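(* Every finitely generated Novikov conformal algebra (over a field of characteristic zero) is special.
   Context: Throughout, $\Bbbk$ is a field of characteristic zero, $\mathbb Z_+$ is the set of nonnegative integers. Conformal algebra: a linear space $C$ over $\Bbbk$ with a linear operator $\partial: C\to C$ and a bilinear operation $(\cdot\,{}_{(\lambda)}\,\cdot): C\times C\to C[\lambda]$ ($\lambda$ a formal variable) such that $(\partial a\,{}_{(\lambda)}\, b) = -\lambda (a\,{}_{(\lambda)}\, b)$ and $\partial(a\,{}_{(\lambda)}\, b) = (a\,{}_{(\lambda)}\,\partial b) - \lambda (a\,{}_{(\lambda)}\, b)$ for all $a,b\in C$. The $n$-products $(a\,{}_{(n)}\,b)\in C$, $n\in\mathbb Z_+$, are defined by $(a\,{}_{(\lambda)}\, b)=\sum_{n\ge 0}\frac{\lambda^n}{n!}(a\,{}_{(n)}\,b)$. Homomorphisms of conformal algebras are linear maps commuting with $\partial$ and preserving all $n$-products; subalgebras are subspaces closed under $\partial$ and all $n$-products. A conformal algebra is finitely generated if it coincides with the smallest subalgebra containing some finite subset. In identities, $(a\,{}_{(-\partial-\lambda)}\,b)$ denotes the result of substituting the operator $-\partial-\lambda$ for the variable $\lambda$ in $(a\,{}_{(\lambda)}\,b)$, i.e. $\sum_{n\ge 0}\frac{(-\partial-\lambda)^n}{n!}(a\,{}_{(n)}\,b)$. Commutative conformal algebra: a conformal algebra satisfying $a\,{}_{(\lambda)}\,(b\,{}_{(\mu)}\,c) = (a\,{}_{(\lambda)}\,b)\,{}_{(\lambda+\mu)}\,c$ and $(a\,{}_{(\lambda)}\,b)=(b\,{}_{(-\partial-\lambda)}\,a)$.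 Novikov conformal algebra: a conformal algebra satisfying $(a\,{}_{(\lambda)}\,b)\,{}_{(\lambda+\mu)}\,c - a\,{}_{(\lambda)}\,(b\,{}_{(\mu)}\,c) = (a\,{}_{(\lambda)}\,c)\,{}_{(-\partial-\mu)}\,b - a\,{}_{(\lambda)}\,(c\,{}_{(-\partial-\mu)}\,b)$ and $a\,{}_{(\lambda)}\,(b\,{}_{(\mu)}\,c)=b\,{}_{(\mu)}\,(a\,{}_{(\lambda)}\,c)$. A derivation of a conformal algebra $C$ is a linear map $D:C\to C$ with $D\partial=\partial D$ and $D(a\,{}_{(\lambda)}\,b)=(D(a)\,{}_{(\lambda)}\,b)+(a\,{}_{(\lambda)}\,D(b))$. If $C$ is a commutative conformal algebra with a derivation $D$, then $C^{(D)}$ denotes the Novikov conformal algebra on the same space $C$ with the same $\partial$ and the operation $(a\,{}_{\circ(\lambda)}\,b)=(Da\,{}_{(\lambda)}\,b)$. A Novikov conformal algebra $V$ is special if there exist a commutative conformal algebra $C$ and a derivation $D$ of $C$ such that $V$ is isomorphic to a subalgebra of $C^{(D)}$. *)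

theory Defs
  imports "HOL-Computational_Algebra.Polynomial" "HOL-Library.Function_Algebras"
begin

section \<open>Conformal algebras\<close>

text \<open>
  The underlying space \<open>cspace C\<close> is a linear subspace of an ambient type \<open>'v\<close> that is a vector space
  over \<open>'k\<close> (it may be all of \<open>'v\<close>); the operations matter only on \<open>cspace C\<close>.
  The \<open>\<lambda>\<close>-product takes values in polynomials with coefficients in \<open>'v\<close>, so \<open>pCons 0\<close> is
  multiplication by \<open>\<lambda>\<close>.
\<close>

record (overloaded) ('k, 'v :: zero) conformal =
  cspace :: "'v set"
  cscale :: "'k \<Rightarrow> 'v \<Rightarrow> 'v"
  cdel :: "'v \<Rightarrow> 'v"
  clprod :: "'v \<Rightarrow> 'v \<Rightarrow> 'v poly"

definition linear_between ::
  "('k, 'v :: ab_group_add) conformal \<Rightarrow> ('k, 'w :: ab_group_add) conformal \<Rightarrow> ('v \<Rightarrow> 'w) \<Rightarrow> bool"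
  where "linear_between A B f \<longleftrightarrow>
    (\<forall>x\<in>cspace A. f x \<in> cspace B) \<and>
    (\<forall>x\<in>cspace A. \<forall>y\<in>cspace A. f (x + y) = f x + f y) \<and>
    (\<forall>c. \<forall>x\<in>cspace A. f (cscale A c x) = cscale B c (f x))"

locale conformal_algebra = vector_space "cscale C"
  for C :: "('k :: field_char_0, 'v :: ab_group_add) conformal" +
  assumes subspace_cspace: "subspace (cspace C)"
    and linear_cdel: "linear_between C C (cdel C)"
    and clprod_closed:
      "\<lbrakk>a \<in> cspace C; b \<in> cspace C\<rbrakk> \<Longrightarrow> coeff (clprod C a b) n \<in> cspace C"
    and clprod_add_left:
      "\<lbrakk>a \<in> cspace C; a' \<in> cspace C; b \<in> cspace C\<rbrakk> \<Longrightarrow>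
        clprod C (a + a') b = clprod C a b + clprod C a' b"
    and clprod_add_right:
      "\<lbrakk>a \<in> cspace C; b \<in> cspace C; b' \<in> cspace C\<rbrakk> \<Longrightarrow>
        clprod C a (b + b') = clprod C a b + clprod C a b'"
    and clprod_scale_left:
      "\<lbrakk>a \<in> cspace C; b \<in> cspace C\<rbrakk> \<Longrightarrow>
        clprod C (cscale C c a) b = map_poly (cscale C c) (clprod C a b)"
    and clprod_scale_right:
      "\<lbrakk>a \<in> cspace C; b \<in> cspace C\<rbrakk> \<Longrightarrow>
        clprod C a (cscale C c b) = map_poly (cscale C c) (clprod C a b)"
    and clprod_del_left:
      "\<lbrakk>a \<in> cspace C; b \<in> cspace C\<rbrakk> \<Longrightarrow>
        clprod C (cdel C a) b = - pCons 0 (clprod C a b)"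
    and del_clprod:
      "\<lbrakk>a \<in> cspace C; b \<in> cspace C\<rbrakk> \<Longrightarrow>
        map_poly (cdel C) (clprod C a b) = clprod C a (cdel C b) - pCons 0 (clprod C a b)"

definition nprod ::
  "('k :: field_char_0, 'v :: ab_group_add) conformal \<Rightarrow> 'v \<Rightarrow> nat \<Rightarrow> 'v \<Rightarrow> 'v"
  where "nprod C a n b = cscale C (fact n) (coeff (clprod C a b) n)"

definition conformal_hom ::
  "('k :: field_char_0, 'v :: ab_group_add) conformal \<Rightarrow> ('k, 'w :: ab_group_add) conformal
    \<Rightarrow> ('v \<Rightarrow> 'w) \<Rightarrow> bool"
  where "conformal_hom A B f \<longleftrightarrow>
    linear_between A B f \<and>
    (\<forall>a\<in>cspace A. f (cdel A a) = cdel B (f a)) \<and>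
    (\<forall>a\<in>cspace A. \<forall>b\<in>cspace A. \<forall>n. f (nprod A a n b) = nprod B (f a) n (f b))"

definition conformal_iso ::
  "('k :: field_char_0, 'v :: ab_group_add) conformal \<Rightarrow> ('k, 'w :: ab_group_add) conformal
    \<Rightarrow> ('v \<Rightarrow> 'w) \<Rightarrow> bool"
  where "conformal_iso A B f \<longleftrightarrow> conformal_hom A B f \<and> bij_betw f (cspace A) (cspace B)"

definition conformal_subalgebra ::
  "('k :: field_char_0, 'v :: ab_group_add) conformal \<Rightarrow> 'v set \<Rightarrow> bool"
  where "conformal_subalgebra C S \<longleftrightarrow>
    S \<subseteq> cspace C \<and> module.subspace (cscale C) S \<and>
    (\<forall>a\<in>S. cdel C a \<in> S) \<and>
    (\<forall>a\<in>S. \<forall>b\<in>S. \<forall>n. nprod C a n b \<in> S)"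

definition finitely_generated ::
  "('k :: field_char_0, 'v :: ab_group_add) conformal \<Rightarrow> bool"
  where "finitely_generated C \<longleftrightarrow>
    (\<exists>X. finite X \<and> X \<subseteq> cspace C \<and> conformal_subalgebra C hull X = cspace C)"


section \<open>Substituting operators for the variable\<close>

text \<open>
  \<open>subst_op T \<iota> p\<close> is \<open>\<Sum>n. T\<^sup>n (\<iota> p\<^sub>n)\<close>: the operator \<open>T\<close> is substituted for the variable of
  \<open>p = \<Sum>n. \<lambda>\<^sup>n p\<^sub>n\<close>, and \<open>\<iota>\<close> maps the coefficients into the space on which \<open>T\<close> acts.
\<close>

definition subst_op ::
  "('w :: ab_group_add \<Rightarrow> 'w) \<Rightarrow> ('v :: zero \<Rightarrow> 'w) \<Rightarrow> 'v poly \<Rightarrow> 'w"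
  where "subst_op T \<iota> p = (\<Sum>n\<le>degree p. (T ^^ n) (\<iota> (coeff p n)))"

text \<open>
  \<open>subst_neg C p\<close> is \<open>p\<close> with \<open>-\<partial> - \<lambda>\<close> substituted for \<open>\<lambda>\<close>; it sends \<open>(a \<^sub>\<lambda> b)\<close> to \<open>(a \<^sub>-\<^sub>\<partial>\<^sub>-\<^sub>\<lambda> b)\<close>.
\<close>

definition subst_neg :: "('k, 'v :: ab_group_add) conformal \<Rightarrow> 'v poly \<Rightarrow> 'v poly"
  where "subst_neg C =
    subst_op (\<lambda>q. - map_poly (cdel C) q - pCons 0 q) (\<lambda>v. [:v:])"

text \<open>
  Identities in two variables live in \<open>C[\<lambda>][\<mu>]\<close>, represented by \<open>'v poly poly\<close> with inner variable
  \<open>\<lambda>\<close> and outer variable \<open>\<mu>\<close>. The operators below are multiplication by \<open>\<lambda>\<close>, by \<open>\<mu>\<close> and by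
  \<open>\<lambda> + \<mu>\<close>, and \<open>-\<partial> - \<mu>\<close>.
\<close>

definition op_lam :: "'v :: ab_group_add poly poly \<Rightarrow> 'v poly poly"
  where "op_lam w = map_poly (pCons 0) w"

definition op_mu :: "'v :: ab_group_add poly poly \<Rightarrow> 'v poly poly"
  where "op_mu w = pCons 0 w"

definition op_lam_mu :: "'v :: ab_group_add poly poly \<Rightarrow> 'v poly poly"
  where "op_lam_mu w = op_lam w + op_mu w"

definition op_neg_mu ::
  "('k, 'v :: ab_group_add) conformal \<Rightarrow> 'v poly poly \<Rightarrow> 'v poly poly"
  where "op_neg_mu C w = - map_poly (map_poly (cdel C)) w - op_mu w"

definition const2 :: "'v :: zero \<Rightarrow> 'v poly poly"
  where "const2 v = [:[:v:]:]"

text \<open>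
  \<open>lprod_right C S T a q\<close> is \<open>(a \<^sub>S q)\<close> where \<open>q\<close> is a polynomial in the variable \<open>T\<close> with
  coefficients in \<open>C\<close>, and \<open>lprod_left C S T p c\<close> is \<open>(p \<^sub>T c)\<close> where \<open>p\<close> is a polynomial in the
  variable \<open>S\<close> with coefficients in \<open>C\<close>.
\<close>

definition lprod_right ::
  "('k, 'v :: ab_group_add) conformal \<Rightarrow> ('v poly poly \<Rightarrow> 'v poly poly)
    \<Rightarrow> ('v poly poly \<Rightarrow> 'v poly poly) \<Rightarrow> 'v \<Rightarrow> 'v poly \<Rightarrow> 'v poly poly"
  where "lprod_right C S T a q = subst_op T (\<lambda>v. subst_op S const2 (clprod C a v)) q"

definition lprod_left ::
  "('k, 'v :: ab_group_add) conformal \<Rightarrow> ('v poly poly \<Rightarrow> 'v poly poly)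
    \<Rightarrow> ('v poly poly \<Rightarrow> 'v poly poly) \<Rightarrow> 'v poly \<Rightarrow> 'v \<Rightarrow> 'v poly poly"
  where "lprod_left C S T p c = subst_op S (\<lambda>v. subst_op T const2 (clprod C v c)) p"


section \<open>Commutative and Novikov conformal algebras\<close>

locale commutative_conformal_algebra = conformal_algebra +
  assumes assoc:
    "\<lbrakk>a \<in> cspace C; b \<in> cspace C; c \<in> cspace C\<rbrakk> \<Longrightarrow>
      lprod_right C op_lam op_mu a (clprod C b c) = lprod_left C op_lam op_lam_mu (clprod C a b) c"
    and commut:
    "\<lbrakk>a \<in> cspace C; b \<in> cspace C\<rbrakk> \<Longrightarrow> clprod C a b = subst_neg C (clprod C b a)"

text \<open>
  In \<open>a \<^sub>\<lambda> (c \<^sub>-\<^sub>\<partial>\<^sub>-\<^sub>\<mu> b)\<close> the operator \<open>\<partial>\<close> acts on the inner product: \<open>subst_neg\<close> yields a polynomial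
  in \<open>\<mu>\<close>, to whose coefficients \<open>a \<^sub>\<lambda>\<close> is then applied.
\<close>

locale novikov_conformal_algebra = conformal_algebra +
  assumes right_symmetric:
    "\<lbrakk>a \<in> cspace C; b \<in> cspace C; c \<in> cspace C\<rbrakk> \<Longrightarrow>
      lprod_left C op_lam op_lam_mu (clprod C a b) c
        - lprod_right C op_lam op_mu a (clprod C b c)
      = lprod_left C op_lam (op_neg_mu C) (clprod C a c) b
        - lprod_right C op_lam op_mu a (subst_neg C (clprod C c b))"
    and left_commutative:
    "\<lbrakk>a \<in> cspace C; b \<in> cspace C; c \<in> cspace C\<rbrakk> \<Longrightarrow>
      lprod_right C op_lam op_mu a (clprod C b c) = lprod_right C op_mu op_lam b (clprod C a c)"

definition conformal_derivation ::
  "('k :: field_char_0, 'v :: ab_group_add) conformal \<Rightarrow> ('v \<Rightarrow> 'v) \<Rightarrow> bool"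
  where "conformal_derivation C D \<longleftrightarrow>
    linear_between C C D \<and>
    (\<forall>a\<in>cspace C. D (cdel C a) = cdel C (D a)) \<and>
    (\<forall>a\<in>cspace C. \<forall>b\<in>cspace C.
      map_poly D (clprod C a b) = clprod C (D a) b + clprod C a (D b))"

definition derived_algebra ::
  "('k, 'v :: ab_group_add) conformal \<Rightarrow> ('v \<Rightarrow> 'v) \<Rightarrow> ('k, 'v) conformal"
  where "derived_algebra C D = C\<lparr>clprod := (\<lambda>a b. clprod C (D a) b)\<rparr>"

text \<open>\<open>V\<close> is isomorphic, via \<open>f\<close>, to a subalgebra of \<open>C\<^sup>(\<^sup>D\<^sup>)\<close> with \<open>C\<close> commutative.\<close>

definition special_via ::
  "('k :: field_char_0, 'v :: ab_group_add) conformal \<Rightarrow> ('k, 'w :: ab_group_add) conformal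
    \<Rightarrow> ('w \<Rightarrow> 'w) \<Rightarrow> 'w set \<Rightarrow> ('v \<Rightarrow> 'w) \<Rightarrow> bool"
  where "special_via V C D S f \<longleftrightarrow>
    commutative_conformal_algebra C \<and> conformal_derivation C D \<and>
    conformal_subalgebra (derived_algebra C D) S \<and>
    conformal_iso V ((derived_algebra C D)\<lparr>cspace := S\<rparr>) f"

text \<open>
  HOL cannot quantify existentially over the ambient type of \<open>C\<close>, so \<open>special\<close> fixes one:
  scalar-valued functions on the monomials formed from elements of \<open>V\<close> by \<open>\<partial>\<close>, \<open>D\<close> and the
  \<open>n\<close>-products. The theorem \<open>special_universal\<close> at the end of this theory shows that this is no
  restriction: a \<open>C\<close> over any type whatsoever can be replaced by one over this type.
\<close>

datatype 'v monomial =
  Gen 'v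
| Del "'v monomial"
| Der "'v monomial"
| Prod "'v monomial" nat "'v monomial"

definition special :: "('k :: field_char_0, 'v :: ab_group_add) conformal \<Rightarrow> bool"
  where "special V \<longleftrightarrow>
    (\<exists>(C :: ('k, 'v monomial \<Rightarrow> 'k) conformal) D S f. special_via V C D S f)"


section \<open>Independence of the ambient type\<close>

definition polys_over :: "'a :: zero set \<Rightarrow> 'a poly set"
  where "polys_over A = {p. \<forall>n. coeff p n \<in> A}"

lemma subst_op_transport:
  assumes p: "p \<in> polys_over A"
    and psi: "\<psi> 0 = 0" "\<And>x. x \<in> A \<Longrightarrow> \<psi> x = 0 \<Longrightarrow> x = 0"
    and W: "0 \<in> W" "\<And>x y. x \<in> W \<Longrightarrow> y \<in> W \<Longrightarrow> x + y \<in> W" "\<And>x. x \<in> W \<Longrightarrow> T x \<in> W"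
    and Phi: "\<Phi> 0 = 0" "\<And>x y. x \<in> W \<Longrightarrow> y \<in> W \<Longrightarrow> \<Phi> (x + y) = \<Phi> x + \<Phi> y"
      "\<And>x. x \<in> W \<Longrightarrow> \<Phi> (T x) = T' (\<Phi> x)"
    and \<iota>: "\<And>x. x \<in> A \<Longrightarrow> \<iota> x \<in> W" "\<And>x. x \<in> A \<Longrightarrow> \<Phi> (\<iota> x) = \<iota>' (\<psi> x)"
  shows "subst_op T \<iota> p \<in> W" "\<Phi> (subst_op T \<iota> p) = subst_op T' \<iota>' (map_poly \<psi> p)"
proof -
  have c: "coeff p n \<in> A" for n using p by (simp add: polys_over_def)
  have deg: "degree (map_poly \<psi> p) = degree p"
  proof (cases "p = 0")
    case False
    then have "\<psi> (lead_coeff p) \<noteq> 0" using psi(2)[OF c, of "degree p"] leading_coeff_0_iff by blast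
    then have "coeff (map_poly \<psi> p) (degree p) \<noteq> 0" by (simp add: coeff_map_poly psi)
    moreover have "degree (map_poly \<psi> p) \<le> degree p"
      by (intro degree_le) (simp add: coeff_map_poly psi coeff_eq_0)
    ultimately show ?thesis by (meson le_antisym le_degree)
  qed simp
  have pow: "(T ^^ n) x \<in> W \<and> \<Phi> ((T ^^ n) x) = (T' ^^ n) (\<Phi> x)" if "x \<in> W" for n x
    by (induction n) (use that W Phi in auto)
  have S: "(\<Sum>n\<in>N. (T ^^ n) (\<iota> (coeff p n))) \<in> W \<and>
      \<Phi> (\<Sum>n\<in>N. (T ^^ n) (\<iota> (coeff p n))) = (\<Sum>n\<in>N. (T' ^^ n) (\<iota>' (\<psi> (coeff p n))))"
    if "finite N" for N :: "nat set"
    using that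
  proof induction
    case (insert n N)
    have "(T ^^ n) (\<iota> (coeff p n)) \<in> W"
      "\<Phi> ((T ^^ n) (\<iota> (coeff p n))) = (T' ^^ n) (\<iota>' (\<psi> (coeff p n)))"
      using pow[OF \<iota>(1)[OF c]] \<iota>(2)[OF c] by auto
    with insert W(2) Phi(2) show ?case by simp
  qed (use W Phi in auto)
  show "subst_op T \<iota> p \<in> W" using S by (simp add: subst_op_def)
  show "\<Phi> (subst_op T \<iota> p) = subst_op T' \<iota>' (map_poly \<psi> p)"
    using S by (simp add: subst_op_def deg coeff_map_poly psi)
qed

lemma commutative_restrict:
  fixes C :: "('k :: field_char_0, 'v :: ab_group_add) conformal"
  assumes C: "commutative_conformal_algebra C"
    and S: "S \<subseteq> cspace C" "module.subspace (cscale C) S" "\<And>a. a \<in> S \<Longrightarrow> cdel C a \<in> S"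
      "\<And>a b n. a \<in> S \<Longrightarrow> b \<in> S \<Longrightarrow> coeff (clprod C a b) n \<in> S"
  shows "commutative_conformal_algebra (C\<lparr>cspace := S\<rparr>)"
proof -
  interpret commutative_conformal_algebra C by fact
  have [simp]: "lprod_right (C\<lparr>cspace := S\<rparr>) = lprod_right C"
    "lprod_left (C\<lparr>cspace := S\<rparr>) = lprod_left C" "subst_neg (C\<lparr>cspace := S\<rparr>) = subst_neg C"
    by (simp_all add: fun_eq_iff lprod_right_def lprod_left_def subst_neg_def)
  have lin: "linear_between (C\<lparr>cspace := S\<rparr>) (C\<lparr>cspace := S\<rparr>) (cdel C)"
    using linear_cdel S(1) S(3) by (simp add: linear_between_def subset_iff)
  have vs: "vector_space (cscale C)" by unfold_locales
  show ?thesis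
  proof (intro commutative_conformal_algebra.intro conformal_algebra.intro
      conformal_algebra_axioms.intro commutative_conformal_algebra_axioms.intro)
  qed (simp_all add: vs lin S subsetD[OF S(1)] clprod_add_left clprod_add_right clprod_scale_left
      clprod_scale_right clprod_del_left del_clprod assoc commut[symmetric])
qed

lemma linear_between_zero:
  assumes "linear_between A B f" "0 \<in> cspace A"
  shows "f 0 = 0"
proof -
  have "f (0 + 0) = f 0 + f 0" using assms unfolding linear_between_def by blast
  then show ?thesis by simp
qed

locale conformal_transport =
  commutative_conformal_algebra C + W: vector_space s
  for C :: "('k :: field_char_0, 'v :: ab_group_add) conformal"
    and s :: "'k \<Rightarrow> 'w :: ab_group_add \<Rightarrow> 'w" +
  fixes \<psi> :: "'v \<Rightarrow> 'w"
  assumes psi_add: "\<psi> (x + y) = \<psi> x + \<psi> y"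
    and psi_scale: "\<psi> (cscale C c x) = s c (\<psi> x)"
    and psi_inj: "inj_on \<psi> (cspace C)"
begin

definition \<chi> :: "'w \<Rightarrow> 'v" where "\<chi> = inv_into (cspace C) \<psi>"

lemma chi [simp]: "x \<in> cspace C \<Longrightarrow> \<chi> (\<psi> x) = x"
  by (simp add: \<chi>_def psi_inj)

definition image_algebra :: "('k, 'w) conformal" where
  "image_algebra = \<lparr>cspace = \<psi> ` cspace C, cscale = s, cdel = (\<lambda>x. \<psi> (cdel C (\<chi> x))),
    clprod = (\<lambda>x y. map_poly \<psi> (clprod C (\<chi> x) (\<chi> y)))\<rparr>"

lemma sel [simp]:
  "cspace image_algebra = \<psi> ` cspace C" "cscale image_algebra = s"
  "cdel image_algebra = (\<lambda>x. \<psi> (cdel C (\<chi> x)))"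
  "clprod image_algebra = (\<lambda>x y. map_poly \<psi> (clprod C (\<chi> x) (\<chi> y)))"
  by (simp_all add: image_algebra_def)

lemma zero_in: "0 \<in> cspace C" and add_in: "x \<in> cspace C \<Longrightarrow> y \<in> cspace C \<Longrightarrow> x + y \<in> cspace C"
  and scale_in: "x \<in> cspace C \<Longrightarrow> cscale C c x \<in> cspace C"
  using subspace_cspace by (auto simp: subspace_def)

lemma diff_in: "x \<in> cspace C \<Longrightarrow> y \<in> cspace C \<Longrightarrow> x - y \<in> cspace C"
  using subspace_cspace by (rule subspace_diff)
lemma neg_in: "x \<in> cspace C \<Longrightarrow> - x \<in> cspace C"
  using subspace_cspace by (rule subspace_neg)

lemma psi_0 [simp]: "\<psi> 0 = 0" using psi_add[of 0 0] by simp
lemma psi_minus: "\<psi> (- x) = - \<psi> x"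
  using psi_add[of x "- x"] by (simp add: eq_neg_iff_add_eq_0 add.commute)
lemma psi_diff: "\<psi> (x - y) = \<psi> x - \<psi> y"
  using psi_add[of x "- y"] by (simp add: psi_minus)
lemma psi_eq_0: "x \<in> cspace C \<Longrightarrow> \<psi> x = 0 \<Longrightarrow> x = 0"
  using psi_inj zero_in psi_0 by (metis inj_onD)

lemma chi_0 [simp]: "\<chi> 0 = 0" using chi[OF zero_in] by simp

lemma chi_add [simp]: "x \<in> cspace C \<Longrightarrow> y \<in> cspace C \<Longrightarrow> \<chi> (\<psi> x + \<psi> y) = x + y"
  using chi[OF add_in] by (simp add: psi_add)
lemma chi_scale [simp]: "x \<in> cspace C \<Longrightarrow> \<chi> (s c (\<psi> x)) = cscale C c x"
  using chi[OF scale_in] by (simp add: psi_scale)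

lemma del_in: "x \<in> cspace C \<Longrightarrow> cdel C x \<in> cspace C"
  and del_add: "x \<in> cspace C \<Longrightarrow> y \<in> cspace C \<Longrightarrow> cdel C (x + y) = cdel C x + cdel C y"
  and del_scale: "x \<in> cspace C \<Longrightarrow> cdel C (cscale C c x) = cscale C c (cdel C x)"
  using linear_cdel by (auto simp: linear_between_def)

lemma del_0 [simp]: "cdel C 0 = 0"
  using linear_between_zero[OF linear_cdel zero_in] .

abbreviation P where "P \<equiv> map_poly \<psi>"
abbreviation PP where "PP \<equiv> map_poly P"
abbreviation A where "A \<equiv> cspace C"
abbreviation A1 where "A1 \<equiv> polys_over A"
abbreviation A2 where "A2 \<equiv> polys_over A1"

lemma A1_closed: "0 \<in> A1" "p \<in> A1 \<Longrightarrow> q \<in> A1 \<Longrightarrow> p + q \<in> A1" "p \<in> A1 \<Longrightarrow> - p \<in> A1"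
  "p \<in> A1 \<Longrightarrow> q \<in> A1 \<Longrightarrow> p - q \<in> A1" "p \<in> A1 \<Longrightarrow> pCons 0 p \<in> A1"
  "p \<in> A1 \<Longrightarrow> map_poly (cdel C) p \<in> A1" "x \<in> A \<Longrightarrow> [:x:] \<in> A1"
  by (auto simp: polys_over_def zero_in add_in diff_in neg_in coeff_pCons coeff_map_poly del_in
      split: nat.splits)

lemma A2_closed: "0 \<in> A2" "p \<in> A2 \<Longrightarrow> q \<in> A2 \<Longrightarrow> p + q \<in> A2" "p \<in> A2 \<Longrightarrow> - p \<in> A2"
  "p \<in> A2 \<Longrightarrow> q \<in> A2 \<Longrightarrow> p - q \<in> A2" "p \<in> A2 \<Longrightarrow> op_mu p \<in> A2" "p \<in> A2 \<Longrightarrow> op_lam p \<in> A2"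
  "p \<in> A2 \<Longrightarrow> op_lam_mu p \<in> A2" "x \<in> A \<Longrightarrow> const2 x \<in> A2"
  using A1_closed
  by (auto simp: polys_over_def[of A1] op_mu_def op_lam_def op_lam_mu_def const2_def
      coeff_pCons coeff_map_poly split: nat.splits)

lemma P_add: "P (p + q) = P p + P q"
  by (rule poly_eqI) (simp add: coeff_map_poly psi_add)
lemma P_diff: "P (p - q) = P p - P q"
  by (rule poly_eqI) (simp add: coeff_map_poly psi_diff)
lemma P_minus: "P (- p) = - P p"
  by (rule poly_eqI) (simp add: coeff_map_poly psi_minus)
lemma P_pCons: "P (pCons x p) = pCons (\<psi> x) (P p)"
  by (simp add: map_poly_pCons)
lemma P_del: "p \<in> A1 \<Longrightarrow> P (map_poly (cdel C) p) = map_poly (cdel image_algebra) (P p)"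
  by (rule poly_eqI) (simp add: coeff_map_poly polys_over_def)
lemma P_eq_0: "p \<in> A1 \<Longrightarrow> P p = 0 \<Longrightarrow> p = 0"
  by (metis (no_types, lifting) coeff_0 coeff_map_poly mem_Collect_eq poly_eqI polys_over_def psi_0
      psi_eq_0)

lemma PP_add: "PP (p + q) = PP p + PP q"
  by (rule poly_eqI) (simp add: coeff_map_poly P_add)
lemma PP_op_mu: "PP (op_mu p) = op_mu (PP p)"
  by (simp add: op_mu_def map_poly_pCons)
lemma PP_op_lam: "PP (op_lam p) = op_lam (PP p)"
  by (rule poly_eqI) (simp add: op_lam_def coeff_map_poly P_pCons)
lemma PP_op_lam_mu: "PP (op_lam_mu p) = op_lam_mu (PP p)"
  by (simp add: op_lam_mu_def PP_add PP_op_mu PP_op_lam)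
lemma PP_const2: "PP (const2 x) = const2 (\<psi> x)"
  by (simp add: const2_def map_poly_pCons)

lemma lp_in: "a \<in> A \<Longrightarrow> b \<in> A \<Longrightarrow> clprod C a b \<in> A1"
  by (simp add: polys_over_def clprod_closed)

lemma lp_image: "a \<in> A \<Longrightarrow> b \<in> A \<Longrightarrow> clprod image_algebra (\<psi> a) (\<psi> b) = P (clprod C a b)"
  by simp

lemma P_subst_neg:
  assumes "p \<in> A1"
  shows "P (subst_neg C p) = subst_neg image_algebra (P p)"
  unfolding subst_neg_def
  by (rule subst_op_transport(2)[where A = A and W = A1, OF assms])
    (use A1_closed in \<open>auto simp: P_add P_diff P_minus P_pCons P_del psi_eq_0 map_poly_pCons
      simp del: sel\<close>)

lemma subst2:
  assumes "p \<in> A1" and T: "\<And>w. w \<in> A2 \<Longrightarrow> T w \<in> A2" "\<And>w. w \<in> A2 \<Longrightarrow> PP (T w) = T' (PP w)"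
    and "\<And>x. x \<in> A \<Longrightarrow> \<iota> x \<in> A2" "\<And>x. x \<in> A \<Longrightarrow> PP (\<iota> x) = \<iota>' (\<psi> x)"
  shows "subst_op T \<iota> p \<in> A2" "PP (subst_op T \<iota> p) = subst_op T' \<iota>' (P p)"
  by (rule subst_op_transport[where A = A and W = A2 and \<Phi> = PP and \<psi> = \<psi>];
      use assms A2_closed in \<open>auto simp: PP_add psi_eq_0\<close>)+

lemma PP_lprod_right:
  assumes "a \<in> A" "q \<in> A1"
    and S: "\<And>w. w \<in> A2 \<Longrightarrow> S w \<in> A2" "\<And>w. w \<in> A2 \<Longrightarrow> PP (S w) = S' (PP w)"
    and T: "\<And>w. w \<in> A2 \<Longrightarrow> T w \<in> A2" "\<And>w. w \<in> A2 \<Longrightarrow> PP (T w) = T' (PP w)"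
  shows "PP (lprod_right C S T a q) = lprod_right image_algebra S' T' (\<psi> a) (P q)"
  unfolding lprod_right_def
proof (rule subst2(2)[where T = T and T' = T'])
  fix x assume x: "x \<in> A"
  have "subst_op S const2 (clprod C a x) \<in> A2 \<and> PP (subst_op S const2 (clprod C a x))
      = subst_op S' const2 (P (clprod C a x))"
    by (intro conjI subst2[where T = S and T' = S'])
      (use assms x lp_in A2_closed in \<open>auto simp: PP_const2\<close>)
  then show "subst_op S const2 (clprod C a x) \<in> A2"
    "PP (subst_op S const2 (clprod C a x))
      = subst_op S' const2 (clprod image_algebra (\<psi> a) (\<psi> x))"
    using assms x by simp_all
qed (use assms in auto)

lemma PP_lprod_left:
  assumes "p \<in> A1" "c \<in> A"
    and S: "\<And>w. w \<in> A2 \<Longrightarrow> S w \<in> A2" "\<And>w. w \<in> A2 \<Longrightarrow> PP (S w) = S' (PP w)"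
    and T: "\<And>w. w \<in> A2 \<Longrightarrow> T w \<in> A2" "\<And>w. w \<in> A2 \<Longrightarrow> PP (T w) = T' (PP w)"
  shows "PP (lprod_left C S T p c) = lprod_left image_algebra S' T' (P p) (\<psi> c)"
  unfolding lprod_left_def
proof (rule subst2(2)[where T = S and T' = S'])
  fix x assume x: "x \<in> A"
  have "subst_op T const2 (clprod C x c) \<in> A2 \<and> PP (subst_op T const2 (clprod C x c))
      = subst_op T' const2 (P (clprod C x c))"
    by (intro conjI subst2[where T = T and T' = T'])
      (use assms x lp_in A2_closed in \<open>auto simp: PP_const2\<close>)
  then show "subst_op T const2 (clprod C x c) \<in> A2"
    "PP (subst_op T const2 (clprod C x c))
      = subst_op T' const2 (clprod image_algebra (\<psi> x) (\<psi> c))"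
    using assms x by simp_all
qed (use assms in auto)

lemma P_scale: "P (map_poly (cscale C c) p) = map_poly (s c) (P p)"
  by (rule poly_eqI) (simp add: coeff_map_poly psi_scale)

lemma image_algebra: "commutative_conformal_algebra image_algebra"
proof
  show "module.subspace (cscale image_algebra) (cspace image_algebra)"
  proof (simp, rule W.subspaceI)
    show "0 \<in> \<psi> ` A" using zero_in psi_0 by (metis imageI)
  qed (auto simp flip: psi_add psi_scale intro!: add_in scale_in)
  show "linear_between image_algebra image_algebra (cdel image_algebra)"
    unfolding linear_between_def
    by (auto simp: del_in del_add del_scale psi_add psi_scale)
  fix a b c assume "a \<in> cspace image_algebra" "b \<in> cspace image_algebra" "c \<in> cspace image_algebra"
  then obtain x y z where a: "a = \<psi> x" "x \<in> A" and b: "b = \<psi> y" "y \<in> A" and c: "c = \<psi> z" "z \<in> A"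
    by auto
  have "PP (lprod_right C op_lam op_mu x (clprod C y z))
      = PP (lprod_left C op_lam op_lam_mu (clprod C x y) z)"
    using assoc a b c by simp
  then show "lprod_right image_algebra op_lam op_mu a (clprod image_algebra b c) =
       lprod_left image_algebra op_lam op_lam_mu (clprod image_algebra a b) c"
    unfolding a b c using a(2) b(2) c(2)
    by (simp add: lp_image lp_in PP_lprod_left[where S' = op_lam and T' = op_lam_mu]
        PP_lprod_right[where S' = op_lam and T' = op_mu]
        A2_closed PP_op_lam PP_op_mu PP_op_lam_mu del: sel)
next
  fix a b assume "a \<in> cspace image_algebra" "b \<in> cspace image_algebra"
  then obtain x y where a: "a = \<psi> x" "x \<in> A" and b: "b = \<psi> y" "y \<in> A"
    by auto
  have "P (clprod C x y) = P (subst_neg C (clprod C y x))"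
    using commut[OF a(2) b(2)] by (rule arg_cong)
  then show "clprod image_algebra a b = subst_neg image_algebra (clprod image_algebra b a)"
    unfolding a b using a(2) b(2) by (simp add: lp_image lp_in P_subst_neg del: sel)
  show "coeff (clprod image_algebra a b) n \<in> cspace image_algebra" for n
    using a b by (simp add: coeff_map_poly clprod_closed)
  show "clprod image_algebra (cscale image_algebra c a) b =
       map_poly (cscale image_algebra c) (clprod image_algebra a b)" for c
    using a b by (simp add: P_scale clprod_scale_left)
  show "clprod image_algebra a (cscale image_algebra c b) =
       map_poly (cscale image_algebra c) (clprod image_algebra a b)" for c
    using a b by (simp add: P_scale clprod_scale_right)
  show "clprod image_algebra (cdel image_algebra a) b = - pCons 0 (clprod image_algebra a b)"
    using a b by (simp add: del_in clprod_del_left P_minus P_pCons)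
  have "P (map_poly (cdel C) (clprod C x y)) = P (clprod C x (cdel C y) - pCons 0 (clprod C x y))"
    using a b by (simp add: del_clprod)
  then show "map_poly (cdel image_algebra) (clprod image_algebra a b) =
       clprod image_algebra a (cdel image_algebra b) - pCons 0 (clprod image_algebra a b)"
    using a b by (simp only: P_del[OF lp_in] P_diff P_pCons lp_image) (simp add: del_in)
next
  fix a b a' assume "a \<in> cspace image_algebra" "a' \<in> cspace image_algebra" "b \<in> cspace image_algebra"
  then show "clprod image_algebra (a + a') b = clprod image_algebra a b + clprod image_algebra a' b"
    by (auto simp: P_add clprod_add_left)
next
  fix a b b' assume "a \<in> cspace image_algebra" "b \<in> cspace image_algebra" "b' \<in> cspace image_algebra"
  then show "clprod image_algebra a (b + b') = clprod image_algebra a b + clprod image_algebra a b'"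
    by (auto simp: P_add clprod_add_right)
qed (simp_all add: W.scale_right_distrib W.scale_left_distrib)

lemma image_derivation:
  assumes "conformal_derivation C D"
  shows "conformal_derivation image_algebra (\<lambda>x. \<psi> (D (\<chi> x)))"
proof -
  have D: "\<And>x. x \<in> A \<Longrightarrow> D x \<in> A" "\<And>x y. x \<in> A \<Longrightarrow> y \<in> A \<Longrightarrow> D (x + y) = D x + D y"
    "\<And>c x. x \<in> A \<Longrightarrow> D (cscale C c x) = cscale C c (D x)" "D 0 = 0"
    "\<And>x. x \<in> A \<Longrightarrow> D (cdel C x) = cdel C (D x)"
    "\<And>x y. x \<in> A \<Longrightarrow> y \<in> A \<Longrightarrow> map_poly D (clprod C x y) = clprod C (D x) y + clprod C x (D y)"
    using assms linear_between_zero[of C C D] zero_in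
    by (auto simp: conformal_derivation_def linear_between_def)
  have "map_poly (\<lambda>x. \<psi> (D (\<chi> x))) (P p) = P (map_poly D p)" if "p \<in> A1" for p
    using that by (intro poly_eqI) (simp add: coeff_map_poly polys_over_def D)
  then show ?thesis
    unfolding conformal_derivation_def linear_between_def
    by (auto simp: D del_in lp_in P_add psi_add psi_scale)
qed

end

primrec monomial_value ::
  "('k :: field_char_0, 'w :: ab_group_add) conformal \<Rightarrow> ('w \<Rightarrow> 'w) \<Rightarrow> ('v \<Rightarrow> 'w) \<Rightarrow> 'v monomial \<Rightarrow> 'w"
  where
    "monomial_value C D g (Gen v) = g v"
  | "monomial_value C D g (Del t) = cdel C (monomial_value C D g t)"
  | "monomial_value C D g (Der t) = D (monomial_value C D g t)"
  | "monomial_value C D g (Prod t n u) =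
      coeff (clprod C (monomial_value C D g t) (monomial_value C D g u)) n"

lemma vector_space_fun: "vector_space (\<lambda>(c :: 'k :: field) f x. c * f x)"
  by unfold_locales (auto simp: fun_eq_iff algebra_simps)

theorem special_universal:
  fixes V :: "('k :: field_char_0, 'v :: ab_group_add) conformal"
    and C :: "('k, 'w :: ab_group_add) conformal"
  assumes "special_via V C D S f"
  shows "special V"
proof -
  have C: "commutative_conformal_algebra C" and D: "conformal_derivation C D"
    and S: "conformal_subalgebra (derived_algebra C D) S"
    and f: "conformal_iso V ((derived_algebra C D)\<lparr>cspace := S\<rparr>) f"
    using assms by (auto simp: special_via_def)
  interpret C: commutative_conformal_algebra C by fact
  have zero: "0 \<in> cspace C" using C.subspace_cspace by (simp add: C.subspace_def)
  have Dl: "linear_between C C D" using D by (simp add: conformal_derivation_def)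
  have SC: "S \<subseteq> cspace C" using S by (auto simp: conformal_subalgebra_def derived_algebra_def)
  have fbij: "bij_betw f (cspace V) S" using f by (auto simp: conformal_iso_def)
  define g where "g v = (if v \<in> cspace V then f v else 0)" for v
  define val where "val = monomial_value C D g"
  define M where "M = range val"
  define C1 where "C1 = C.span M"
  have MC: "M \<subseteq> cspace C"
  proof -
    have "val t \<in> cspace C" for t
      unfolding val_def
    proof (induction t)
      case (Gen v)
      then show ?case using zero fbij SC by (auto simp: g_def bij_betw_def)
    qed (use C.linear_cdel Dl C.clprod_closed in \<open>auto simp: linear_between_def\<close>)
    then show ?thesis by (auto simp: M_def)
  qed
  have C1C: "C1 \<subseteq> cspace C"
    unfolding C1_def by (rule C.span_minimal[OF MC C.subspace_cspace])
  have C1: "C.subspace C1" by (simp add: C1_def)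
  have lin: "h x \<in> C1" if h: "linear_between C C h" "\<And>t. h (val t) \<in> M" and x: "x \<in> C1" for h x
  proof -
    have "x \<in> cspace C \<and> h x \<in> C1"
      using x unfolding C1_def
    proof (induction rule: C.span_induct_alt)
      case base
      then show ?case using linear_between_zero[OF h(1) zero] zero by (simp add: C.span_zero)
    next
      case (step c x y)
      then have "x \<in> cspace C" "h x \<in> M" using h MC by (auto simp: M_def)
      with step h(1) C.subspace_cspace C.span_base[of "h x" M] show ?case
        by (auto simp: linear_between_def C.subspace_def intro!: C.span_add C.span_scale)
    qed
    then show ?thesis ..
  qed
  have C1_del: "cdel C x \<in> C1" if "x \<in> C1" for x
    by (rule lin[OF C.linear_cdel _ that])
      (metis M_def monomial_value.simps(2) rangeI val_def)
  have C1_D: "D x \<in> C1" if "x \<in> C1" for x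
    by (rule lin[OF Dl _ that]) (metis M_def monomial_value.simps(3) rangeI val_def)
  have C1_right: "coeff (clprod C (val t) x) n \<in> C1" if "x \<in> C1" for t x n
  proof (rule lin[OF _ _ that, of "\<lambda>x. coeff (clprod C (val t) x) n"])
    have "val t \<in> cspace C" using MC by (auto simp: M_def)
    then show "linear_between C C (\<lambda>x. coeff (clprod C (val t) x) n)"
      by (auto simp: linear_between_def C.clprod_closed C.clprod_add_right C.clprod_scale_right
          coeff_map_poly)
  qed (metis M_def monomial_value.simps(4) rangeI val_def)
  have C1_prod: "coeff (clprod C x y) n \<in> C1" if x: "x \<in> C1" and y: "y \<in> C1" for x y n
  proof -
    have yC: "y \<in> cspace C" using y C1C by auto
    have 0: "clprod C 0 y = 0" using C.clprod_add_left[OF zero zero yC] by simp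
    have "x \<in> cspace C \<and> coeff (clprod C x y) n \<in> C1"
      using x unfolding C1_def
    proof (induction rule: C.span_induct_alt)
      case base
      then show ?case using 0 zero by (simp add: C.span_zero)
    next
      case (step c x z)
      then have xC: "x \<in> cspace C" and x1: "coeff (clprod C x y) n \<in> C1"
        using C1_right[OF y] MC by (auto simp: M_def)
      have cx: "cscale C c x \<in> cspace C" using xC C.subspace_cspace by (simp add: C.subspace_def)
      have "coeff (clprod C (cscale C c x + z) y) n
          = cscale C c (coeff (clprod C x y) n) + coeff (clprod C z y) n"
        using step cx xC yC by (simp add: C.clprod_add_left C.clprod_scale_left coeff_map_poly)
      moreover have "cscale C c x + z \<in> cspace C"
        using cx step C.subspace_cspace by (simp add: C.subspace_def)
      ultimately show ?case
        using step x1 by (auto simp: C1_def intro!: C.span_add C.span_scale)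
    qed
    then show ?thesis ..
  qed
  define E where "E = C\<lparr>cspace := C1\<rparr>"
  have E: "commutative_conformal_algebra E"
    unfolding E_def by (rule commutative_restrict[OF C C1C C1 C1_del C1_prod])
  have ED: "conformal_derivation E D"
    using D C1C C1_D unfolding E_def conformal_derivation_def linear_between_def
    by (auto simp: subset_iff)
  have SE: "S \<subseteq> C1"
  proof
    fix x assume "x \<in> S"
    then obtain v where "v \<in> cspace V" "x = f v" using fbij by (auto simp: bij_betw_def)
    then have "x = val (Gen v)" by (simp add: val_def g_def)
    then show "x \<in> C1" unfolding C1_def M_def by (auto intro: C.span_base)
  qed
  obtain B where B: "B \<subseteq> M" "C.independent B" "M \<subseteq> C.span B"
    using C.maximal_independent_subset[of M] by metis
  define B' where "B' = C.extend_basis B"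
  have B': "C.independent B'" "C.span B' = UNIV"
    by (simp_all add: B'_def B C.independent_extend_basis)
  have C1B: "C1 = C.span B"
    unfolding C1_def using B
    by (metis C.span_minimal C.span_mono C.subspace_span subset_antisym)
  define \<psi> :: "'w \<Rightarrow> 'v monomial \<Rightarrow> 'k"
    where "\<psi> x t = C.representation B' x (val t)" for x t
  let ?s = "\<lambda>(c :: 'k) (h :: 'v monomial \<Rightarrow> 'k) t. c * h t"
  have "inj_on \<psi> C1"
  proof (rule inj_onI)
    fix x y assume x: "x \<in> C1" and y: "y \<in> C1" and eq: "\<psi> x = \<psi> y"
    define z where "z = x - y"
    have z: "z \<in> C.span B" using x y by (simp add: z_def C1B C.span_diff)
    have r: "C.representation B' z = C.representation B z"
      by (rule C.representation_extend) (use B' z C.extend_basis_superset[OF B(2)] in \<open>auto simp: B'_def\<close>)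
    have "C.representation B z b = 0" for b
    proof (cases "b \<in> B")
      case True
      then obtain t where t: "b = val t" using B(1) by (auto simp: M_def)
      have "C.representation B' z b = \<psi> x t - \<psi> y t"
        by (simp add: z_def t \<psi>_def C.representation_diff B')
      then show ?thesis using eq r by simp
    next
      case False
      then show ?thesis using C.representation_ne_zero by blast
    qed
    then have "z = 0"
      using C.sum_nonzero_representation_eq[OF B(2) z] by simp
    then show "x = y" by (simp add: z_def)
  qed
  then interpret T: conformal_transport E ?s \<psi>
    unfolding conformal_transport_def conformal_transport_axioms_def
    using E vector_space_fun B'
    by (auto simp: \<psi>_def fun_eq_iff E_def C.representation_add C.representation_scale)
  have E_sel: "cspace E = C1" "cscale E = cscale C" "cdel E = cdel C" "clprod E = clprod C"
    by (simp_all add: E_def)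
  note psi_scale = T.psi_scale[unfolded E_sel]
  let ?D = "\<lambda>x. \<psi> (D (T.\<chi> x))"
  have chi: "T.\<chi> (\<psi> x) = x" if "x \<in> C1" for x
    using T.chi that by (simp add: E_sel)
  have nprod: "nprod (derived_algebra T.image_algebra ?D) (\<psi> a) n (\<psi> b)
      = \<psi> (nprod (derived_algebra C D) a n b)" if "a \<in> C1" "b \<in> C1" for a b n
    using that
    by (simp add: nprod_def derived_algebra_def chi C1_D coeff_map_poly psi_scale E_sel)
  have sub: "conformal_subalgebra (derived_algebra T.image_algebra ?D) (\<psi> ` S)"
  proof -
    have "T.W.subspace (\<psi> ` S)"
    proof (rule T.W.subspaceI)
      have *: "0 \<in> S" "\<And>x y. x \<in> S \<Longrightarrow> y \<in> S \<Longrightarrow> x + y \<in> S" "\<And>c x. x \<in> S \<Longrightarrow> cscale C c x \<in> S"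
        using S by (auto simp: conformal_subalgebra_def derived_algebra_def C.subspace_def E_sel)
      show "0 \<in> \<psi> ` S" using *(1) T.psi_0 by (metis imageI)
      show "x + y \<in> \<psi> ` S" if "x \<in> \<psi> ` S" "y \<in> \<psi> ` S" for x y
        using that *(2) by (auto simp flip: T.psi_add)
      show "?s c x \<in> \<psi> ` S" if "x \<in> \<psi> ` S" for c x
      proof -
        obtain z where z: "x = \<psi> z" "z \<in> S" using \<open>x \<in> \<psi> ` S\<close> by blast
        have "?s c x = \<psi> (cscale C c z)" unfolding z(1) by (rule psi_scale[symmetric])
        then show ?thesis using *(3)[OF z(2)] by (rule image_eqI)
      qed
    qed
    moreover have "cdel T.image_algebra (\<psi> x) \<in> \<psi> ` S" if "x \<in> S" for x
      using that SE S chi by (auto simp: conformal_subalgebra_def derived_algebra_def E_sel)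
    moreover have "nprod (derived_algebra T.image_algebra ?D) (\<psi> a) n (\<psi> b) \<in> \<psi> ` S"
      if "a \<in> S" "b \<in> S" for a b n
      unfolding nprod[OF subsetD[OF SE that(1)] subsetD[OF SE that(2)]]
      using that S by (auto simp: conformal_subalgebra_def)
    moreover have "\<psi> ` S \<subseteq> cspace T.image_algebra" using SE by (auto simp: E_sel)
    ultimately show ?thesis
      unfolding conformal_subalgebra_def by (auto simp: derived_algebra_def simp del: T.sel(3,4))
  qed
  have iso: "conformal_iso V ((derived_algebra T.image_algebra ?D)\<lparr>cspace := \<psi> ` S\<rparr>) (\<psi> \<circ> f)"
  proof -
    have fS: "f x \<in> S" "f x \<in> C1" if "x \<in> cspace V" for x
      using that fbij SE by (auto simp: bij_betw_def)
    have "bij_betw (\<psi> \<circ> f) (cspace V) (\<psi> ` S)"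
      using fbij T.psi_inj SE
      by (intro bij_betw_trans[OF fbij]) (auto simp: bij_betw_def E_sel intro: inj_on_subset)
    moreover have np: "nprod ((derived_algebra T.image_algebra ?D)\<lparr>cspace := \<psi> ` S\<rparr>) (\<psi> (f a)) n (\<psi> (f b))
      = \<psi> (f (nprod V a n b))" if "a \<in> cspace V" "b \<in> cspace V" for a b n
      using nprod[OF fS(2)[OF that(1)] fS(2)[OF that(2)], of n] f that
      by (simp add: nprod_def conformal_iso_def conformal_hom_def)
    moreover have "linear_between V ((derived_algebra T.image_algebra ?D)\<lparr>cspace := \<psi> ` S\<rparr>) (\<psi> \<circ> f)"
      using f fS SE psi_scale T.psi_add
      by (auto simp: linear_between_def conformal_iso_def conformal_hom_def derived_algebra_def E_sel)
    moreover have "\<psi> (f (cdel V a)) = cdel T.image_algebra (\<psi> (f a))" if "a \<in> cspace V" for a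
      using f fS that chi by (auto simp: conformal_iso_def conformal_hom_def derived_algebra_def E_sel)
    ultimately show ?thesis
      by (auto simp: conformal_iso_def conformal_hom_def derived_algebra_def simp del: T.sel(3,4))
  qed
  show ?thesis
    unfolding special_def special_via_def
    using T.image_algebra T.image_derivation[OF ED] sub iso by blast
qed

end

theory Submission
  imports Defs "HOL-Library.Multiset" "HOL-Library.Poly_Mapping"
begin

text \<open>
  The theorem combines one construction for ordinary Novikov algebras with a change of viewpoint that
  turns a conformal algebra into an ordinary one.

  \<^emph>\<open>Ordinary Novikov algebras.\<close> Let \<open>A\<close> be an algebra with \<open>a(bc) = b(ac)\<close> and \<open>(ab)c - a(bc)\<close> symmetric
  in \<open>b, c\<close>. It embeds into a commutative algebra with a derivation \<open>D\<close> such that \<open>ab = D(a) \<cdot> b\<close>. Give the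
  letter \<open>D\<^sup>k a\<close> the weight \<open>k - 1\<close>, so that elements of \<open>A\<close> have weight \<open>-1\<close>. The embedding amounts
  to a linear evaluation of the differential monomials of weight \<open>-1\<close> in \<open>A\<close> that fixes the letters
  \<open>a\<close> and respects \<open>D\<^sup>m (D(a) \<cdot> b) = D\<^sup>m (ab)\<close> inside every monomial. The operators generated by the
  left multiplications commute (\<open>op_commute\<close>) and inherit the second identity (\<open>op_right_sym\<close>).
  Functions \<open>f\<close> of finite multisets in \<open>A\<close> that are such an operator in each argument carry an explicit
  derivation \<open>der\<close>; the iterated commutators \<open>jet a k\<close> of \<open>der\<close> with left multiplication by \<open>a\<close> commute
  with each other. A monomial is evaluated by letting its letters of order at least \<open>1\<close> act on a unit
  function and by inserting its letters of order \<open>0\<close> as arguments. The relation to be respected is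
  \<open>jet_product\<close>. Dividing the differential polynomials by the largest differential ideal inside the
  kernel of the evaluation gives the commutative algebra.

  \<^emph>\<open>Momenta.\<close> For a Novikov conformal algebra \<open>V\<close> and a commutative ring of momenta, consider symbols
  \<open>v \<otimes> e\<^sup>\<sigma>\<close> with \<open>\<partial>v \<otimes> e\<^sup>\<sigma> = - \<sigma> (v \<otimes> e\<^sup>\<sigma>)\<close> and
  \<open>(a \<otimes> e\<^sup>\<alpha>)(b \<otimes> e\<^sup>\<beta>) = (a \<^sub>\<alpha> b) \<otimes> e\<^sup>\<alpha>\<^sup>+\<^sup>\<beta>\<close>. The conformal identities make this an
  ordinary Novikov algebra (\<open>novikov_ring_atoms\<close>). With momenta in the base field \<open>k\<close> an element \<open>v\<close> that
  lies in \<open>(\<partial> + \<sigma>) V\<close> for all \<open>\<sigma>\<close> would be lost; with momenta in \<open>k[t]\<close> the generic momentum \<open>t\<close>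
  recovers all of \<open>V\<close>, on which \<open>t\<close> then acts as \<open>- \<partial>\<close> (\<open>letter_generic_zero\<close>).
  Conversely, functions \<open>c\<close> from momenta to a commutative differential algebra form a commutative
  conformal algebra under \<open>(\<partial>c)(\<sigma>) = - \<sigma> c(\<sigma>)\<close> and \<open>(b \<^sub>\<mu> c)(\<sigma>) = b(\<mu>) c(\<sigma> - \<mu>)\<close>, where the
  axioms hold by inspection, as soon as these products are polynomial in \<open>\<mu>\<close>.

  \<^emph>\<open>Locality.\<close> What remains is this polynomial dependence for the fields \<open>\<sigma> \<mapsto> D\<^sup>k x \<otimes> e\<^sup>\<sigma>\<close>, with \<open>x\<close> in a
  finite generating set. There \<open>D x \<cdot> y = xy\<close> has degree below a common \<open>N\<close>. A product of \<open>D\<^sup>p x\<close> and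
  \<open>D\<^sup>q y\<close> is tested against monomials in the generators of complementary weight. If \<open>p, q > 0\<close> such a
  monomial contains a generator \<open>z\<close> of order \<open>0\<close>, and shifting momentum between \<open>x\<close> and \<open>y\<close> is shifting
  it between \<open>x\<close> and \<open>z\<close> and between \<open>z\<close> and \<open>y\<close>; the Leibniz formula for \<open>D\<^sup>p\<^sup>-\<^sup>1 (D x \<cdot> y)\<close> treats
  \<open>q = 0\<close>; for \<open>p = q = 0\<close> the monomial contains some \<open>D\<^sup>k z\<close> with \<open>k \<ge> 2\<close>, and
  \<open>D\<^sup>k\<^sup>-\<^sup>1 (D z \<cdot> xy)\<close> is used. The degrees grow with \<open>p\<close> and \<open>q\<close> but do not depend on the test monomial
  (\<open>letters_local\<close>). The common bound \<open>N\<close>, valid for every choice of \<open>z\<close>, is where finite generation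
  enters.
\<close>

section \<open>Symmetric maps on a Novikov algebra\<close>

lemma add_mset_diff_single:
  "x \<in># N \<Longrightarrow> add_mset z N - {#x#} = add_mset z (N - {#x#})"
  by (metis add_mset_add_single add_mset_commute diff_union_swap insert_DiffM multi_drop_mem_not_eq add_mset_diff_bothsides diff_empty)

lemma size_diff_single: "x \<in># N \<Longrightarrow> size N = Suc n \<Longrightarrow> size (N - {#x#}) = n"
  by (simp add: size_Diff_singleton)

text \<open>
  The scalars \<open>'s\<close> act without a unit law: in the application \<open>A\<close> is a quotient, realised as the range
  of a projection on a larger type, and \<open>sc 1\<close> is that projection.
\<close>
locale novikov_ring =
  fixes circ :: "'a :: ab_group_add \<Rightarrow> 'a \<Rightarrow> 'a" (infixl "\<odot>" 75)
    and sc :: "'s :: comm_ring_1 \<Rightarrow> 'a \<Rightarrow> 'a"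
  assumes circ_add_left: "(a + b) \<odot> c = a \<odot> c + b \<odot> c"
    and circ_add_right: "a \<odot> (b + c) = a \<odot> b + a \<odot> c"
    and sc_add_left: "sc (s + t) a = sc s a + sc t a"
    and sc_add_right: "sc s (a + b) = sc s a + sc s b"
    and sc_mult: "sc (s * t) a = sc s (sc t a)"
    and circ_sc_left: "sc s a \<odot> b = sc s (a \<odot> b)"
    and circ_sc_right: "a \<odot> sc s b = sc s (a \<odot> b)"
    and left_comm: "a \<odot> (b \<odot> c) = b \<odot> (a \<odot> c)"
    and right_sym: "(a \<odot> b) \<odot> c - a \<odot> (b \<odot> c) = (a \<odot> c) \<odot> b - a \<odot> (c \<odot> b)"
begin

lemma circ_zero_left [simp]: "0 \<odot> a = 0"
  using circ_add_left[of 0 0 a] by simp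

lemma circ_zero_right [simp]: "a \<odot> 0 = 0"
  using circ_add_right[of a 0 0] by simp

lemma circ_diff_left: "(a - b) \<odot> c = a \<odot> c - b \<odot> c"
  using circ_add_left[of "a - b" b c] by (simp add: algebra_simps)

lemma circ_diff_right: "a \<odot> (b - c) = a \<odot> b - a \<odot> c"
  using circ_add_right[of a "b - c" c] by (simp add: algebra_simps)

lemma sc_zero_left [simp]: "sc 0 a = 0"
  using sc_add_left[of 0 0 a] by simp

lemma sc_zero_right [simp]: "sc s 0 = 0"
  using sc_add_right[of s 0 0] by simp

lemma sc_diff_right: "sc s (a - b) = sc s a - sc s b"
  using sc_add_right[of s "a - b" b] by (simp add: algebra_simps)

lemma sc_sum_mset: "sc s (\<Sum>x\<in>#M. f x) = (\<Sum>x\<in>#M. sc s (f x))"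
  by (induction M) (simp_all add: sc_add_right)

lemma sc_sum: "sc s (sum f I) = (\<Sum>i\<in>I. sc s (f i))"
  by (induction I rule: infinite_finite_induct) (simp_all add: sc_add_right)

text \<open>
  The algebra of operators generated by the left multiplications, which is commutative. In a commutative
  differential algebra containing \<open>A\<close> these are multiplications by elements of weight \<open>0\<close>.
\<close>
inductive_set mult_ops :: "('a \<Rightarrow> 'a) set" where
  op_id: "(\<lambda>x. x) \<in> mult_ops"
| op_mult: "(\<lambda>x. a \<odot> x) \<in> mult_ops"
| op_diff: "\<lbrakk>\<theta> \<in> mult_ops; \<eta> \<in> mult_ops\<rbrakk> \<Longrightarrow> (\<lambda>x. \<theta> x - \<eta> x) \<in> mult_ops"
| op_comp: "\<lbrakk>\<theta> \<in> mult_ops; \<eta> \<in> mult_ops\<rbrakk> \<Longrightarrow> (\<lambda>x. \<theta> (\<eta> x)) \<in> mult_ops"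

lemma op_zero: "(\<lambda>x. 0) \<in> mult_ops"
  using op_diff[OF op_id op_id] by simp

lemma op_sum_mset: "(\<And>y. y \<in># M \<Longrightarrow> (\<lambda>x. F y x) \<in> mult_ops) \<Longrightarrow> (\<lambda>x. \<Sum>y\<in>#M. F y x) \<in> mult_ops"
proof (induction M)
  case empty
  then show ?case by (simp add: op_zero)
next
  case (add y M)
  have "(\<lambda>x. F y x - (0 - (\<Sum>y\<in>#M. F y x))) \<in> mult_ops"
    using add by (intro op_diff op_zero) auto
  then show ?case by (simp add: add.commute)
qed

lemma op_diff_arg: "\<theta> \<in> mult_ops \<Longrightarrow> \<theta> (x - y) = \<theta> x - \<theta> y"
  by (induction arbitrary: x y rule: mult_ops.induct) (simp_all add: circ_diff_right)

lemma op_zero_arg [simp]: "\<theta> \<in> mult_ops \<Longrightarrow> \<theta> 0 = 0"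
  using op_diff_arg[of \<theta> 0 0] by simp

lemma op_add_arg: "\<theta> \<in> mult_ops \<Longrightarrow> \<theta> (x + y) = \<theta> x + \<theta> y"
  using op_diff_arg[of \<theta> x "0 - y"] op_diff_arg[of \<theta> 0 y] by simp

lemma op_sum_mset_arg: "\<theta> \<in> mult_ops \<Longrightarrow> \<theta> (\<Sum>x\<in>#M. f x) = (\<Sum>x\<in>#M. \<theta> (f x))"
  by (induction M) (simp_all add: op_add_arg)

lemma op_sc: "\<theta> \<in> mult_ops \<Longrightarrow> \<theta> (sc s x) = sc s (\<theta> x)"
  by (induction arbitrary: x rule: mult_ops.induct) (simp_all add: circ_sc_right sc_diff_right)

lemma op_circ_right: "\<theta> \<in> mult_ops \<Longrightarrow> \<theta> (a \<odot> x) = a \<odot> \<theta> x"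
  by (induction arbitrary: x rule: mult_ops.induct) (simp_all add: circ_diff_right left_comm)

lemma op_commute: "\<theta> \<in> mult_ops \<Longrightarrow> \<eta> \<in> mult_ops \<Longrightarrow> \<theta> (\<eta> x) = \<eta> (\<theta> x)"
proof (induction arbitrary: x rule: mult_ops.induct)
  case (op_mult a)
  then show ?case by (simp add: op_circ_right)
qed (simp_all add: op_diff_arg)

text \<open>
  If \<open>\<theta>\<close> is multiplication by \<open>u\<close>, both sides are \<open>D u \<cdot> x \<cdot> y\<close>. For a composition the defect of \<open>\<theta> \<eta>\<close>
  is \<open>\<eta>\<close> applied to the defect of \<open>\<theta>\<close> plus \<open>\<theta>\<close> applied to the defect of \<open>\<eta>\<close>.
\<close>
lemma op_right_sym:
  "\<theta> \<in> mult_ops \<Longrightarrow> \<theta> x \<odot> y - \<theta> (x \<odot> y) = \<theta> y \<odot> x - \<theta> (y \<odot> x)"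
proof (induction arbitrary: x y rule: mult_ops.induct)
  case (op_mult a)
  show ?case by (rule right_sym)
next
  case (op_diff \<theta> \<eta>)
  have "(\<theta> x - \<eta> x) \<odot> y - (\<theta> (x \<odot> y) - \<eta> (x \<odot> y))
      = (\<theta> x \<odot> y - \<theta> (x \<odot> y)) - (\<eta> x \<odot> y - \<eta> (x \<odot> y))"
    by (simp add: circ_diff_left)
  also have "\<dots> = (\<theta> y \<odot> x - \<theta> (y \<odot> x)) - (\<eta> y \<odot> x - \<eta> (y \<odot> x))"
    using op_diff.IH by simp
  finally show ?case by (simp add: circ_diff_left)
next
  case (op_comp \<theta> \<eta>)
  note c = op_comp.hyps
  have "\<theta> (\<eta> x) \<odot> y - \<theta> (\<eta> (x \<odot> y))
      = (\<theta> (\<eta> x) \<odot> y - \<theta> (\<eta> x \<odot> y)) + \<theta> (\<eta> x \<odot> y - \<eta> (x \<odot> y))" for x y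
    using c by (simp add: op_diff_arg)
  also have "\<dots> x y = (\<theta> y \<odot> \<eta> x - \<theta> (y \<odot> \<eta> x)) + \<theta> (\<eta> x \<odot> y - \<eta> (x \<odot> y))" for x y
    using op_comp.IH(1)[of "\<eta> x" y] by simp
  also have "\<dots> x y = \<eta> (\<theta> y \<odot> x - \<theta> (y \<odot> x)) + \<theta> (\<eta> x \<odot> y - \<eta> (x \<odot> y))" for x y
    using c by (simp add: op_diff_arg op_circ_right[symmetric] op_commute[OF c])
  finally have e: "\<theta> (\<eta> x) \<odot> y - \<theta> (\<eta> (x \<odot> y))
      = \<eta> (\<theta> y \<odot> x - \<theta> (y \<odot> x)) + \<theta> (\<eta> x \<odot> y - \<eta> (x \<odot> y))" for x y .
  show ?case
    unfolding e[of x y] e[of y x]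
    using op_comp.IH(1)[of y x] op_comp.IH(2)[of x y] by simp
qed simp

text \<open>
  Elements of weight \<open>w \<ge> -1\<close> act on \<open>w + 1\<close> elements of \<open>A\<close> by multiplication, with values in \<open>A\<close>. Such
  a map is symmetric, which the use of multisets builds in, and multiplies by an element of weight \<open>0\<close>
  when all arguments but one are fixed. Maps of different arities are collected in one function.
\<close>
definition sym_maps :: "('a multiset \<Rightarrow> 'a) set" where
  "sym_maps = {f. \<forall>N. (\<lambda>z. f (add_mset z N)) \<in> mult_ops}"

lemma sym_mapsD: "f \<in> sym_maps \<Longrightarrow> (\<lambda>z. f (add_mset z N)) \<in> mult_ops"
  by (simp add: sym_maps_def)

text \<open>
  The derivation: \<open>D(u) \<cdot> z \<cdot> x\<^sub>1 \<cdots> x\<^sub>n = D(u x\<^sub>1 \<cdots> x\<^sub>n) \<cdot> z - \<Sum>\<^sub>i D(x\<^sub>i) \<cdot> (u z x\<^sub>1 \<cdots> x\<^sub>n / x\<^sub>i)\<close>. An argument \<open>z\<close> is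
  singled out; the terms are arranged so that only the first two depend on its choice, and their sum does
  not, by \<open>op_right_sym\<close>.
\<close>
definition der :: "('a multiset \<Rightarrow> 'a) \<Rightarrow> 'a multiset \<Rightarrow> 'a" where
  "der f M = (if M = {#} then 0 else
     (let z = SOME z. z \<in># M in f (M - {#z#}) \<odot> z + z \<odot> f (M - {#z#}))
       - (\<Sum>x\<in>#M. x \<odot> f (M - {#x#})))"

lemma der_empty [simp]: "der f {#} = 0"
  by (simp add: der_def)

lemma der_add_mset:
  assumes f: "f \<in> sym_maps"
  shows "der f (add_mset z N) = f N \<odot> z - (\<Sum>x\<in>#N. x \<odot> f (add_mset z (N - {#x#})))"
proof -
  define M where "M = add_mset z N"
  define w where "w = (SOME z. z \<in># M)"
  have "w \<in># M" unfolding w_def by (rule someI[of _ z]) (simp add: M_def)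
  then obtain N' where N': "M = add_mset w N'" by (meson multi_member_split)
  have "f N' \<odot> w + w \<odot> f N' = f N \<odot> z + z \<odot> f N"
  proof (cases "w = z")
    case True
    then show ?thesis using N' by (simp add: M_def)
  next
    case False
    then obtain K where K: "N = add_mset w K" "N' = add_mset z K"
      using N' unfolding M_def by (auto simp: add_eq_conv_ex)
    let ?t = "\<lambda>x. f (add_mset x K)"
    have t: "?t \<in> mult_ops" by (rule sym_mapsD[OF f])
    show ?thesis
      unfolding K using op_right_sym[OF t, of z w] op_circ_right[OF t, of w z]
        op_circ_right[OF t, of z w] by (simp add: algebra_simps)
  qed
  moreover have "(\<Sum>x\<in>#M. x \<odot> f (M - {#x#})) = z \<odot> f N + (\<Sum>x\<in>#N. x \<odot> f (add_mset z (N - {#x#})))"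
  proof -
    have "f (add_mset z N - {#x#}) = f (add_mset z (N - {#x#}))" if "x \<in># N" for x
      using that by (simp add: add_mset_diff_single)
    then show ?thesis unfolding M_def by (simp cong: image_mset_cong)
  qed
  moreover have "der f M = (f (M - {#w#}) \<odot> w + w \<odot> f (M - {#w#})) - (\<Sum>x\<in>#M. x \<odot> f (M - {#x#}))"
    unfolding der_def Let_def w_def[symmetric] using N' by simp
  ultimately show ?thesis using N' by (simp add: M_def)
qed

lemma der_in: "f \<in> sym_maps \<Longrightarrow> der f \<in> sym_maps"
proof -
  assume f: "f \<in> sym_maps"
  have "(\<lambda>z. f N \<odot> z - (\<Sum>x\<in>#N. x \<odot> f (add_mset z (N - {#x#})))) \<in> mult_ops" for N
    by (intro op_diff op_mult op_sum_mset op_comp[OF op_mult sym_mapsD[OF f]])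
  then show ?thesis by (simp add: sym_maps_def der_add_mset[OF f])
qed

lemma der_add: "der (\<lambda>M. f M + g M) M = der f M + der g M"
  by (auto simp: der_def Let_def circ_add_left circ_add_right sum_mset.distrib)

lemma der_sum: "der (\<lambda>M. \<Sum>i\<in>I. f i M) M = (\<Sum>i\<in>I. der (f i) M)"
proof (induction I rule: infinite_finite_induct)
  case (insert i I)
  then show ?case by (simp add: der_add)
qed (auto simp: der_def)

lemma der_sc: "der (\<lambda>M. sc s (f M)) M = sc s (der f M)"
  by (auto simp: der_def Let_def circ_sc_left circ_sc_right sc_sum_mset sc_diff_right sc_add_right)

text \<open>
  Contraction with \<open>b\<close> is multiplication by a letter of weight \<open>-1\<close>, and its commutator with the
  derivation is multiplication by \<open>D b\<close>. The hypothesis excludes maps of arity \<open>0\<close>, whose product with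
  \<open>b\<close> has weight \<open>-2\<close> and is not represented.
\<close>
lemma der_shift:
  assumes f: "f \<in> sym_maps" and 0: "f {#} = 0"
  shows "der (\<lambda>M. f (add_mset b M)) M = der f (add_mset b M) + b \<odot> f M"
proof (cases M)
  case empty
  then show ?thesis using 0 by (simp add: der_add_mset[OF f])
next
  case (add z N)
  have s: "(\<lambda>M. f (add_mset b M)) \<in> sym_maps"
    using sym_mapsD[OF f] by (simp add: sym_maps_def add_mset_commute[of b])
  have "f (add_mset z (add_mset b N - {#x#})) = f (add_mset z (add_mset b (N - {#x#})))" if "x \<in># N" for x
    using that by (simp add: add_mset_diff_single)
  then have "(\<Sum>x\<in>#add_mset b N. x \<odot> f (add_mset z (add_mset b N - {#x#})))
     = b \<odot> f (add_mset z N) + (\<Sum>x\<in>#N. x \<odot> f (add_mset b (add_mset z (N - {#x#}))))"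
    by (simp add: add_mset_commute cong: image_mset_cong)
  then show ?thesis
    unfolding add add_mset_commute[of b z N] der_add_mset[OF f] der_add_mset[OF s] by simp
qed

text \<open>
  The element \<open>1\<close> of weight \<open>0\<close>, which acts on \<open>A\<close> as the identity.
\<close>
definition unit_map :: "'a multiset \<Rightarrow> 'a" where
  "unit_map M = (if size M = 1 then (THE z. M = {#z#}) else 0)"

lemma unit_map_single [simp]: "unit_map {#z#} = z"
  by (simp add: unit_map_def)

lemma unit_map_other: "size M \<noteq> 1 \<Longrightarrow> unit_map M = 0"
  by (simp add: unit_map_def)

lemma unit_map_in: "unit_map \<in> sym_maps"
proof -
  have "(\<lambda>z. unit_map (add_mset z N)) \<in> mult_ops" for N
    by (cases N) (simp_all add: op_id op_zero unit_map_other)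
  then show ?thesis by (simp add: sym_maps_def)
qed

text \<open>
  Operators that multiply by a single element of weight \<open>w\<close>: such an element consumes \<open>w\<close> of the
  arguments, no matter which, and acts on the value at the others by an operator in \<open>mult_ops\<close>. Applying
  the operator to \<open>unit_map\<close> recovers the element.
\<close>
definition tame :: "nat \<Rightarrow> (('a multiset \<Rightarrow> 'a) \<Rightarrow> 'a multiset \<Rightarrow> 'a) \<Rightarrow> bool" where
  "tame w X \<longleftrightarrow>
     (\<forall>M. size M = w \<longrightarrow> (\<lambda>v. X unit_map (add_mset v M)) \<in> mult_ops) \<and>
     (\<forall>f\<in>sym_maps. \<forall>M. size M < w \<longrightarrow> X f M = 0) \<and>
     (\<forall>f\<in>sym_maps. \<forall>M N. size M = w \<longrightarrow> X f (M + N) = X unit_map (add_mset (f N) M))"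

lemma
  assumes "tame w X"
  shows tame_op: "size M = w \<Longrightarrow> (\<lambda>v. X unit_map (add_mset v M)) \<in> mult_ops"
    and tame_small: "f \<in> sym_maps \<Longrightarrow> size M < w \<Longrightarrow> X f M = 0"
    and tame_eq: "f \<in> sym_maps \<Longrightarrow> size M = w \<Longrightarrow> X f (M + N) = X unit_map (add_mset (f N) M)"
  using assms by (auto simp: tame_def)

lemma tameI:
  assumes op: "\<And>M. size M = w \<Longrightarrow> \<tau> M \<in> mult_ops"
    and small: "\<And>f M. f \<in> sym_maps \<Longrightarrow> size M < w \<Longrightarrow> X f M = 0"
    and eq: "\<And>f M N. f \<in> sym_maps \<Longrightarrow> size M = w \<Longrightarrow> X f (M + N) = \<tau> M (f N)"
  shows "tame w X"
proof -
  have u: "X unit_map (add_mset v M) = \<tau> M v" if "size M = w" for M v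
    using eq[OF unit_map_in that, of "{#v#}"] by simp
  show ?thesis unfolding tame_def using op small eq by (auto simp: u)
qed

lemma split_size: "w \<le> size (M :: 'b multiset) \<Longrightarrow> \<exists>A B. M = A + B \<and> size A = w"
proof (induction w)
  case (Suc w)
  then obtain A B where AB: "M = A + B" "size A = w" by auto
  with Suc.prems have "B \<noteq> {#}" by auto
  then obtain z B' where "B = add_mset z B'" by (meson multiset_cases)
  with AB have "M = add_mset z A + B'" "size (add_mset z A) = Suc w" by auto
  then show ?case by blast
qed simp

text \<open>
  When the variable argument is consumed together with all the others, symmetry in the arguments, read off
  from \<open>X unit_map\<close>, moves it to a position where \<open>mult_ops\<close> membership is known.
\<close>
lemma tame_in:
  assumes X: "tame w X" and f: "f \<in> sym_maps"
  shows "X f \<in> sym_maps"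
  unfolding sym_maps_def mem_Collect_eq
proof
  fix N
  show "(\<lambda>z. X f (add_mset z N)) \<in> mult_ops"
  proof (cases "w \<le> size N")
    case True
    then obtain A B where AB: "N = A + B" "size A = w" using split_size by blast
    have "X f (add_mset z N) = X unit_map (add_mset (f (add_mset z B)) A)" for z
      using tame_eq[OF X f AB(2), of "add_mset z B"] by (simp add: AB)
    then show ?thesis
      using op_comp[OF tame_op[OF X AB(2)] sym_mapsD[OF f]] by simp
  next
    case False
    show ?thesis
    proof (cases "w = Suc (size N)")
      case True
      have "X f (add_mset z N) = X unit_map (add_mset z (add_mset (f {#}) N))" for z
        using tame_eq[OF X f, of "add_mset z N" "{#}"] True by (simp add: add_mset_commute)
      then show ?thesis using tame_op[OF X, of "add_mset (f {#}) N"] True by simp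
    next
      case w: False
      then have "X f (add_mset z N) = 0" for z
        using tame_small[OF X f, of "add_mset z N"] False by simp
      then show ?thesis by (simp add: op_zero)
    qed
  qed
qed

text \<open>
  The two operators can consume disjoint sets of arguments, and then \<open>op_commute\<close> applies.
\<close>
lemma tame_commute:
  assumes X: "tame w X" and Y: "tame w' Y" and f: "f \<in> sym_maps"
  shows "X (Y f) = Y (X f)"
proof
  fix M
  have *: "X (Y f) M = 0" if "size M < w + w'" "tame w X" "tame w' Y" for w w' X Y
  proof (cases "size M < w")
    case True
    then show ?thesis using tame_small[OF that(2) tame_in[OF that(3) f]] by simp
  next
    case False
    then obtain A B where AB: "M = A + B" "size A = w" using split_size[of w M] by auto
    then show ?thesis
      using tame_eq[OF that(2) tame_in[OF that(3) f] AB(2), of B]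
        tame_small[OF that(3) f, of B] op_zero_arg[OF tame_op[OF that(2) AB(2)]] that(1) by simp
  qed
  show "X (Y f) M = Y (X f) M"
  proof (cases "size M < w + w'")
    case True
    then show ?thesis using *[OF True X Y] *[of w' w Y X] X Y by (simp add: add.commute)
  next
    case False
    then obtain A B where AB: "M = A + B" "size A = w" using split_size[of w M] by auto
    with False obtain B1 B2 where B: "B = B1 + B2" "size B1 = w'"
      using split_size[of w' B] by auto
    have "X (Y f) M = X unit_map (add_mset (Y unit_map (add_mset (f B2) B1)) A)"
      using tame_eq[OF X tame_in[OF Y f] AB(2), of B] tame_eq[OF Y f B(2)] by (simp add: AB B)
    moreover have "Y (X f) M = Y unit_map (add_mset (X unit_map (add_mset (f B2) A)) B1)"
      using tame_eq[OF Y tame_in[OF X f] B(2), of "A + B2"] tame_eq[OF X f AB(2)]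
      by (simp add: AB B ac_simps)
    ultimately show ?thesis
      using op_commute[OF tame_op[OF X AB(2)] tame_op[OF Y B(2)]] by simp
  qed
qed

lemma tame_add:
  assumes X: "tame w X" and f: "f \<in> sym_maps" and g: "g \<in> sym_maps"
    and fg: "(\<lambda>M. f M + g M) \<in> sym_maps"
  shows "X (\<lambda>M. f M + g M) M = X f M + X g M"
proof (cases "size M < w")
  case True
  then show ?thesis using tame_small[OF X] f g fg by simp
next
  case False
  then obtain A B where AB: "M = A + B" "size A = w" using split_size[of w M] by auto
  show ?thesis
    unfolding AB tame_eq[OF X f AB(2)] tame_eq[OF X g AB(2)] tame_eq[OF X fg AB(2)]
    by (rule op_add_arg[OF tame_op[OF X AB(2)]])
qed

lemma sym_maps_diff: "f \<in> sym_maps \<Longrightarrow> g \<in> sym_maps \<Longrightarrow> (\<lambda>M. f M - g M) \<in> sym_maps"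
  using op_diff by (auto simp: sym_maps_def)

lemma tame_diff:
  assumes X: "tame w X" and f: "f \<in> sym_maps" and g: "g \<in> sym_maps"
  shows "X (\<lambda>M. f M - g M) M = X f M - X g M"
proof -
  have "X (\<lambda>M. f M - g M + g M) M = X (\<lambda>M. f M - g M) M + X g M"
    by (rule tame_add[OF X sym_maps_diff[OF f g] g]) (simp add: f)
  then show ?thesis by simp
qed

definition ad :: "(('a multiset \<Rightarrow> 'a) \<Rightarrow> 'a multiset \<Rightarrow> 'a) \<Rightarrow> ('a multiset \<Rightarrow> 'a) \<Rightarrow> 'a multiset \<Rightarrow> 'a"
  where "ad X f M = der (X f) M - X (der f) M"

text \<open>
  Multiplication by \<open>D u\<close> is the commutator of the derivation with multiplication by \<open>u\<close>. In the commutator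
  every term in which the derivation acts on arguments not consumed by \<open>X\<close> cancels.
\<close>
lemma tame_ad:
  assumes X: "tame w X"
  shows "tame (Suc w) (ad X)"
proof -
  let ?u = "\<lambda>A v. X unit_map (add_mset v A)"
  define T where "T z A = (\<lambda>v. (?u A z \<odot> v - ?u A (z \<odot> v))
      - (\<Sum>x\<in>#A. x \<odot> ?u (add_mset z (A - {#x#})) v))" for z A
  have T: "T z A \<in> mult_ops" if A: "size A = w" for z A
  proof -
    have "(\<lambda>v. ?u (add_mset z (A - {#x#})) v) \<in> mult_ops" if "x \<in># A" for x
      by (rule tame_op[OF X]) (use A that in \<open>auto simp: size_Diff_singleton dest!: multi_member_split\<close>)
    then show ?thesis
      unfolding T_def
      by (intro op_diff op_mult op_sum_mset op_comp[OF op_mult] op_comp[OF tame_op[OF X A] op_mult])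
  qed
  have eq: "ad X f (add_mset z A + N) = T z A (f N)"
    if f: "f \<in> sym_maps" and A: "size A = w" for f z A N
  proof -
    note Xf = tame_in[OF X f]
    have u: "?u A \<in> mult_ops" by (rule tame_op[OF X A])
    have 1: "der (X f) (add_mset z A + N) = ?u A (f N) \<odot> z
        - ((\<Sum>x\<in>#A. x \<odot> ?u (add_mset z (A - {#x#})) (f N))
         + (\<Sum>x\<in>#N. x \<odot> ?u A (f (add_mset z (N - {#x#})))))"
    proof -
      have a: "X f (add_mset z ((A + N) - {#x#})) = ?u (add_mset z (A - {#x#})) (f N)" if x: "x \<in># A" for x
      proof -
        obtain A' where A': "A = add_mset x A'" using x by (meson multi_member_split)
        show ?thesis using tame_eq[OF X f, of "add_mset z A'" N] A by (simp add: A')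
      qed
      have b: "X f (add_mset z ((A + N) - {#x#})) = ?u A (f (add_mset z (N - {#x#})))" if x: "x \<in># N" for x
      proof -
        obtain N' where N': "N = add_mset x N'" using x by (meson multi_member_split)
        show ?thesis using tame_eq[OF X f A, of "add_mset z N'"] by (simp add: N')
      qed
      have "der (X f) (add_mset z (A + N)) = X f (A + N) \<odot> z
        - (\<Sum>x\<in>#A + N. x \<odot> X f (add_mset z ((A + N) - {#x#})))"
        by (rule der_add_mset[OF Xf])
      also have "X f (A + N) = ?u A (f N)" by (rule tame_eq[OF X f A])
      also have "(\<Sum>x\<in>#A + N. x \<odot> X f (add_mset z ((A + N) - {#x#})))
        = (\<Sum>x\<in>#A. x \<odot> ?u (add_mset z (A - {#x#})) (f N))
         + (\<Sum>x\<in>#N. x \<odot> ?u A (f (add_mset z (N - {#x#}))))"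
        using a b by (simp cong: image_mset_cong)
      finally show ?thesis by simp
    qed
    have 2: "X (der f) (add_mset z A + N) = ?u A (f N \<odot> z)
         - (\<Sum>x\<in>#N. x \<odot> ?u A (f (add_mset z (N - {#x#}))))"
      using tame_eq[OF X der_in[OF f] A, of "add_mset z N"]
      by (simp add: der_add_mset[OF f] op_diff_arg[OF u] op_sum_mset_arg[OF u] op_circ_right[OF u])
    have "?u A (f N) \<odot> z - ?u A (f N \<odot> z) = ?u A z \<odot> f N - ?u A (z \<odot> f N)"
      by (rule op_right_sym[OF u])
    then show ?thesis unfolding ad_def 1 2 T_def by (simp add: algebra_simps)
  qed
  define \<tau> where "\<tau> M = (let p = SOME (z, A). M = add_mset z A \<and> size A = w in T (fst p) (snd p))" for M
  have \<tau>: "\<exists>z A. M = add_mset z A \<and> size A = w \<and> \<tau> M = T z A" if M: "size M = Suc w" for M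
  proof -
    define p where "p = (SOME (z, A). M = add_mset z A \<and> size A = w)"
    obtain z where "z \<in># M" using M by (metis size_eq_Suc_imp_elem)
    then have "M = add_mset z (M - {#z#}) \<and> size (M - {#z#}) = w"
      using size_diff_single[OF _ M] by simp
    then have "case p of (z, A) \<Rightarrow> M = add_mset z A \<and> size A = w"
      unfolding p_def
      using someI[of "\<lambda>(z, A). M = add_mset z A \<and> size A = w" "(z, M - {#z#})"] by simp
    then have "M = add_mset (fst p) (snd p) \<and> size (snd p) = w"
      by (simp add: case_prod_beta)
    moreover have "\<tau> M = T (fst p) (snd p)" by (simp add: \<tau>_def p_def Let_def)
    ultimately show ?thesis by blast
  qed
  show ?thesis
  proof (rule tameI)
    fix M :: "'a multiset" assume M: "size M = Suc w"
    obtain z A where zA: "M = add_mset z A" "size A = w" "\<tau> M = T z A"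
      using \<tau>[OF M] by blast
    show "\<tau> M \<in> mult_ops" using T zA by simp
    fix f N assume "f \<in> sym_maps"
    then show "ad X f (M + N) = \<tau> M (f N)" using zA eq by simp
  next
    fix f and M :: "'a multiset" assume f: "f \<in> sym_maps" and M: "size M < Suc w"
    show "ad X f M = 0"
    proof (cases M)
      case empty
      have "X (der f) {#} = 0"
      proof (cases "w = 0")
        case True
        then have "(\<lambda>v. X unit_map (add_mset v {#})) \<in> mult_ops" using tame_op[OF X, of "{#}"] by simp
        from op_zero_arg[OF this] show ?thesis
          using True tame_eq[OF X der_in[OF f], of "{#}" "{#}"] by simp
      qed (use tame_small[OF X der_in[OF f]] in simp)
      then show ?thesis by (simp add: ad_def empty)
    next
      case (add z N)
      then have N: "size N < w" using M by simp
      have "X f (add_mset z (N - {#x#})) = 0" if "x \<in># N" for x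
        using N that by (intro tame_small[OF X f]) (auto simp: size_Diff_singleton dest!: multi_member_split)
      then have "der (X f) M = 0"
        using N tame_small[OF X f] by (simp add: add der_add_mset[OF tame_in[OF X f]] cong: image_mset_cong)
      moreover have "X (der f) M = 0"
      proof (cases "size M = w")
        case True
        then show ?thesis
          using tame_eq[OF X der_in[OF f], of M "{#}"] op_zero_arg[OF tame_op[OF X True]] by simp
      next
        case False
        then show ?thesis using M by (intro tame_small[OF X der_in[OF f]]) simp
      qed
      ultimately show ?thesis by (simp add: ad_def)
    qed
  qed
qed

text \<open>
  Multiplication by \<open>D\<^sup>n\<^sup>+\<^sup>1 a\<close>.
\<close>
primrec jet :: "'a \<Rightarrow> nat \<Rightarrow> ('a multiset \<Rightarrow> 'a) \<Rightarrow> 'a multiset \<Rightarrow> 'a" where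
  "jet a 0 = (\<lambda>f M. a \<odot> f M)"
| "jet a (Suc n) = ad (jet a n)"

lemma tame_jet: "tame n (jet a n)"
proof (induction n)
  case 0
  show ?case by (rule tameI[where \<tau> = "\<lambda>_ x. a \<odot> x"]) (auto intro: op_mult)
qed (simp add: tame_ad)

lemmas jet_in = tame_in[OF tame_jet]

lemma jet_add: "jet (a + b) n f M = jet a n f M + jet b n f M"
proof (induction n arbitrary: f M)
  case (Suc n)
  have "jet (a + b) n f = (\<lambda>M. jet a n f M + jet b n f M)" using Suc by blast
  then show ?case by (simp add: ad_def Suc der_add)
qed (simp add: circ_add_left)

lemma jet_sc: "jet (sc s a) n f M = sc s (jet a n f M)"
proof (induction n arbitrary: f M)
  case (Suc n)
  have "jet (sc s a) n f = (\<lambda>M. sc s (jet a n f M))" using Suc by blast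
  then show ?case by (simp add: ad_def Suc der_sc sc_diff_right)
qed (simp add: circ_sc_left)

lemma ad_comp:
  assumes X: "tame w X" and Y: "tame w' Y" and f: "f \<in> sym_maps"
  shows "der (X (Y f)) M - X (Y (der f)) M = ad X (Y f) M + X (ad Y f) M"
  unfolding ad_def
  using tame_diff[OF X der_in[OF tame_in[OF Y f]] tame_in[OF Y der_in[OF f]], of M] by simp

lemma jet_one_contract:
  assumes f: "f \<in> sym_maps"
  shows "jet a 1 f (add_mset b M) = (a \<odot> b) \<odot> f M - a \<odot> (b \<odot> f M)"
proof -
  have s: "(\<lambda>M. a \<odot> f M) \<in> sym_maps" using jet_in[OF f, of a 0] by simp
  have t: "a \<odot> (\<Sum>x\<in>#M. g x) = (\<Sum>x\<in>#M. a \<odot> g x)" for g and M :: "'a multiset"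
    by (induction M) (simp_all add: circ_add_right)
  show ?thesis
    using right_sym[of a "f M" b]
    by (simp add: ad_def der_add_mset[OF f] der_add_mset[OF s] circ_diff_right t left_comm[of a])
qed

text \<open>
  This is \<open>D\<^sup>m\<^sup>+\<^sup>1 (D(a) \<cdot> b) = D\<^sup>m\<^sup>+\<^sup>1 (ab)\<close>, expanded by the Leibniz rule, as an identity of operators. The term
  in which \<open>b\<close> is not differentiated is a contraction. The induction step applies the commutator with \<open>der\<close>
  to both sides.
\<close>
lemma jet_product:
  assumes f: "f \<in> sym_maps"
  shows "(\<Sum>i\<le>m. sc (of_nat (Suc m choose i)) (jet a i (jet b (m - i) f) M))
      + sc 1 (jet a (Suc m) f (add_mset b M))
    = sc 1 (jet (a \<odot> b) m f M)"
  using f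
proof (induction m arbitrary: f M)
  case 0
  then show ?case using jet_one_contract[OF 0, of a b M] by (simp add: sc_diff_right)
next
  case (Suc m)
  note f = Suc.prems
  define T where "T i j = jet a i (jet b j f) M" for i j
  define g where "g = jet a (Suc m) f"
  have g: "g \<in> sym_maps" unfolding g_def by (rule jet_in[OF f])
  have g0: "g {#} = 0" unfolding g_def by (rule tame_small[OF tame_jet f]) simp
  let ?c = "\<lambda>i. of_nat (Suc m choose i) :: 's"
  \<comment> \<open>The commutator with \<open>der\<close> of a product of two jets, and of a jet followed by contraction with \<open>b\<close>; the latter also produces a letter \<open>D b\<close>.\<close>
  have br: "der (jet a i (jet b j f)) M - jet a i (jet b j (der f)) M = T (Suc i) j + T i (Suc j)" for i j
    using ad_comp[OF tame_jet tame_jet f] by (simp add: T_def)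
  have g1: "der (\<lambda>M. g (add_mset b M)) M - jet a (Suc m) (der f) (add_mset b M)
      = jet a (Suc (Suc m)) f (add_mset b M) + T (Suc m) 0"
  proof -
    have "der (\<lambda>M. g (add_mset b M)) M = der g (add_mset b M) + b \<odot> g M"
      by (rule der_shift[OF g g0])
    moreover have "b \<odot> g M = T (Suc m) 0"
      unfolding g_def T_def using tame_commute[OF tame_jet[of 0 b] tame_jet[of "Suc m" a] f]
      by (metis jet.simps(1))
    moreover have "jet a (Suc (Suc m)) f (add_mset b M)
      = der g (add_mset b M) - jet a (Suc m) (der f) (add_mset b M)"
      by (simp only: jet.simps(2)[of a "Suc m"] ad_def g_def)
    ultimately show ?thesis by (simp only: algebra_simps)
  qed
  have "sc 1 (jet (a \<odot> b) (Suc m) f M)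
      = der (\<lambda>M. sc 1 (jet (a \<odot> b) m f M)) M - sc 1 (jet (a \<odot> b) m (der f) M)"
    by (simp add: ad_def der_sc sc_diff_right)
  also have "(\<lambda>M. sc 1 (jet (a \<odot> b) m f M))
      = (\<lambda>M. (\<Sum>i\<le>m. sc (?c i) (jet a i (jet b (m - i) f) M)) + sc 1 (g (add_mset b M)))"
    unfolding g_def using Suc.IH[OF f] by simp
  also have "sc 1 (jet (a \<odot> b) m (der f) M)
      = (\<Sum>i\<le>m. sc (?c i) (jet a i (jet b (m - i) (der f)) M)) + sc 1 (jet a (Suc m) (der f) (add_mset b M))"
    using Suc.IH[OF der_in[OF f], of M] by (simp only:)
  also have "der (\<lambda>M. (\<Sum>i\<le>m. sc (?c i) (jet a i (jet b (m - i) f) M)) + sc 1 (g (add_mset b M))) M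
      = (\<Sum>i\<le>m. sc (?c i) (der (jet a i (jet b (m - i) f)) M)) + sc 1 (der (\<lambda>M. g (add_mset b M)) M)"
    by (simp only: der_add der_sum der_sc)
  also have "(\<Sum>i\<le>m. sc (?c i) (der (jet a i (jet b (m - i) f)) M)) + sc 1 (der (\<lambda>M. g (add_mset b M)) M)
      - ((\<Sum>i\<le>m. sc (?c i) (jet a i (jet b (m - i) (der f)) M)) + sc 1 (jet a (Suc m) (der f) (add_mset b M)))
      = (\<Sum>i\<le>m. sc (?c i) (T (Suc i) (m - i) + T i (Suc (m - i))))
        + sc 1 (jet a (Suc (Suc m)) f (add_mset b M) + T (Suc m) 0)"
    by (simp only: br[symmetric] g1[symmetric] sc_diff_right sum_subtractf add_diff_add)
  also have "\<dots> = (\<Sum>i\<le>Suc m. sc (of_nat (Suc (Suc m) choose i)) (T i (Suc m - i)))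
        + sc 1 (jet a (Suc (Suc m)) f (add_mset b M))"
  proof -
    have "(\<Sum>i\<le>Suc m. sc (of_nat (Suc (Suc m) choose i)) (T i (Suc m - i)))
       = sc 1 (T 0 (Suc m)) + (\<Sum>i\<le>m. sc (?c i) (T (Suc i) (m - i)) + sc (?c (Suc i)) (T (Suc i) (m - i)))"
      by (simp only: sum.atMost_Suc_shift binomial_Suc_Suc[of "Suc m"] of_nat_add sc_add_left
          binomial_n_0 of_nat_1 diff_zero diff_Suc_Suc)
    moreover have "sc 1 (T 0 (Suc m)) + (\<Sum>i\<le>m. sc (?c (Suc i)) (T (Suc i) (m - i)))
       = (\<Sum>i\<le>Suc m. sc (?c i) (T i (Suc m - i)))"
      by (simp only: sum.atMost_Suc_shift binomial_n_0 of_nat_1 diff_zero diff_Suc_Suc)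
    moreover have "\<dots> = (\<Sum>i\<le>m. sc (?c i) (T i (Suc (m - i)))) + sc 1 (T (Suc m) 0)"
      by (simp add: Suc_diff_le)
    ultimately show ?thesis by (simp add: sum.distrib sc_add_right algebra_simps)
  qed
  finally show ?case by (simp only: T_def)
qed

text \<open>
  The operators \<open>jet\<close> commute on \<open>sym_maps\<close> only. Acting trivially elsewhere makes them commute globally,
  so that a multiset of letters can act.
\<close>
definition act :: "'a \<times> nat \<Rightarrow> ('a multiset \<Rightarrow> 'a) \<Rightarrow> 'a multiset \<Rightarrow> 'a" where
  "act l f = (if f \<in> sym_maps then jet (fst l) (snd l - 1) f else f)"

lemma act_in: "act l f \<in> sym_maps \<longleftrightarrow> f \<in> sym_maps"
  by (simp add: act_def jet_in)

lemma act_commute: "comp_fun_commute act"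
proof
  fix k l
  have "act k (act l f) = act l (act k f)" for f
  proof (cases "f \<in> sym_maps")
    case True
    then show ?thesis
      unfolding act_def using tame_commute[OF tame_jet tame_jet True] jet_in[OF True] by simp
  qed (simp add: act_def)
  then show "act k \<circ> act l = act l \<circ> act k" by (simp add: fun_eq_iff)
qed

definition acts :: "('a \<times> nat) multiset \<Rightarrow> 'a multiset \<Rightarrow> 'a" where
  "acts P = fold_mset act unit_map P"

lemma acts_empty [simp]: "acts {#} = unit_map"
  by (simp add: acts_def)

lemma acts_in: "acts P \<in> sym_maps"
  by (induction P) (simp_all add: acts_def comp_fun_commute.fold_mset_add_mset[OF act_commute] act_in unit_map_in)

lemma acts_add_mset [simp]: "acts (add_mset (a, Suc k) P) = jet a k (acts P)"
  using acts_in[of P] by (simp add: acts_def comp_fun_commute.fold_mset_add_mset[OF act_commute] act_def)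

text \<open>
  Evaluation of a differential monomial; the pair \<open>(a, k)\<close> stands for \<open>D\<^sup>k a\<close>.
\<close>
definition contract :: "('a \<times> nat) multiset \<Rightarrow> 'a" where
  "contract M = acts {#l \<in># M. snd l \<noteq> 0#} (image_mset fst {#l \<in># M. snd l = 0#})"

lemma contract_add_0: "contract (add_mset (a, 0) M)
    = acts {#l \<in># M. snd l \<noteq> 0#} (add_mset a (image_mset fst {#l \<in># M. snd l = 0#}))"
  by (simp add: contract_def)

lemma contract_add_Suc: "contract (add_mset (a, Suc k) M)
    = jet a k (acts {#l \<in># M. snd l \<noteq> 0#}) (image_mset fst {#l \<in># M. snd l = 0#})"
  by (simp add: contract_def)

lemma contract_single [simp]: "contract {#(a, 0)#} = a"
  by (simp add: contract_def)

lemma contract_add: "contract (add_mset (a + b, k) M) = contract (add_mset (a, k) M) + contract (add_mset (b, k) M)"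
  by (cases k) (simp_all add: contract_add_0 contract_add_Suc jet_add op_add_arg[OF sym_mapsD[OF acts_in]])

lemma contract_sc: "contract (add_mset (sc s a, k) M) = sc s (contract (add_mset (a, k) M))"
  by (cases k) (simp_all add: contract_add_0 contract_add_Suc jet_sc op_sc[OF sym_mapsD[OF acts_in]])

lemma contract_product:
  "(\<Sum>i\<le>m. sc (of_nat (m choose i)) (contract (add_mset (a, Suc i) (add_mset (b, m - i) M))))
    = sc 1 (contract (add_mset (a \<odot> b, m) M))"
proof (cases m)
  case 0
  let ?f = "acts {#l \<in># M. snd l \<noteq> 0#}"
  have "a \<odot> ?f (add_mset b N) = ?f (add_mset (a \<odot> b) N)" for N
    by (rule op_circ_right[OF sym_mapsD[OF acts_in], symmetric])
  then show ?thesis by (simp add: 0 contract_def)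
next
  case (Suc n)
  let ?f = "acts {#l \<in># M. snd l \<noteq> 0#}" and ?Z = "image_mset fst {#l \<in># M. snd l = 0#}"
  have "contract (add_mset (a, Suc i) (add_mset (b, m - i) M)) = jet a i (jet b (n - i) ?f) ?Z" if "i \<le> n" for i
    using that by (simp add: contract_def Suc Suc_diff_le)
  moreover have "contract (add_mset (a, Suc m) (add_mset (b, 0) M)) = jet a m ?f (add_mset b ?Z)"
    by (simp add: contract_def)
  moreover have "contract (add_mset (a \<odot> b, m) M) = jet (a \<odot> b) n ?f ?Z"
    by (simp add: contract_def Suc)
  ultimately show ?thesis
    using jet_product[OF acts_in, of n a b "{#l \<in># M. snd l \<noteq> 0#}" ?Z] by (simp add: Suc)
qed

lemma jet_support:
  assumes f: "f \<in> sym_maps" and d: "\<And>M. f M \<noteq> 0 \<Longrightarrow> int (size M) = d" and nz: "jet a n f M \<noteq> 0"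
  shows "int (size M) = d + int n"
proof -
  have "n \<le> size M" using tame_small[OF tame_jet f, of M n a] nz by (meson not_le)
  then obtain A B where AB: "M = A + B" "size A = n" using split_size by blast
  then have "f B \<noteq> 0"
    using nz tame_eq[OF tame_jet f AB(2), of a B] op_zero_arg[OF tame_op[OF tame_jet AB(2)]] by auto
  then show ?thesis using d AB by fastforce
qed

lemma acts_support:
  assumes "\<forall>l\<in>#P. snd l \<noteq> 0" "acts P M \<noteq> 0"
  shows "int (size M) = 1 + (\<Sum>l\<in>#P. int (snd l) - 1)"
  using assms
proof (induction P arbitrary: M)
  case empty
  then show ?case using unit_map_other[of M] by auto
next
  case (add l P)
  then obtain a k where l: "l = (a, Suc k)" by (cases l, cases "snd l") auto
  have "int (size M) = (1 + (\<Sum>l\<in>#P. int (snd l) - 1)) + int k"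
    by (rule jet_support[OF acts_in[of P], of _ a]) (use add l in auto)
  then show ?case by (simp add: l)
qed

text \<open>
  A letter of order \<open>k > 0\<close> raises the arity by \<open>k - 1\<close>, starting from arity \<open>1\<close>, and the letters of order
  \<open>0\<close> have to fill the arguments exactly.
\<close>
lemma contract_weight:
  assumes "contract M \<noteq> 0"
  shows "(\<Sum>l\<in>#M. int (snd l) - 1) = -1"
proof -
  have "(\<Sum>l\<in>#M. int (snd l) - 1) = (\<Sum>l\<in>#{#l \<in># M. snd l \<noteq> 0#}. int (snd l) - 1)
     + (\<Sum>l\<in>#{#l \<in># M. \<not> snd l \<noteq> 0#}. int (snd l) - 1)"
    by (subst multiset_partition[of M "\<lambda>l. snd l \<noteq> 0"]) (simp only: image_mset_union sum_mset.union)
  also have "(\<Sum>l\<in>#{#l \<in># M. \<not> snd l \<noteq> 0#}. int (snd l) - 1) = - int (size {#l \<in># M. snd l = 0#})"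
    by (induction M) auto
  finally show ?thesis
    using acts_support[OF _ assms[unfolded contract_def]] by simp
qed

end

section \<open>Differential polynomials over a Novikov algebra\<close>

definition lin :: "('i \<Rightarrow> 's \<Rightarrow> 'b) \<Rightarrow> ('i \<Rightarrow>\<^sub>0 's :: zero) \<Rightarrow> 'b :: comm_monoid_add" where
  "lin h u = (\<Sum>i\<in>Poly_Mapping.keys u. h i (Poly_Mapping.lookup u i))"

lemma lin_zero [simp]: "lin h 0 = 0"
  by (simp add: lin_def)

lemma lin_single: "h i 0 = 0 \<Longrightarrow> lin h (Poly_Mapping.single i c) = h i c"
  by (simp add: lin_def)

lemma lin_add:
  fixes u v :: "'i \<Rightarrow>\<^sub>0 's :: monoid_add"
  assumes "\<And>i. h i 0 = 0" "\<And>i s t. h i (s + t) = h i s + h i t"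
  shows "lin h (u + v) = lin h u + lin h v"
  unfolding lin_def by (rule setsum_keys_plus_distrib) (use assms in auto)

lemma poly_mapping_eq_sum_single:
  fixes u :: "'i \<Rightarrow>\<^sub>0 's :: comm_monoid_add"
  shows "u = (\<Sum>i\<in>Poly_Mapping.keys u. Poly_Mapping.single i (Poly_Mapping.lookup u i))"
  by (rule poly_mapping_eqI) (auto simp: lookup_sum lookup_single when_def in_keys_iff)

lemma poly_mapping_additive_induct [case_names single add]:
  fixes u :: "'i \<Rightarrow>\<^sub>0 's :: comm_monoid_add"
  assumes single: "\<And>i c. P (Poly_Mapping.single i c)" and add: "\<And>u v. P u \<Longrightarrow> P v \<Longrightarrow> P (u + v)"
  shows "P u"
proof -
  have "P (\<Sum>i\<in>I. Poly_Mapping.single i (Poly_Mapping.lookup u i))" if "finite I" for I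
    using that
  proof induction
    case empty
    then show ?case using single[of undefined 0] by simp
  qed (simp add: single add)
  then show ?thesis using poly_mapping_eq_sum_single[of u] by (metis finite_keys)
qed

locale diff_ring =
  fixes D :: "'u :: comm_ring_1 \<Rightarrow> 'u"
  assumes D_add: "D (u + v) = D u + D v"
    and D_mult: "D (u * v) = D u * v + u * D v"
begin

lemma D_zero [simp]: "D 0 = 0"
  using D_add[of 0 0] by simp

lemma D_uminus: "D (- u) = - D u"
  using D_add[of u "- u"] by (simp add: eq_neg_iff_add_eq_0 add.commute)

lemma D_diff: "D (u - v) = D u - D v"
  using D_add[of u "- v"] by (simp add: D_uminus)

lemma D_sum: "D (sum f I) = (\<Sum>i\<in>I. D (f i))"
  by (induction I rule: infinite_finite_induct) (simp_all add: D_add)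

lemma Dn_add: "(D ^^ n) (u + v) = (D ^^ n) u + (D ^^ n) v"
  by (induction n) (simp_all add: D_add)

lemma Dn_zero [simp]: "(D ^^ n) 0 = 0"
  by (induction n) simp_all

lemma Dn_diff: "(D ^^ n) (u - v) = (D ^^ n) u - (D ^^ n) v"
  by (induction n) (simp_all add: D_diff)

lemma Dn_sum: "(D ^^ n) (sum f I) = (\<Sum>i\<in>I. (D ^^ n) (f i))"
  by (induction I rule: infinite_finite_induct) (simp_all add: Dn_add)

lemma D_one [simp]: "D 1 = 0"
  using D_mult[of 1 1] by simp

lemma D_of_nat [simp]: "D (of_nat n) = 0"
  by (induction n) (simp_all add: D_add)

lemma Leibniz: "(D ^^ m) (x * y) = (\<Sum>i\<le>m. of_nat (m choose i) * ((D ^^ i) x * (D ^^ (m - i)) y))"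
proof (induction m)
  case (Suc m)
  define T where "T i j = (D ^^ i) x * (D ^^ j) y" for i j
  have DT: "D (T i j) = T (Suc i) j + T i (Suc j)" for i j
    by (simp add: T_def D_mult)
  have "(D ^^ Suc m) (x * y) = (\<Sum>i\<le>m. of_nat (m choose i) * (T (Suc i) (m - i) + T i (Suc (m - i))))"
    using Suc by (simp add: D_sum D_mult DT flip: T_def)
  also have "\<dots> = (\<Sum>i\<le>Suc m. of_nat (Suc m choose i) * T i (Suc m - i))"
  proof -
    have "(\<Sum>i\<le>Suc m. of_nat (Suc m choose i) * T i (Suc m - i))
       = T 0 (Suc m) + (\<Sum>i\<le>m. of_nat (m choose i) * T (Suc i) (m - i) + of_nat (m choose Suc i) * T (Suc i) (m - i))"
      by (simp only: sum.atMost_Suc_shift binomial_Suc_Suc of_nat_add distrib_right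
          binomial_n_0 of_nat_1 diff_zero diff_Suc_Suc mult_1)
    moreover have "T 0 (Suc m) + (\<Sum>i\<le>m. of_nat (m choose Suc i) * T (Suc i) (m - i))
       = (\<Sum>i\<le>Suc m. of_nat (m choose i) * T i (Suc m - i))"
      by (simp only: sum.atMost_Suc_shift binomial_n_0 of_nat_1 diff_zero diff_Suc_Suc mult_1)
    moreover have "\<dots> = (\<Sum>i\<le>m. of_nat (m choose i) * T i (Suc (m - i)))"
      by (simp add: Suc_diff_le binomial_eq_0)
    ultimately show ?thesis by (simp add: sum.distrib algebra_simps)
  qed
  finally show ?case by (simp add: T_def)
qed simp

end

type_synonym ('l, 's) dpoly = "('l \<times> nat) multiset \<Rightarrow>\<^sub>0 's"

definition dletter :: "'l \<Rightarrow> nat \<Rightarrow> ('l, 's :: comm_ring_1) dpoly" where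
  "dletter a k = Poly_Mapping.single {#(a, k)#} 1"

definition dconst :: "'s :: comm_ring_1 \<Rightarrow> ('l, 's) dpoly" where
  "dconst s = Poly_Mapping.single {#} s"

definition dmono :: "('l \<times> nat) multiset \<Rightarrow> ('l, 's :: comm_ring_1) dpoly" where
  "dmono M = Poly_Mapping.single M 1"

definition dder :: "('l, 's :: comm_ring_1) dpoly \<Rightarrow> ('l, 's) dpoly" where
  "dder = lin (\<lambda>M c. \<Sum>l\<in>#M. Poly_Mapping.single (add_mset (fst l, Suc (snd l)) (M - {#l#})) c)"

lemma dconst_add: "dconst (s + t) = dconst s + dconst t"
  by (simp add: dconst_def single_add)

lemma dconst_mult: "dconst (s * t) = dconst s * dconst t"
  by (simp add: dconst_def mult_single)

lemma dconst_1 [simp]: "dconst 1 = 1"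
  by (simp add: dconst_def flip: zero_multiset_def)

lemma single_eq_dmono: "Poly_Mapping.single M s = dconst s * dmono M"
  by (simp add: dconst_def dmono_def mult_single)

lemma dmono_add_mset: "dmono (add_mset (a, k) M) = dletter a k * dmono M"
  by (simp add: dmono_def dletter_def mult_single)

lemma dmono_empty [simp]: "dmono {#} = 1"
  by (simp add: dmono_def flip: zero_multiset_def)

lemma dder_add: "dder (u + v) = dder u + dder v"
  unfolding dder_def by (rule lin_add) (simp_all add: single_add sum_mset.distrib)

lemma dder_single: "dder (Poly_Mapping.single M c) = (\<Sum>l\<in>#M. Poly_Mapping.single (add_mset (fst l, Suc (snd l)) (M - {#l#})) c)"
  unfolding dder_def by (rule lin_single) simp

lemma dder_dletter: "dder (dletter a k) = dletter a (Suc k)"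
  by (simp add: dletter_def dder_single)

lemma dder_dconst [simp]: "dder (dconst s) = 0"
  by (simp add: dconst_def dder_single)

interpretation dder: diff_ring dder
proof
  show "dder (u + v) = dder u + dder v" for u v :: "('l, 's :: comm_ring_1) dpoly"
    by (rule dder_add)
next
  fix u v :: "('l, 's :: comm_ring_1) dpoly"
  show "dder (u * v) = dder u * v + u * dder v"
  proof (induction u rule: poly_mapping_additive_induct)
    case (single M c)
    show ?case
    proof (induction v rule: poly_mapping_additive_induct)
      case (single N d)
      have "(\<Sum>l\<in>#M. Poly_Mapping.single (add_mset (fst l, Suc (snd l)) (M + N - {#l#})) (c * d))
          = (\<Sum>l\<in>#M. Poly_Mapping.single (add_mset (fst l, Suc (snd l)) (M - {#l#})) c * Poly_Mapping.single N d)"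
        by (intro arg_cong[of _ _ sum_mset] image_mset_cong) (auto simp: mult_single dest!: multi_member_split)
      moreover have "(\<Sum>l\<in>#N. Poly_Mapping.single (add_mset (fst l, Suc (snd l)) (M + N - {#l#})) (c * d))
          = (\<Sum>l\<in>#N. Poly_Mapping.single M c * Poly_Mapping.single (add_mset (fst l, Suc (snd l)) (N - {#l#})) d)"
        by (intro arg_cong[of _ _ sum_mset] image_mset_cong) (auto simp: mult_single dest!: multi_member_split)
      ultimately show ?case
        by (simp only: mult_single dder_single image_mset_union sum_mset.union sum_mset_distrib_left sum_mset_distrib_right)
    qed (simp_all add: dder_add algebra_simps)
  qed (simp_all add: dder_add algebra_simps)
qed

lemma dder_dconst_mult: "dder (dconst s * u) = dconst s * dder u"
  by (simp add: dder.D_mult)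

lemma dder_pow_dletter: "(dder ^^ m) (dletter a k) = dletter a (k + m)"
  by (induction m) (simp_all add: dder_dletter)

lemma dder_pow_dconst_mult: "(dder ^^ m) (dconst s * u) = dconst s * (dder ^^ m) u"
  by (induction m) (simp_all add: dder_dconst_mult)

lemma of_nat_dconst: "of_nat n = dconst (of_nat n)"
  by (simp add: dconst_def flip: zero_multiset_def)

context novikov_ring
begin

definition eval :: "('a, 's) dpoly \<Rightarrow> 'a" where
  "eval = lin (\<lambda>M s. sc s (contract M))"

lemma eval_add: "eval (u + v) = eval u + eval v"
  unfolding eval_def by (rule lin_add) (simp_all add: sc_add_left)

lemma eval_zero [simp]: "eval 0 = 0"
  by (simp add: eval_def)

lemma eval_diff: "eval (u - v) = eval u - eval v"
  using eval_add[of "u - v" v] by (simp add: algebra_simps)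

lemma eval_sum: "eval (sum f I) = (\<Sum>i\<in>I. eval (f i))"
  by (induction I rule: infinite_finite_induct) (simp_all add: eval_add)

lemma eval_single: "eval (Poly_Mapping.single M s) = sc s (contract M)"
  unfolding eval_def by (rule lin_single) simp

lemma eval_dconst: "eval (dconst s * u) = sc s (eval u)"
  by (induction u rule: poly_mapping_additive_induct)
    (simp_all add: dconst_def mult_single eval_single eval_add sc_mult sc_add_right distrib_left)

lemma eval_dmono: "eval (dmono M) = sc 1 (contract M)"
  by (simp add: dmono_def eval_single)

lemma eval_single_mult: "eval (Poly_Mapping.single M s * u) = sc s (eval (dmono M * u))"
  by (simp add: single_eq_dmono mult.assoc eval_dconst)

text \<open>
  The largest differential ideal on which the evaluation vanishes.
\<close>
definition kern :: "('a, 's) dpoly set" where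
  "kern = {u. \<forall>q m. eval (q * (dder ^^ m) u) = 0}"

lemma kernI:
  assumes "\<And>M m. eval (dmono M * (dder ^^ m) u) = 0"
  shows "u \<in> kern"
proof -
  have "eval (q * (dder ^^ m) u) = 0" for q m
    by (induction q rule: poly_mapping_additive_induct)
      (simp_all add: eval_single_mult assms eval_add distrib_right)
  then show ?thesis by (simp add: kern_def)
qed

lemma kern_eval: "u \<in> kern \<Longrightarrow> eval u = 0"
  unfolding kern_def mem_Collect_eq by (metis funpow_0 mult_1)

lemma kern_zero: "0 \<in> kern"
  by (simp add: kern_def)

lemma kern_diff: "u \<in> kern \<Longrightarrow> v \<in> kern \<Longrightarrow> u - v \<in> kern"
  by (simp add: kern_def dder.Dn_diff right_diff_distrib eval_diff)

lemma kern_mult: "u \<in> kern \<Longrightarrow> r * u \<in> kern"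
proof -
  assume u: "u \<in> kern"
  have "q * (of_nat (m choose i) * ((dder ^^ i) r * (dder ^^ (m - i)) u))
     = (q * of_nat (m choose i) * (dder ^^ i) r) * (dder ^^ (m - i)) u" for q m i
    by (simp add: mult.assoc)
  moreover have "eval (q' * (dder ^^ i) u) = 0" for q' i using u by (simp add: kern_def)
  ultimately show ?thesis
    unfolding kern_def mem_Collect_eq dder.Leibniz sum_distrib_left eval_sum by (simp only: sum.neutral_const simp_thms)
qed

lemma kern_dder: "u \<in> kern \<Longrightarrow> dder u \<in> kern"
  unfolding kern_def mem_Collect_eq by (metis funpow_Suc_right comp_apply)

lemma kern_letter_add: "dletter (a + b) k - (dletter a k + dletter b k) \<in> kern"
proof (rule kernI)
  fix M m
  have "(dmono M :: ('a, 's) dpoly) * (dder ^^ m) (dletter (a + b) k - (dletter a k + dletter b k))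
      = dmono (add_mset (a + b, k + m) M) - (dmono (add_mset (a, k + m) M) + dmono (add_mset (b, k + m) M))"
    by (simp add: dder.Dn_diff dder.Dn_add dder_pow_dletter dmono_add_mset algebra_simps)
  then show "eval (dmono M * (dder ^^ m) (dletter (a + b) k - (dletter a k + dletter b k))) = 0"
    by (simp add: eval_diff eval_add eval_dmono contract_add sc_add_right)
qed

lemma kern_letter_sc: "dletter (sc s a) k - dconst s * dletter a k \<in> kern"
proof (rule kernI)
  fix M m
  have "dmono M * (dder ^^ m) (dletter (sc s a) k - dconst s * dletter a k)
      = dmono (add_mset (sc s a, k + m) M) - dconst s * dmono (add_mset (a, k + m) M)"
    by (simp add: dder.Dn_diff dder_pow_dletter dder_pow_dconst_mult dmono_add_mset algebra_simps)
  then show "eval (dmono M * (dder ^^ m) (dletter (sc s a) k - dconst s * dletter a k)) = 0"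
    by (simp add: eval_diff eval_dconst eval_dmono contract_sc flip: sc_mult)
qed

text \<open>
  In the quotient by \<open>kern\<close> the product of \<open>A\<close> is \<open>D(a) \<cdot> b\<close>. Tested with \<open>D\<^sup>m\<close> inside a monomial this is
  \<open>contract_product\<close>.
\<close>
lemma kern_product: "dletter a 1 * dletter b 0 - dletter (a \<odot> b) 0 \<in> kern"
proof (rule kernI)
  fix M m
  let ?t = "\<lambda>i. of_nat (m choose i) * (dletter a (Suc i) * dletter b (m - i)) :: ('a, 's) dpoly"
  have t: "dmono M * ?t i = dconst (of_nat (m choose i)) * dmono (add_mset (a, Suc i) (add_mset (b, m - i) M))" for i
    by (simp add: of_nat_dconst dmono_add_mset algebra_simps)
  have "(dmono M :: ('a, 's) dpoly) * (dder ^^ m) (dletter a 1 * dletter b 0 - dletter (a \<odot> b) 0)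
      = (\<Sum>i\<le>m. dmono M * ?t i) - dmono (add_mset (a \<odot> b, m) M)"
    by (simp add: dder.Dn_diff dder.Leibniz dder_pow_dletter dmono_add_mset right_diff_distrib sum_distrib_left
        mult.commute[of "dmono M" "dletter (a \<odot> b) m"])
  also have "eval \<dots> = (\<Sum>i\<le>m. sc 1 (sc (of_nat (m choose i)) (contract (add_mset (a, Suc i) (add_mset (b, m - i) M)))))
      - sc 1 (contract (add_mset (a \<odot> b, m) M))"
    by (simp only: t eval_diff eval_sum eval_dconst eval_dmono sc_mult[symmetric] mult.commute)
  also have "\<dots> = 0"
    by (simp only: contract_product sc_sum[symmetric] sc_mult[symmetric] mult_1 diff_self)
  finally show "eval (dmono M * (dder ^^ m) (dletter a 1 * dletter b 0 - dletter (a \<odot> b) 0)) = 0" .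
qed

text \<open>
  The letter \<open>a\<close> itself evaluates to \<open>sc 1 a\<close>, so \<open>A\<close> embeds into the quotient by \<open>kern\<close>.
\<close>
lemma kern_letter_zero: "dletter a 0 \<in> kern \<Longrightarrow> sc 1 a = 0"
  using kern_eval[of "dletter a 0"] by (simp add: dletter_def eval_single)

lemma eval_weight:
  assumes "(\<Sum>l\<in>#M. int (snd l) - 1) \<noteq> -1"
  shows "eval (Poly_Mapping.single M s) = 0"
  using contract_weight[of M] assms by (cases "contract M = 0") (simp_all add: eval_single)

end

section \<open>Polynomial dependence modulo a differential ideal\<close>

text \<open>
  The rows are the coefficients of the Lagrange interpolation polynomials for the nodes \<open>0, \<dots>, N - 1\<close>.
  Since the inverse has entries in the field, coefficients of polynomial functions can be recovered in any
  vector space, even when the values are also multiplied by scalars from a larger ring.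
\<close>
lemma vandermonde_inverse_exists:
  "\<exists>\<kappa> :: nat \<Rightarrow> nat \<Rightarrow> 'k :: field_char_0. \<forall>i<N. \<forall>l<N.
     (\<Sum>r<N. \<kappa> i r * of_nat r ^ l) = (if i = l then 1 else 0)"
proof -
  define L :: "nat \<Rightarrow> 'k poly" where
    "L r = (\<Prod>s\<in>{..<N} - {r}. smult (1 / (of_nat r - of_nat s)) [:- of_nat s, 1:])" for r
  have val: "poly (L r) (of_nat t) = (if t = r then 1 else 0)" if "r < N" "t < N" for r t
  proof (cases "t = r")
    case True
    then show ?thesis by (auto simp: L_def poly_prod intro!: prod.neutral simp flip: diff_divide_distrib)
  next
    case False
    then show ?thesis using that by (auto simp: L_def poly_prod intro!: prod_zero bexI[of _ t])
  qed
  have deg: "degree (L r) < N" if "r < N" for r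
  proof -
    have "degree (L r) \<le> sum (degree \<circ> (\<lambda>s. smult (1 / (of_nat r - of_nat s)) [:- of_nat s, 1 :: 'k:])) ({..<N} - {r})"
      unfolding L_def by (rule degree_prod_sum_le) simp
    also have "\<dots> \<le> (\<Sum>s\<in>{..<N} - {r}. 1)"
      by (intro sum_mono) simp
    also have "\<dots> < N" using that by simp
    finally show ?thesis .
  qed
  have eq: "(\<Sum>r<N. smult (of_nat r ^ l) (L r)) = monom 1 l" if l: "l < N" for l
  proof (rule poly_eqI_degree[where A = "of_nat ` {..<N}"])
    fix x :: 'k assume "x \<in> of_nat ` {..<N}"
    then obtain t where t: "x = of_nat t" "t < N" by auto
    have "poly (\<Sum>r<N. smult (of_nat r ^ l) (L r)) x = (\<Sum>r<N. of_nat r ^ l * (if t = r then 1 else 0))"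
      unfolding poly_sum by (intro sum.cong refl) (simp add: t val)
    also have "\<dots> = of_nat t ^ l" using t by (subst sum.remove[of _ t]) auto
    finally show "poly (\<Sum>r<N. smult (of_nat r ^ l) (L r)) x = poly (monom 1 l) x"
      by (simp add: t poly_monom)
  next
    have c: "card ((of_nat :: nat \<Rightarrow> 'k) ` {..<N}) = N" by (simp add: card_image inj_on_def)
    have "degree (\<Sum>r<N. smult (of_nat r ^ l) (L r)) \<le> N - 1"
    proof (rule degree_sum_le)
      fix r assume "r \<in> {..<N}"
      then show "degree (smult (of_nat r ^ l) (L r)) \<le> N - 1"
        using deg[of r] degree_smult_le[of "of_nat r ^ l" "L r"] by simp
    qed simp
    then show "degree (\<Sum>r<N. smult (of_nat r ^ l) (L r)) < card ((of_nat :: nat \<Rightarrow> 'k) ` {..<N})"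
      using l c by simp
    show "degree (monom (1 :: 'k) l) < card ((of_nat :: nat \<Rightarrow> 'k) ` {..<N})"
      using l c by (simp add: degree_monom_eq)
  qed
  have "(\<Sum>r<N. coeff (L r) i * of_nat r ^ l) = (if i = l then 1 else 0)" if "l < N" for i l
    using arg_cong[OF eq[OF that], of "\<lambda>p. coeff p i"] by (simp add: coeff_sum mult.commute eq_commute)
  then show ?thesis by (intro exI[of _ "\<lambda>i r. coeff (L r) i"]) auto
qed

definition vandermonde_inverse :: "nat \<Rightarrow> nat \<Rightarrow> nat \<Rightarrow> 'k :: field_char_0" where
  "vandermonde_inverse N = (SOME \<kappa>. \<forall>i<N. \<forall>l<N.
     (\<Sum>r<N. \<kappa> i r * of_nat r ^ l) = (if i = l then 1 else 0))"

lemma vandermonde_inverse: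
  "i < N \<Longrightarrow> l < N \<Longrightarrow>
    (\<Sum>r<N. vandermonde_inverse N i r * of_nat r ^ l) = (if i = l then 1 else (0 :: 'k :: field_char_0))"
  using someI_ex[OF vandermonde_inverse_exists[of N, where ?'k = 'k]]
  unfolding vandermonde_inverse_def by blast

lemma const_poly_of_nat_power: "[:c:] * of_nat r ^ l = [:c * of_nat r ^ l :: 'k :: field_char_0:]"
  by (induction l) (simp_all add: of_nat_poly algebra_simps)

text \<open>
  \<open>\<iota>\<close> embeds the ring of momenta, whose elements are constants for the derivation.
\<close>
locale diff_ideal = diff_ring D for D :: "'u :: comm_ring_1 \<Rightarrow> 'u" +
  fixes J :: "'u set" and \<iota> :: "'k :: field_char_0 poly \<Rightarrow> 'u"
  assumes J_zero: "0 \<in> J"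
    and J_diff: "u \<in> J \<Longrightarrow> v \<in> J \<Longrightarrow> u - v \<in> J"
    and J_mult: "u \<in> J \<Longrightarrow> r * u \<in> J"
    and J_D: "u \<in> J \<Longrightarrow> D u \<in> J"
    and \<iota>_add: "\<iota> (s + t) = \<iota> s + \<iota> t"
    and \<iota>_mult: "\<iota> (s * t) = \<iota> s * \<iota> t"
    and \<iota>_1: "\<iota> 1 = 1"
    and D_\<iota>: "D (\<iota> s) = 0"
begin

lemma J_uminus: "u \<in> J \<Longrightarrow> - u \<in> J"
  using J_diff[OF J_zero] by simp

lemma J_add: "u \<in> J \<Longrightarrow> v \<in> J \<Longrightarrow> u + v \<in> J"
  using J_diff[OF _ J_uminus, of u v] by simp

lemma J_sum: "(\<And>i. i \<in> I \<Longrightarrow> f i \<in> J) \<Longrightarrow> sum f I \<in> J"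
  by (induction I rule: infinite_finite_induct) (simp_all add: J_zero J_add)

lemma J_Dn: "u \<in> J \<Longrightarrow> (D ^^ n) u \<in> J"
  by (induction n) (simp_all add: J_D)

lemma \<iota>_zero [simp]: "\<iota> 0 = 0"
  using \<iota>_add[of 0 0] by simp

lemma \<iota>_uminus: "\<iota> (- s) = - \<iota> s"
  using \<iota>_add[of s "- s"] by (simp add: eq_neg_iff_add_eq_0 add.commute)

lemma \<iota>_diff: "\<iota> (s - t) = \<iota> s - \<iota> t"
  using \<iota>_add[of s "- t"] by (simp add: \<iota>_uminus)

lemma \<iota>_sum: "\<iota> (sum f I) = (\<Sum>i\<in>I. \<iota> (f i))"
  by (induction I rule: infinite_finite_induct) (simp_all add: \<iota>_add)

lemma D_\<iota>_mult: "D (\<iota> s * u) = \<iota> s * D u"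
  by (simp add: D_mult D_\<iota>)

lemma Dn_\<iota>_mult: "(D ^^ n) (\<iota> s * u) = \<iota> s * (D ^^ n) u"
  by (induction n) (simp_all add: D_\<iota>_mult)

definition cg :: "'u \<Rightarrow> 'u \<Rightarrow> bool" (infix "\<approx>" 50) where "u \<approx> v \<longleftrightarrow> u - v \<in> J"

lemma cg_refl [simp]: "u \<approx> u" by (simp add: cg_def J_zero)

lemma cg_sym: "u \<approx> v \<Longrightarrow> v \<approx> u"
  using J_uminus[of "u - v"] by (simp add: cg_def)

lemma cg_trans [trans]: "u \<approx> v \<Longrightarrow> v \<approx> w \<Longrightarrow> u \<approx> w"
  using J_add[of "u - v" "v - w"] by (simp add: cg_def)

lemma eq_cg_trans [trans]: "u = v \<Longrightarrow> v \<approx> w \<Longrightarrow> u \<approx> w"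
  and cg_eq_trans [trans]: "u \<approx> v \<Longrightarrow> v = w \<Longrightarrow> u \<approx> w"
  by simp_all

lemma cg_add: "u \<approx> v \<Longrightarrow> u' \<approx> v' \<Longrightarrow> u + u' \<approx> v + v'"
  using J_add[of "u - v" "u' - v'"] by (simp add: cg_def algebra_simps)

lemma cg_diff: "u \<approx> v \<Longrightarrow> u' \<approx> v' \<Longrightarrow> u - u' \<approx> v - v'"
  using J_diff[of "u - v" "u' - v'"] by (simp add: cg_def algebra_simps)

lemma cg_mult_left: "u \<approx> v \<Longrightarrow> r * u \<approx> r * v"
  using J_mult[of "u - v" r] by (simp add: cg_def algebra_simps)

lemma cg_mult: "u \<approx> v \<Longrightarrow> u' \<approx> v' \<Longrightarrow> u * u' \<approx> v * v'"
  by (metis cg_mult_left cg_trans mult.commute)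

lemma cg_sum: "(\<And>i. i \<in> I \<Longrightarrow> f i \<approx> g i) \<Longrightarrow> sum f I \<approx> sum g I"
  using J_sum[of I "\<lambda>i. f i - g i"] by (simp add: cg_def sum_subtractf)

lemma cg_D: "u \<approx> v \<Longrightarrow> D u \<approx> D v"
  using J_D[of "u - v"] by (simp add: cg_def D_diff)

lemma cg_Dn: "u \<approx> v \<Longrightarrow> (D ^^ n) u \<approx> (D ^^ n) v"
  using J_Dn[of "u - v"] by (simp add: cg_def Dn_diff)

text \<open>
  Polynomial dependence on a momentum, of degree less than \<open>N\<close>, in the quotient by \<open>J\<close>.
\<close>
definition poly_mod :: "nat \<Rightarrow> ('k poly \<Rightarrow> 'u) \<Rightarrow> bool" where
  "poly_mod N f \<longleftrightarrow> (\<exists>e. \<forall>s. f s \<approx> (\<Sum>i<N. \<iota> (s ^ i) * e i))"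

definition lagrange :: "nat \<Rightarrow> ('k poly \<Rightarrow> 'u) \<Rightarrow> nat \<Rightarrow> 'u" where
  "lagrange N f i = (\<Sum>r<N. \<iota> [:vandermonde_inverse N i r:] * f (of_nat r))"

lemma lagrange_coeff:
  assumes f: "\<And>r. f (of_nat r) \<approx> (\<Sum>i<N. \<iota> (of_nat r ^ i) * e i)" and i: "i < N"
  shows "lagrange N f i \<approx> e i"
proof -
  have "lagrange N f i \<approx> (\<Sum>r<N. \<iota> [:vandermonde_inverse N i r:] * (\<Sum>l<N. \<iota> (of_nat r ^ l) * e l))"
    unfolding lagrange_def by (intro cg_sum cg_mult_left f)
  also have "(\<Sum>r<N. \<iota> [:vandermonde_inverse N i r:] * (\<Sum>l<N. \<iota> (of_nat r ^ l) * e l))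
      = (\<Sum>l<N. \<iota> (\<Sum>r<N. [:vandermonde_inverse N i r:] * of_nat r ^ l) * e l)"
    unfolding sum_distrib_left \<iota>_sum sum_distrib_right \<iota>_mult
    by (subst sum.swap) (simp add: mult.assoc)
  also have "\<dots> = (\<Sum>l<N. (if i = l then 1 else 0) * e l)"
  proof (intro sum.cong refl)
    fix l assume l: "l \<in> {..<N}"
    have "(\<Sum>r<N. [:vandermonde_inverse N i r:] * of_nat r ^ l :: 'k poly) = [:\<Sum>r<N. vandermonde_inverse N i r * of_nat r ^ l:]"
      unfolding const_poly_of_nat_power by (induction N) (simp_all add: sum_to_poly)
    then show "\<iota> (\<Sum>r<N. [:vandermonde_inverse N i r:] * of_nat r ^ l) * e l = (if i = l then 1 else 0) * e l"
      using l i by (simp add: vandermonde_inverse \<iota>_1 flip: one_pCons)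
  qed
  also have "\<dots> = e i" using i by (subst sum.remove[of _ i]) auto
  finally show ?thesis .
qed

lemma poly_mod_lagrange:
  assumes "poly_mod N f"
  shows "f s \<approx> (\<Sum>i<N. \<iota> (s ^ i) * lagrange N f i)"
proof -
  obtain e where e: "\<And>s. f s \<approx> (\<Sum>i<N. \<iota> (s ^ i) * e i)" using assms by (auto simp: poly_mod_def)
  have "f s \<approx> (\<Sum>i<N. \<iota> (s ^ i) * e i)" by (rule e)
  also have "(\<Sum>i<N. \<iota> (s ^ i) * e i) \<approx> (\<Sum>i<N. \<iota> (s ^ i) * lagrange N f i)"
    by (intro cg_sum cg_mult_left cg_sym[OF lagrange_coeff[OF e]]) simp
  finally show ?thesis .
qed

lemma poly_mod_cong: "poly_mod N f \<Longrightarrow> (\<And>s. g s \<approx> f s) \<Longrightarrow> poly_mod N g"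
  unfolding poly_mod_def using cg_trans by blast

lemma poly_mod_mono: "poly_mod N f \<Longrightarrow> N \<le> M \<Longrightarrow> poly_mod M f"
proof -
  assume "poly_mod N f" and NM: "N \<le> M"
  then obtain e where e: "\<And>s. f s \<approx> (\<Sum>i<N. \<iota> (s ^ i) * e i)" by (auto simp: poly_mod_def)
  have "(\<Sum>i<N. \<iota> (s ^ i) * e i) = (\<Sum>i<M. \<iota> (s ^ i) * (if i < N then e i else 0))" for s
    using NM by (intro sum.mono_neutral_cong_left) auto
  then show "poly_mod M f" unfolding poly_mod_def using e by (intro exI[of _ "\<lambda>i. if i < N then e i else 0"]) simp
qed

lemma poly_mod_zero: "poly_mod N (\<lambda>s. 0)"
  unfolding poly_mod_def by (intro exI[of _ "\<lambda>_. 0"]) simp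

lemma poly_mod_add: "poly_mod N f \<Longrightarrow> poly_mod N g \<Longrightarrow> poly_mod N (\<lambda>s. f s + g s)"
proof -
  assume "poly_mod N f" "poly_mod N g"
  then obtain e e' where "\<And>s. f s \<approx> (\<Sum>i<N. \<iota> (s ^ i) * e i)" "\<And>s. g s \<approx> (\<Sum>i<N. \<iota> (s ^ i) * e' i)"
    by (auto simp: poly_mod_def)
  then have "f s + g s \<approx> (\<Sum>i<N. \<iota> (s ^ i) * (e i + e' i))" for s
    using cg_add by (simp add: distrib_left sum.distrib)
  then show ?thesis unfolding poly_mod_def by (intro exI[of _ "\<lambda>i. e i + e' i"]) simp
qed

lemma poly_mod_mult: "poly_mod N f \<Longrightarrow> poly_mod N (\<lambda>s. u * f s)"
proof -
  assume "poly_mod N f"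
  then obtain e where e: "\<And>s. f s \<approx> (\<Sum>i<N. \<iota> (s ^ i) * e i)" by (auto simp: poly_mod_def)
  have "u * f s \<approx> (\<Sum>i<N. \<iota> (s ^ i) * (u * e i))" for s
    using cg_mult_left[OF e, of u] by (simp add: sum_distrib_left mult.left_commute)
  then show ?thesis unfolding poly_mod_def by (intro exI[of _ "\<lambda>i. u * e i"]) simp
qed

lemma poly_mod_mult_right: "poly_mod N f \<Longrightarrow> poly_mod N (\<lambda>s. f s * u)"
  using poly_mod_mult[of N f u] by (simp add: mult.commute)

lemma poly_mod_diff: "poly_mod N f \<Longrightarrow> poly_mod N g \<Longrightarrow> poly_mod N (\<lambda>s. f s - g s)"
  using poly_mod_add[of N f "\<lambda>s. - 1 * g s"] poly_mod_mult[of N g "- 1"] by simp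

lemma poly_mod_sum: "(\<And>i. i \<in> I \<Longrightarrow> poly_mod N (f i)) \<Longrightarrow> poly_mod N (\<lambda>s. \<Sum>i\<in>I. f i s)"
  by (induction I rule: infinite_finite_induct) (simp_all add: poly_mod_zero poly_mod_add)

lemma poly_mod_Dn: "poly_mod N f \<Longrightarrow> poly_mod N (\<lambda>s. (D ^^ m) (f s))"
proof -
  assume "poly_mod N f"
  then obtain e where e: "\<And>s. f s \<approx> (\<Sum>i<N. \<iota> (s ^ i) * e i)" by (auto simp: poly_mod_def)
  have "(D ^^ m) (f s) \<approx> (\<Sum>i<N. \<iota> (s ^ i) * (D ^^ m) (e i))" for s
    using cg_Dn[OF e, of m] by (simp add: Dn_sum Dn_\<iota>_mult)
  then show ?thesis unfolding poly_mod_def by (intro exI[of _ "\<lambda>i. (D ^^ m) (e i)"]) simp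
qed

lemma poly_mod_const: "poly_mod (Suc 0) (\<lambda>s. u)"
  unfolding poly_mod_def by (intro exI[of _ "\<lambda>_. u"]) (simp add: \<iota>_1)

lemma poly_mod_var: "poly_mod N f \<Longrightarrow> poly_mod (Suc N) (\<lambda>s. \<iota> s * f s)"
proof -
  assume "poly_mod N f"
  then obtain e where e: "\<And>s. f s \<approx> (\<Sum>i<N. \<iota> (s ^ i) * e i)" by (auto simp: poly_mod_def)
  have "\<iota> s * f s \<approx> (\<Sum>i<Suc N. \<iota> (s ^ i) * (case i of 0 \<Rightarrow> 0 | Suc j \<Rightarrow> e j))" for s
    using cg_mult_left[OF e, of "\<iota> s"]
    by (subst sum.lessThan_Suc_shift) (simp add: sum_distrib_left \<iota>_mult mult.assoc)
  then show ?thesis unfolding poly_mod_def by (intro exI[of _ "\<lambda>i. case i of 0 \<Rightarrow> 0 | Suc j \<Rightarrow> e j"]) simp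
qed

lemma poly_mod_power: "poly_mod (Suc n) (\<lambda>s. \<iota> ((a + c * s) ^ n) * u)"
proof (induction n)
  case 0
  then show ?case using poly_mod_const[of u] by (simp add: \<iota>_1)
next
  case (Suc n)
  let ?f = "\<lambda>s. \<iota> ((a + c * s) ^ n) * u"
  have "poly_mod (Suc (Suc n)) (\<lambda>s. \<iota> a * ?f s + \<iota> c * (\<iota> s * ?f s))"
    by (intro poly_mod_add poly_mod_mult poly_mod_var poly_mod_mono[OF Suc]) (use Suc in auto)
  then show ?case by (simp add: \<iota>_mult \<iota>_add algebra_simps)
qed

lemma poly_mod_affine:
  assumes "poly_mod N f"
  shows "poly_mod N (\<lambda>s. f (a + c * s))"
proof -
  obtain e where e: "\<And>s. f s \<approx> (\<Sum>i<N. \<iota> (s ^ i) * e i)" using assms by (auto simp: poly_mod_def)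
  have "poly_mod N (\<lambda>s. \<Sum>i<N. \<iota> ((a + c * s) ^ i) * e i)"
    by (intro poly_mod_sum poly_mod_mono[OF poly_mod_power]) auto
  then show ?thesis by (rule poly_mod_cong) (rule e)
qed

text \<open>
  The coefficients in one variable are combinations, with coefficients in the field, of finitely many
  values, hence are themselves polynomial in the other variable.
\<close>
lemma poly_mod_two:
  assumes 1: "\<And>t. poly_mod N (\<lambda>s. f s t)" and 2: "\<And>s. poly_mod M (f s)"
  shows "poly_mod (N + M) (\<lambda>s. f s (- s))"
proof -
  define e where "e t = lagrange N (\<lambda>s. f s t)" for t
  have e: "f s t \<approx> (\<Sum>i<N. \<iota> (s ^ i) * e t i)" for s t
    unfolding e_def by (rule poly_mod_lagrange[OF 1])
  have "poly_mod M (\<lambda>t. e t i)" for i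
    unfolding e_def lagrange_def by (intro poly_mod_sum poly_mod_mult 2)
  then obtain c where c: "\<And>i t. e t i \<approx> (\<Sum>j<M. \<iota> (t ^ j) * c i j)"
    unfolding poly_mod_def by metis
  have f: "f s (- s) \<approx> (\<Sum>i<N. \<iota> (s ^ i) * (\<Sum>j<M. \<iota> ((- s) ^ j) * c i j))" for s
    by (rule cg_trans[OF e]) (intro cg_sum cg_mult_left c)
  have m: "\<iota> (s ^ i) * (\<iota> ((- s) ^ j) * c i j) = \<iota> ((0 + 1 * s) ^ (i + j)) * ((-1) ^ j * c i j)" for s i j
  proof -
    have "s ^ i * (- s) ^ j = (-1) ^ j * s ^ (i + j)"
      by (simp add: power_minus[of s] power_add algebra_simps)
    moreover have "\<iota> ((-1) ^ j) = (-1) ^ j"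
      by (induction j) (simp_all add: \<iota>_1 \<iota>_mult \<iota>_uminus)
    ultimately show ?thesis by (simp add: \<iota>_mult[symmetric] mult.assoc[symmetric])
       (simp add: \<iota>_mult algebra_simps)
  qed
  have p: "poly_mod (N + M) (\<lambda>s. \<Sum>i<N. \<Sum>j<M. \<iota> ((0 + 1 * s) ^ (i + j)) * ((-1) ^ j * c i j))"
    by (intro poly_mod_sum poly_mod_mono[OF poly_mod_power]) auto
  show ?thesis
    by (rule poly_mod_cong[OF p]) (use f in \<open>simp only: sum_distrib_left m\<close>)
qed

end

section \<open>Locality of the derivatives of the generators\<close>

text \<open>
  \<open>g x \<alpha> k\<close> is the \<open>k\<close>-th derivative of the generator \<open>x\<close> with momentum \<open>\<alpha>\<close>. Only test monomials in these letters
  are used, by the assumption \<open>test\<close>: the bound \<open>N\<close> of \<open>loc\<close> holds between generators, not between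
  arbitrary elements.
\<close>
locale local_letters = diff_ideal D J \<iota>
  for D :: "'u :: comm_ring_1 \<Rightarrow> 'u" and J and \<iota> :: "'k :: field_char_0 poly \<Rightarrow> 'u" +
  fixes X :: "'x set" and g :: "'x \<Rightarrow> 'k poly \<Rightarrow> nat \<Rightarrow> 'u" and N :: nat and ev :: "'u \<Rightarrow> 'b :: ab_group_add"
  assumes D_g: "D (g x \<alpha> k) = g x \<alpha> (Suc k)"
    and loc: "x \<in> X \<Longrightarrow> y \<in> X \<Longrightarrow> \<exists>E. \<forall>\<alpha> \<beta>. g x \<alpha> 1 * g y \<beta> 0 \<approx> (\<Sum>i<N. \<iota> (\<alpha> ^ i) * E i (\<alpha> + \<beta>))"
    and ev_add: "ev (u + v) = ev u + ev v"
    and ev_J: "u \<in> J \<Longrightarrow> ev u = 0"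
    and ev_weight: "(\<Sum>(x, \<alpha>, k)\<in>#P. int k - 1) \<noteq> - 1 \<Longrightarrow> ev (\<iota> s * (\<Prod>(x, \<alpha>, k)\<in>#P. g x \<alpha> k)) = 0"
    and test: "(\<And>P m. (\<forall>l\<in>#P. fst l \<in> X) \<Longrightarrow> ev ((\<Prod>(x, \<alpha>, k)\<in>#P. g x \<alpha> k) * (D ^^ m) u) = 0) \<Longrightarrow> u \<in> J"
begin

definition jet_mono :: "('x \<times> 'k poly \<times> nat) multiset \<Rightarrow> 'u" where
  "jet_mono P = (\<Prod>(x, \<alpha>, k)\<in>#P. g x \<alpha> k)"

definition weight :: "('x \<times> 'k poly \<times> nat) multiset \<Rightarrow> int" where
  "weight P = (\<Sum>(x, \<alpha>, k)\<in>#P. int k - 1)"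

definition over_X :: "('x \<times> 'k poly \<times> nat) multiset \<Rightarrow> bool" where
  "over_X P \<longleftrightarrow> (\<forall>l\<in>#P. fst l \<in> X)"

lemma jet_mono_simps [simp]: "jet_mono {#} = 1" "jet_mono (add_mset (x, \<alpha>, k) P) = g x \<alpha> k * jet_mono P" "jet_mono (P + Q) = jet_mono P * jet_mono Q"
  by (simp_all add: jet_mono_def)

lemma weight_simps [simp]: "weight {#} = 0" "weight (add_mset (x, \<alpha>, k) P) = int k - 1 + weight P" "weight (P + Q) = weight P + weight Q"
  by (simp_all add: weight_def)

lemma over_X_simps [simp]: "over_X {#}" "over_X (add_mset (x, \<alpha>, k) P) \<longleftrightarrow> x \<in> X \<and> over_X P" "over_X (P + Q) \<longleftrightarrow> over_X P \<and> over_X Q"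
  by (auto simp: over_X_def)

lemma Dn_g: "(D ^^ m) (g x \<alpha> k) = g x \<alpha> (k + m)"
  by (induction m) (simp_all add: D_g)

lemma loc_10:
  assumes x: "x \<in> X" and y: "y \<in> X"
  shows "poly_mod N (\<lambda>s. (D ^^ m) (g x (\<alpha> + s) 1 * g y (\<beta> - s) 0))"
proof (rule poly_mod_Dn)
  obtain E where E: "\<And>\<alpha> \<beta>. g x \<alpha> 1 * g y \<beta> 0 \<approx> (\<Sum>i<N. \<iota> (\<alpha> ^ i) * E i (\<alpha> + \<beta>))"
    using loc[OF x y] by blast
  have "poly_mod N (\<lambda>s. \<Sum>i<N. \<iota> ((\<alpha> + 1 * s) ^ i) * E i (\<alpha> + \<beta>))"
    by (intro poly_mod_sum poly_mod_mono[OF poly_mod_power]) auto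
  then show "poly_mod N (\<lambda>s. g x (\<alpha> + s) 1 * g y (\<beta> - s) 0)"
  proof (rule poly_mod_cong)
    fix s show "g x (\<alpha> + s) 1 * g y (\<beta> - s) 0 \<approx> (\<Sum>i<N. \<iota> ((\<alpha> + 1 * s) ^ i) * E i (\<alpha> + \<beta>))"
      using E[of "\<alpha> + s" "\<beta> - s"] by simp
  qed
qed

lemma loc_01:
  assumes x: "x \<in> X" and y: "y \<in> X"
  shows "poly_mod N (\<lambda>s. (D ^^ m) (g x (\<alpha> + s) 0 * g y (\<beta> - s) 1))"
  using poly_mod_affine[OF loc_10[OF y x, of m \<beta> \<alpha>], of 0 "- 1"] by (simp add: mult.commute)

text \<open>
  \<open>B\<close> bounds the degree in the momentum \<open>s\<close> shifted between two letters of total order \<open>k\<close>, in all contexts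
  \<open>P\<close> that complete them to weight \<open>-1\<close>.
\<close>
definition bound :: "nat \<Rightarrow> nat \<Rightarrow> bool" where
  "bound k B \<longleftrightarrow> (\<forall>p q x y \<alpha> \<beta> P. p + q = k \<longrightarrow> x \<in> X \<longrightarrow> y \<in> X \<longrightarrow> over_X P \<longrightarrow> weight P = 1 - int k \<longrightarrow>
     poly_mod B (\<lambda>s. g x (\<alpha> + s) p * g y (\<beta> - s) q * jet_mono P))"

lemma boundD:
  "bound k B \<Longrightarrow> p + q = k \<Longrightarrow> x \<in> X \<Longrightarrow> y \<in> X \<Longrightarrow> over_X P \<Longrightarrow> weight P = 1 - int k \<Longrightarrow>
     poly_mod B (\<lambda>s. g x (\<alpha> + s) p * g y (\<beta> - s) q * jet_mono P)"
  unfolding bound_def by blast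

lemma bound_mono: "bound k B \<Longrightarrow> B \<le> B' \<Longrightarrow> bound k B'"
  unfolding bound_def by (intro allI impI, rule poly_mod_mono[of B]) auto

lemma negative_weight_has_plain:
  assumes "weight P < 0"
  obtains z \<gamma> P' where "P = add_mset (z, \<gamma>, 0) P'"
proof -
  have "\<exists>l\<in>#P. snd (snd l) = 0"
  proof (rule ccontr)
    assume "\<not> ?thesis"
    then have "\<forall>l\<in>#P. snd (snd l) \<noteq> 0" by auto
    then have "0 \<le> weight P" by (induction P) auto
    then show False using assms by simp
  qed
  then show ?thesis using that by (metis multi_member_split prod.collapse)
qed

lemma positive_weight_has_higher:
  assumes "weight P > 0"
  obtains z \<gamma> k P' where "P = add_mset (z, \<gamma>, Suc (Suc k)) P'"
proof -
  have "\<exists>l\<in>#P. 2 \<le> snd (snd l)"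
  proof (rule ccontr)
    assume "\<not> ?thesis"
    then have "\<forall>l\<in>#P. snd (snd l) < 2" by auto
    then have "weight P \<le> 0" by (induction P) auto
    then show False using assms by simp
  qed
  then obtain z \<gamma> k where "(z, \<gamma>, k) \<in># P" "2 \<le> k" by auto
  then show ?thesis using that by (metis multi_member_split add_2_eq_Suc le_Suc_ex)
qed

text \<open>
  The context contains a letter \<open>D\<^sup>k\<^sup>+\<^sup>2 z\<close>. In the Leibniz expansion of \<open>D\<^sup>k\<^sup>+\<^sup>1 (D z \<cdot> x y)\<close> the product with this
  letter appears together with terms in which \<open>x y\<close> is differentiated; the latter contain \<open>D x \<cdot> y\<close> or
  \<open>x \<cdot> D y\<close> and have degree below \<open>N\<close>. The left-hand side has degree below \<open>N\<close> for a shift between \<open>z\<close> and \<open>x\<close>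
  and for a shift between \<open>z\<close> and \<open>y\<close>.
\<close>
lemma bound_0: "bound 0 (N + N)"
  unfolding bound_def
proof (intro allI impI)
  fix p q :: nat and x y \<alpha> \<beta> P
  assume pq: "p + q = 0" and x: "x \<in> X" and y: "y \<in> X" and P: "over_X P" "weight P = 1 - int 0"
  obtain z \<gamma> k P' where P': "P = add_mset (z, \<gamma>, Suc (Suc k)) P'"
    by (rule positive_weight_has_higher[of P]) (use P in auto)
  have z: "z \<in> X" using P P' by simp
  let ?xy = "\<lambda>s. g x (\<alpha> + s) 0 * g y (\<beta> - s) 0"
  define h where "h s = (D ^^ Suc k) (g z \<gamma> 1 * ?xy s)" for s
  have D_xy: "poly_mod N (\<lambda>s. (D ^^ Suc m) (?xy s))" for m
  proof -
    have "(D ^^ Suc m) (?xy s) = (D ^^ m) (g x (\<alpha> + s) 1 * g y (\<beta> - s) 0)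
        + (D ^^ m) (g x (\<alpha> + s) 0 * g y (\<beta> - s) 1)" for s
      unfolding funpow_Suc_right comp_apply by (simp add: D_mult D_g Dn_add)
    then show ?thesis using poly_mod_add[OF loc_10[OF x y] loc_01[OF x y]] by simp
  qed
  have h: "poly_mod (N + N) h"
  proof -
    \<comment> \<open>The momentum of \<open>z\<close> is free to absorb independent shifts \<open>s\<close> and \<open>t\<close>; they cancel for \<open>t = - s\<close>.\<close>
    have "poly_mod (N + N) (\<lambda>s. (\<lambda>s t. (D ^^ Suc k) (g z (\<gamma> - s - t) 1 * (g x (\<alpha> + s) 0 * g y (\<beta> + t) 0))) s (- s))"
    proof (rule poly_mod_two)
      fix t
      have "poly_mod N (\<lambda>s. (D ^^ Suc k) (g y (\<beta> + t) 0 * (D ^^ 0) (g x (\<alpha> + s) 0 * g z ((\<gamma> - t) - s) 1)))"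
        by (intro poly_mod_Dn poly_mod_mult loc_01 x z)
      then show "poly_mod N (\<lambda>s. (D ^^ Suc k) (g z (\<gamma> - s - t) 1 * (g x (\<alpha> + s) 0 * g y (\<beta> + t) 0)))"
        by (simp add: algebra_simps)
    next
      fix s
      have "poly_mod N (\<lambda>t. (D ^^ Suc k) (g x (\<alpha> + s) 0 * (D ^^ 0) (g y (\<beta> + t) 0 * g z ((\<gamma> - s) - t) 1)))"
        by (intro poly_mod_Dn poly_mod_mult loc_01 y z)
      then show "poly_mod N (\<lambda>t. (D ^^ Suc k) (g z (\<gamma> - s - t) 1 * (g x (\<alpha> + s) 0 * g y (\<beta> + t) 0)))"
        by (simp add: algebra_simps)
    qed
    then show ?thesis by (simp add: h_def [abs_def])
  qed
  have "h s = (\<Sum>i\<le>k. of_nat (Suc k choose i) * (g z \<gamma> (Suc i) * (D ^^ Suc (k - i)) (?xy s)))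
      + g z \<gamma> (Suc (Suc k)) * ?xy s" for s
  proof -
    have "h s = (\<Sum>i\<le>Suc k. of_nat (Suc k choose i) * (g z \<gamma> (Suc i) * (D ^^ (Suc k - i)) (?xy s)))"
      unfolding h_def Leibniz by (simp add: Dn_g)
    also have "\<dots> = (\<Sum>i\<le>k. of_nat (Suc k choose i) * (g z \<gamma> (Suc i) * (D ^^ (Suc k - i)) (?xy s)))
      + g z \<gamma> (Suc (Suc k)) * ?xy s"
      by simp
    finally show ?thesis by (simp add: Suc_diff_le)
  qed
  then have "?xy s * jet_mono P = (h s - (\<Sum>i\<le>k. of_nat (Suc k choose i) * (g z \<gamma> (Suc i) * (D ^^ Suc (k - i)) (?xy s)))) * jet_mono P'" for s
    by (simp add: P' algebra_simps)
  moreover have "poly_mod (N + N) (\<lambda>s. (h s - (\<Sum>i\<le>k. of_nat (Suc k choose i) * (g z \<gamma> (Suc i) * (D ^^ Suc (k - i)) (?xy s)))) * jet_mono P')"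
    by (intro poly_mod_mult_right poly_mod_diff poly_mod_sum poly_mod_mult h poly_mod_mono[OF D_xy]) simp
  ultimately show "poly_mod (N + N) (\<lambda>s. g x (\<alpha> + s) p * g y (\<beta> - s) q * jet_mono P)"
    using pq by simp
qed

text \<open>
  If both letters are differentiated, the context has negative weight and so contains an undifferentiated
  letter \<open>z\<close>. A shift between \<open>x\<close> and \<open>y\<close> is composed of shifts between \<open>x\<close>, \<open>z\<close> and between \<open>y\<close>, \<open>z\<close>, for which
  the other letter belongs to the context and the total order is smaller. If only one is differentiated, all
  other terms of \<open>D\<^sup>k\<^sup>-\<^sup>1 (D x \<cdot> y)\<close> are of the first kind.
\<close>
lemma bound_ex: "\<exists>B. bound k B"
proof (induction k rule: less_induct)
  case (less k)
  show ?case
  proof (cases k)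
    case 0
    then show ?thesis using bound_0 by blast
  next
    case (Suc n)
    obtain b where b: "\<And>j. j < k \<Longrightarrow> bound j (b j)" using less by metis
    define C where "C = (\<Sum>j<k. b j)"
    have C: "bound j C" if "j < k" for j
      using that by (intro bound_mono[OF b]) (auto simp: C_def intro: member_le_sum)
    have mixed: "poly_mod (C + C) (\<lambda>s. g x (\<alpha> + s) p * g y (\<beta> - s) q * jet_mono P)"
      if pq: "p + q = k" "0 < p" "0 < q" and x: "x \<in> X" and y: "y \<in> X" and P: "over_X P" "weight P = 1 - int k"
      for p q x y \<alpha> \<beta> P
    proof -
      obtain z \<gamma> P' where P': "P = add_mset (z, \<gamma>, 0) P'"
        by (rule negative_weight_has_plain[of P]) (use P pq in auto)
      have z: "z \<in> X" using P P' by simp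
      have "poly_mod (C + C) (\<lambda>s. (\<lambda>s t. g x (\<alpha> + s) p * g y (\<beta> + t) q * g z (\<gamma> - s - t) 0 * jet_mono P') s (- s))"
      proof (rule poly_mod_two)
        fix t
        have "poly_mod C (\<lambda>s. g x (\<alpha> + s) p * g z ((\<gamma> - t) - s) 0 * jet_mono (add_mset (y, \<beta> + t, q) P'))"
          by (rule boundD[OF C[of p]]) (use P P' pq x y z in auto)
        then show "poly_mod C (\<lambda>s. g x (\<alpha> + s) p * g y (\<beta> + t) q * g z (\<gamma> - s - t) 0 * jet_mono P')"
          by (simp add: algebra_simps)
      next
        fix s
        have "poly_mod C (\<lambda>t. g y (\<beta> + t) q * g z ((\<gamma> - s) - t) 0 * jet_mono (add_mset (x, \<alpha> + s, p) P'))"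
          by (rule boundD[OF C[of q]]) (use P P' pq x y z in auto)
        then show "poly_mod C (\<lambda>t. g x (\<alpha> + s) p * g y (\<beta> + t) q * g z (\<gamma> - s - t) 0 * jet_mono P')"
          by (simp add: algebra_simps)
      qed
      then show ?thesis by (simp add: P' algebra_simps)
    qed
    let ?B = "N + (C + C)"
    have pure: "poly_mod ?B (\<lambda>s. g x (\<alpha> + s) k * g y (\<beta> - s) 0 * jet_mono P)"
      if x: "x \<in> X" and y: "y \<in> X" and P: "over_X P" "weight P = 1 - int k" for x y \<alpha> \<beta> P
    proof -
      have "(D ^^ n) (g x (\<alpha> + s) 1 * g y (\<beta> - s) 0)
        = (\<Sum>i\<le>n. of_nat (n choose i) * (g x (\<alpha> + s) (Suc i) * g y (\<beta> - s) (n - i)))" for s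
        by (simp add: Leibniz Dn_g)
      also have "\<dots> s = (\<Sum>i<n. of_nat (n choose i) * (g x (\<alpha> + s) (Suc i) * g y (\<beta> - s) (n - i)))
          + g x (\<alpha> + s) k * g y (\<beta> - s) 0" for s
        by (simp add: Suc flip: lessThan_Suc_atMost)
      finally have fin: "(D ^^ n) (g x (\<alpha> + s) 1 * g y (\<beta> - s) 0)
        = (\<Sum>i<n. of_nat (n choose i) * (g x (\<alpha> + s) (Suc i) * g y (\<beta> - s) (n - i)))
          + g x (\<alpha> + s) k * g y (\<beta> - s) 0" for s .
      have "g x (\<alpha> + s) k * g y (\<beta> - s) 0 * jet_mono P =
         (D ^^ n) (g x (\<alpha> + s) 1 * g y (\<beta> - s) 0) * jet_mono P
         - (\<Sum>i<n. of_nat (n choose i) * (g x (\<alpha> + s) (Suc i) * g y (\<beta> - s) (n - i) * jet_mono P))" for s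
        unfolding fin by (simp add: algebra_simps sum_distrib_left)
      moreover have "poly_mod ?B (\<lambda>s. (D ^^ n) (g x (\<alpha> + s) 1 * g y (\<beta> - s) 0) * jet_mono P
         - (\<Sum>i<n. of_nat (n choose i) * (g x (\<alpha> + s) (Suc i) * g y (\<beta> - s) (n - i) * jet_mono P)))"
      proof (intro poly_mod_diff poly_mod_sum poly_mod_mult)
        show "poly_mod ?B (\<lambda>s. (D ^^ n) (g x (\<alpha> + s) 1 * g y (\<beta> - s) 0) * jet_mono P)"
          by (intro poly_mod_mono[OF poly_mod_mult_right[OF loc_10[OF x y]]]) simp
      next
        fix i assume i: "i \<in> {..<n}"
        have "poly_mod (C + C) (\<lambda>s. g x (\<alpha> + s) (Suc i) * g y (\<beta> - s) (n - i) * jet_mono P)"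
          using i by (intro mixed x y P) (auto simp: Suc)
        then show "poly_mod ?B (\<lambda>s. g x (\<alpha> + s) (Suc i) * g y (\<beta> - s) (n - i) * jet_mono P)"
          by (rule poly_mod_mono) simp
      qed
      ultimately show ?thesis by simp
    qed
    have "bound k ?B"
      unfolding bound_def
    proof (intro allI impI)
      fix p q :: nat and x y \<alpha> \<beta> P
      assume a: "p + q = k" "x \<in> X" "y \<in> X" "over_X P" "weight P = 1 - int k"
      consider "0 < p" "0 < q" | "p = k" "q = 0" | "p = 0" "q = k"
        using a(1) by (cases "p = 0"; cases "q = 0") auto
      then show "poly_mod ?B (\<lambda>s. g x (\<alpha> + s) p * g y (\<beta> - s) q * jet_mono P)"
      proof cases
        case 1
        show ?thesis by (rule poly_mod_mono[OF mixed[OF a(1) 1 a(2-)]]) simp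
      next
        case 2
        then show ?thesis using pure[OF a(2-)] by simp
      next
        case 3
        have "poly_mod ?B (\<lambda>s. g y (\<beta> + (0 + (- 1) * s)) k * g x (\<alpha> - (0 + (- 1) * s)) 0 * jet_mono P)"
          by (rule poly_mod_affine[OF pure[OF a(3,2,4,5)]])
        then show ?thesis using 3 by (simp add: algebra_simps)
      qed
    qed
    then show ?thesis by blast
  qed
qed

text \<open>
  Sums of monomials of a fixed weight, the form in which derivatives of monomials arise.
\<close>
inductive_set contexts :: "int \<Rightarrow> 'u set" for w where
  ctx_zero: "0 \<in> contexts w"
| ctx_mo: "over_X P \<Longrightarrow> weight P = w \<Longrightarrow> jet_mono P \<in> contexts w"
| ctx_add: "u \<in> contexts w \<Longrightarrow> v \<in> contexts w \<Longrightarrow> u + v \<in> contexts w"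

lemma ctx_mult_mo: "u \<in> contexts w \<Longrightarrow> over_X P \<Longrightarrow> jet_mono P * u \<in> contexts (weight P + w)"
proof (induction rule: contexts.induct)
  case (ctx_mo Q)
  then show ?case using contexts.ctx_mo[of "P + Q" "weight P + w"] by simp
qed (simp_all add: distrib_left contexts.intros)

lemma ctx_D: "u \<in> contexts w \<Longrightarrow> D u \<in> contexts (w + 1)"
proof (induction rule: contexts.induct)
  case (ctx_mo P)
  have "D (jet_mono P) \<in> contexts (weight P + 1)" using ctx_mo(1)
  proof (induction P)
    case (add l P)
    obtain x \<alpha> k where l: "l = (x, \<alpha>, k)" by (metis prod.collapse)
    have "jet_mono (add_mset (x, \<alpha>, Suc k) P) \<in> contexts (weight (add_mset l P) + 1)"
      using add by (intro contexts.ctx_mo) (simp_all add: l)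
    moreover have "jet_mono {#(x, \<alpha>, k)#} * D (jet_mono P) \<in> contexts (weight {#(x, \<alpha>, k)#} + (weight P + 1))"
      using add by (intro ctx_mult_mo) (simp_all add: l)
    ultimately show ?case by (auto simp: l D_mult D_g algebra_simps intro!: contexts.ctx_add)
  qed (simp add: contexts.ctx_zero)
  then show ?case using ctx_mo by simp
qed (simp_all add: D_add contexts.intros)

lemma ctx_Dn: "u \<in> contexts w \<Longrightarrow> (D ^^ n) u \<in> contexts (w + int n)"
proof (induction n)
  case (Suc n)
  then show ?case using ctx_D[of "(D ^^ n) u" "w + int n"] by (simp add: algebra_simps)
qed simp

lemma ctx_ev: "u \<in> contexts w \<Longrightarrow> w \<noteq> - 1 \<Longrightarrow> ev (\<iota> s * u) = 0"
proof (induction rule: contexts.induct)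
  case ctx_zero
  then show ?case using ev_J[OF J_zero] by simp
next
  case (ctx_mo P)
  then show ?case using ev_weight[of P s] by (simp add: jet_mono_def weight_def)
qed (simp_all add: distrib_left ev_add)

lemma split_plain:
  assumes "weight P \<le> - int r"
  shows "\<exists>Z P'. P = Z + P' \<and> weight Z = - int r"
  using assms
proof (induction r arbitrary: P)
  case (Suc r)
  obtain z \<gamma> P1 where P1: "P = add_mset (z, \<gamma>, 0) P1"
    by (rule negative_weight_has_plain[of P]) (use Suc.prems in auto)
  then obtain Z P' where "P1 = Z + P'" "weight Z = - int r"
    using Suc.IH[of P1] Suc.prems by auto
  then show ?case using P1 by (intro exI[of _ "add_mset (z, \<gamma>, 0) Z"] exI[of _ P']) simp
qed (auto intro: exI[of _ "{#}"])

text \<open>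
  The bound does not depend on \<open>m\<close>, which is needed since the ideal tests all derivatives of an element. For
  \<open>k > 0\<close> the context contains a product \<open>Z\<close> of \<open>k - 1\<close> undifferentiated letters. The weight of the two
  letters times \<open>Z\<close> is \<open>-1\<close>, so \<open>bound\<close> applies before \<open>D\<^sup>m\<close>; the other terms of the Leibniz
  expansion involve fewer derivatives of the two letters.
\<close>
lemma jet_bound:
  assumes B: "bound k B" and BN: "N + N \<le> B" and pq: "p + q = k" and x: "x \<in> X" and y: "y \<in> X"
    and P: "over_X P" "weight P = 1 - int k - int m"
  shows "poly_mod B (\<lambda>s. (D ^^ m) (g x (\<alpha> + s) p * g y (\<beta> - s) q) * jet_mono P)"
proof (cases k)
  case 0
  then have p0: "p = 0" "q = 0" using pq by auto
  show ?thesis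
  proof (cases m)
    case m0: 0
    then show ?thesis using boundD[OF B pq x y P(1)] P(2) by simp
  next
    case (Suc n)
    have "(D ^^ m) (g x (\<alpha> + s) 0 * g y (\<beta> - s) 0) = (D ^^ n) (g x (\<alpha> + s) 1 * g y (\<beta> - s) 0)
        + (D ^^ n) (g x (\<alpha> + s) 0 * g y (\<beta> - s) 1)" for s
      unfolding Suc funpow_Suc_right comp_apply by (simp add: D_mult D_g Dn_add)
    moreover have "poly_mod N (\<lambda>s. ((D ^^ n) (g x (\<alpha> + s) 1 * g y (\<beta> - s) 0)
        + (D ^^ n) (g x (\<alpha> + s) 0 * g y (\<beta> - s) 1)) * jet_mono P)"
      by (intro poly_mod_mult_right poly_mod_add loc_10 loc_01 x y)
    ultimately show ?thesis using BN p0 by (auto intro: poly_mod_mono)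
  qed
next
  case (Suc r)
  define h where "h s = g x (\<alpha> + s) p * g y (\<beta> - s) q" for s
  have "poly_mod B (\<lambda>s. (D ^^ m) (h s) * jet_mono P)" using P
  proof (induction m arbitrary: P rule: less_induct)
    case (less m)
    obtain Z P' where Z: "P = Z + P'" "weight Z = - int r"
      using split_plain[of P r] less.prems Suc by auto
    \<comment> \<open>The product \<open>h s * jet_mono Z\<close> has weight \<open>-1\<close> by itself, and \<open>Z\<close> is its context.\<close>
    have 1: "poly_mod B (\<lambda>s. (D ^^ m) (h s * jet_mono Z) * jet_mono P')"
      unfolding h_def using less.prems Z Suc
      by (intro poly_mod_mult_right poly_mod_Dn boundD[OF B pq x y]) auto
    have 2: "poly_mod B (\<lambda>s. (D ^^ i) (h s) * u)" if i: "i < m" and u: "u \<in> contexts (1 - int k - int i)" for i u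
      using u
    proof (induction rule: contexts.induct)
      case (ctx_mo Q)
      then show ?case using less.IH[OF i] by simp
    qed (simp_all add: poly_mod_zero distrib_left poly_mod_add)
    have "(D ^^ m) (h s * jet_mono Z) * jet_mono P'
       = (\<Sum>i<m. of_nat (m choose i) * ((D ^^ i) (h s) * (jet_mono P' * (D ^^ (m - i)) (jet_mono Z)))) + (D ^^ m) (h s) * jet_mono P" for s
      by (simp add: Leibniz Z algebra_simps sum_distrib_left flip: lessThan_Suc_atMost)
    then have "(D ^^ m) (h s) * jet_mono P = (D ^^ m) (h s * jet_mono Z) * jet_mono P'
       - (\<Sum>i<m. of_nat (m choose i) * ((D ^^ i) (h s) * (jet_mono P' * (D ^^ (m - i)) (jet_mono Z))))" for s
      by simp
    moreover have "jet_mono P' * (D ^^ (m - i)) (jet_mono Z) \<in> contexts (1 - int k - int i)" if "i < m" for i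
    proof -
      have "jet_mono P' * (D ^^ (m - i)) (jet_mono Z) \<in> contexts (weight P' + (weight Z + int (m - i)))"
        using less.prems Z by (intro ctx_mult_mo ctx_Dn ctx_mo) auto
      also have "weight P' + (weight Z + int (m - i)) = 1 - int k - int i"
        using less.prems Z that by auto
      finally show ?thesis .
    qed
    ultimately show ?case using 1 2
      by (auto intro!: poly_mod_diff poly_mod_sum poly_mod_mult)
  qed
  then show ?thesis by (simp add: h_def)
qed

text \<open>
  The difference to the interpolating polynomial lies in \<open>J\<close>: test monomials of complementary weight are
  covered by \<open>jet_bound\<close>, and all others give \<open>0\<close> for reasons of weight.
\<close>
theorem letters_local: "\<exists>B. \<forall>x\<in>X. \<forall>y\<in>X. \<exists>E. \<forall>\<mu> \<sigma>. g x \<mu> p * g y (\<sigma> - \<mu>) q \<approx> (\<Sum>i<B. \<iota> (\<mu> ^ i) * E i \<sigma>)"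
proof -
  obtain B0 where B0: "bound (p + q) B0" using bound_ex by blast
  define B where "B = B0 + (N + N)"
  have B: "bound (p + q) B" by (rule bound_mono[OF B0]) (simp add: B_def)
  have "g x \<mu> p * g y (\<sigma> - \<mu>) q \<approx> (\<Sum>i<B. \<iota> (\<mu> ^ i) * lagrange B (\<lambda>s. g x s p * g y (\<sigma> - s) q) i)"
    (is "?h \<mu> \<approx> ?r")
    if x: "x \<in> X" and y: "y \<in> X" for x y \<mu> \<sigma>
  proof -
    have "?h \<mu> - ?r \<in> J"
    proof (rule test)
      fix P :: "('x \<times> 'k poly \<times> nat) multiset" and m
      assume "\<forall>l\<in>#P. fst l \<in> X"
      then have P: "over_X P" by (simp add: over_X_def)
      let ?H = "\<lambda>s. (D ^^ m) (?h s) * jet_mono P"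
      have r: "(D ^^ m) (?h \<mu> - ?r) * jet_mono P = ?H \<mu> - (\<Sum>i<B. \<iota> (\<mu> ^ i) * lagrange B ?H i)"
        by (simp add: Dn_diff Dn_sum Dn_\<iota>_mult lagrange_def left_diff_distrib sum_distrib_right mult.assoc)
      have "ev ((D ^^ m) (?h \<mu> - ?r) * jet_mono P) = 0"
      proof (cases "weight P = 1 - int (p + q) - int m")
        case True
        have "poly_mod B (\<lambda>s. (D ^^ m) (g x (0 + s) p * g y (\<sigma> - s) q) * jet_mono P)"
          by (rule jet_bound[OF B _ refl x y P True]) (simp add: B_def)
        then have "poly_mod B ?H" by simp
        from poly_mod_lagrange[OF this, of \<mu>] show ?thesis
          unfolding r cg_def by (rule ev_J)
      next
        case False
        have "jet_mono P * (D ^^ m) (jet_mono {#(x, s, p), (y, \<sigma> - s, q)#}) \<in> contexts (weight P + (weight {#(x, s, p), (y, \<sigma> - s, q)#} + int m))" for s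
          using x y P by (intro ctx_mult_mo ctx_Dn ctx_mo) auto
        then have H: "?H s \<in> contexts (weight P + (int p + int q - 2 + int m))" for s
          by (simp add: mult.commute algebra_simps)
        have z: "ev (\<iota> t * ?H s) = 0" for s t
          by (rule ctx_ev[OF H]) (use False in auto)
        have ev0: "ev 0 = 0" by (rule ev_J[OF J_zero])
        have evs: "ev (sum f I) = (\<Sum>i\<in>I. ev (f i))" for f and I :: "nat set"
          by (induction I rule: infinite_finite_induct) (simp_all add: ev_add ev0)
        have "ev (\<iota> t * lagrange B ?H i) = 0" for t i
          unfolding lagrange_def sum_distrib_left evs
          using z by (simp add: \<iota>_mult[symmetric] mult.assoc[symmetric])
        then have s: "ev (\<Sum>i<B. \<iota> (\<mu> ^ i) * lagrange B ?H i) = 0" by (simp add: evs)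
        have "ev (?H \<mu>) = ev (?H \<mu> - (\<Sum>i<B. \<iota> (\<mu> ^ i) * lagrange B ?H i)) + ev (\<Sum>i<B. \<iota> (\<mu> ^ i) * lagrange B ?H i)"
          by (simp flip: ev_add)
        then show ?thesis using s z[of 1 \<mu>] by (simp add: r \<iota>_1)
      qed
      then show "ev ((\<Prod>(x, \<alpha>, k)\<in>#P. g x \<alpha> k) * (D ^^ m) (?h \<mu> - ?r)) = 0"
        by (simp only: jet_mono_def mult.commute)
    qed
    then show ?thesis by (simp add: cg_def)
  qed
  then show ?thesis
    by (intro exI[of _ B] ballI)
      (rule_tac x = "\<lambda>i \<sigma>. lagrange B (\<lambda>s. g x s p * g y (\<sigma> - s) q) i" in exI, simp)
qed

end

section \<open>Evaluating lambda products at momenta\<close>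

definition psum :: "(nat \<Rightarrow> 'v :: zero \<Rightarrow> 'b :: ab_group_add) \<Rightarrow> 'v poly \<Rightarrow> 'b" where
  "psum F p = (\<Sum>i\<le>degree p. F i (coeff p i))"

lemma psum_atMost:
  assumes "degree p \<le> n" "\<And>i. F i 0 = 0"
  shows "psum F p = (\<Sum>i\<le>n. F i (coeff p i))"
  unfolding psum_def by (rule sum.mono_neutral_left) (use assms in \<open>auto simp: coeff_eq_0\<close>)

lemma psum_lessThan:
  assumes "degree p < n" "\<And>i. F i 0 = 0"
  shows "psum F p = (\<Sum>i<n. F i (coeff p i))"
  unfolding psum_def by (rule sum.mono_neutral_left) (use assms in \<open>auto simp: coeff_eq_0\<close>)

lemma psum_zero [simp]: "(\<And>i. F i 0 = 0) \<Longrightarrow> psum F 0 = 0"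
  by (simp add: psum_def)

lemma psum_cong: "(\<And>i. F i (coeff p i) = G i (coeff p i)) \<Longrightarrow> psum F p = psum G p"
  by (simp add: psum_def)

lemma psum_plus: "psum (\<lambda>i v. F i v + G i v) p = psum F p + psum G p"
  by (simp add: psum_def sum.distrib)

lemma psum_minus: "psum (\<lambda>i v. - F i v) p = - psum F p"
  by (simp add: psum_def sum_negf)

lemma psum_pCons:
  assumes "\<And>i. F i 0 = 0"
  shows "psum F (pCons a p) = F 0 a + psum (\<lambda>i. F (Suc i)) p"
proof -
  have "psum F (pCons a p) = (\<Sum>i\<le>Suc (degree p). F i (coeff (pCons a p) i))"
    by (rule psum_atMost) (simp_all add: assms degree_pCons_le)
  then show ?thesis by (simp only: sum.atMost_Suc_shift coeff_pCons_0 coeff_pCons_Suc psum_def)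
qed

lemma psum_map_poly:
  assumes "f 0 = 0" "\<And>i. F i 0 = 0"
  shows "psum F (map_poly f p) = psum (\<lambda>i v. F i (f v)) p"
proof -
  have "degree (map_poly f p) \<le> degree p"
    by (intro degree_le) (simp add: coeff_map_poly assms coeff_eq_0)
  then show ?thesis using assms by (subst psum_atMost[of _ "degree p"]) (auto simp: coeff_map_poly psum_def)
qed

lemma psum_add:
  assumes "p \<in> polys_over A" "q \<in> polys_over A" "\<And>i. F i 0 = 0"
    and "\<And>i u v. u \<in> A \<Longrightarrow> v \<in> A \<Longrightarrow> F i (u + v) = F i u + F i v"
  shows "psum F (p + q) = psum F p + psum F q"
proof -
  let ?n = "max (degree p) (degree q)"
  have "psum F (p + q) = (\<Sum>i\<le>?n. F i (coeff (p + q) i))"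
    by (rule psum_atMost) (simp_all add: assms degree_add_le)
  moreover have "psum F p = (\<Sum>i\<le>?n. F i (coeff p i))"
    "psum F q = (\<Sum>i\<le>?n. F i (coeff q i))"
    using assms(3) by (auto intro!: psum_atMost)
  ultimately show ?thesis using assms by (simp add: sum.distrib polys_over_def)
qed

context conformal_algebra
begin

lemma zero_in: "0 \<in> cspace C" and add_in: "x \<in> cspace C \<Longrightarrow> y \<in> cspace C \<Longrightarrow> x + y \<in> cspace C"
  and scale_in: "x \<in> cspace C \<Longrightarrow> cscale C c x \<in> cspace C"
  using subspace_cspace by (auto simp: subspace_def)

lemma diff_in: "x \<in> cspace C \<Longrightarrow> y \<in> cspace C \<Longrightarrow> x - y \<in> cspace C"
  using subspace_cspace by (rule subspace_diff)

lemma neg_in: "x \<in> cspace C \<Longrightarrow> - x \<in> cspace C"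
  using subspace_cspace by (rule subspace_neg)

lemma del_in: "x \<in> cspace C \<Longrightarrow> cdel C x \<in> cspace C"
  and del_add: "x \<in> cspace C \<Longrightarrow> y \<in> cspace C \<Longrightarrow> cdel C (x + y) = cdel C x + cdel C y"
  and del_scale: "x \<in> cspace C \<Longrightarrow> cdel C (cscale C c x) = cscale C c (cdel C x)"
  using linear_cdel by (auto simp: linear_between_def)

lemma del_0 [simp]: "cdel C 0 = 0"
  using linear_between_zero[OF linear_cdel zero_in] .

abbreviation A1 where "A1 \<equiv> polys_over (cspace C)"
abbreviation A2 where "A2 \<equiv> polys_over A1"

lemma A1_closed: "0 \<in> A1" "p \<in> A1 \<Longrightarrow> q \<in> A1 \<Longrightarrow> p + q \<in> A1" "p \<in> A1 \<Longrightarrow> - p \<in> A1"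
  "p \<in> A1 \<Longrightarrow> q \<in> A1 \<Longrightarrow> p - q \<in> A1" "p \<in> A1 \<Longrightarrow> pCons 0 p \<in> A1"
  "p \<in> A1 \<Longrightarrow> map_poly (cdel C) p \<in> A1" "x \<in> cspace C \<Longrightarrow> [:x:] \<in> A1"
  by (auto simp: polys_over_def zero_in add_in diff_in neg_in coeff_pCons coeff_map_poly del_in
      split: nat.splits)

lemma A2_closed: "0 \<in> A2" "p \<in> A2 \<Longrightarrow> q \<in> A2 \<Longrightarrow> p + q \<in> A2" "p \<in> A2 \<Longrightarrow> - p \<in> A2"
  "p \<in> A2 \<Longrightarrow> q \<in> A2 \<Longrightarrow> p - q \<in> A2" "p \<in> A2 \<Longrightarrow> op_mu p \<in> A2" "p \<in> A2 \<Longrightarrow> op_lam p \<in> A2"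
  "p \<in> A2 \<Longrightarrow> op_lam_mu p \<in> A2" "p \<in> A2 \<Longrightarrow> op_neg_mu C p \<in> A2" "x \<in> cspace C \<Longrightarrow> const2 x \<in> A2"
  using A1_closed
  by (auto simp: polys_over_def[of A1] op_mu_def op_lam_def op_lam_mu_def op_neg_mu_def const2_def
      coeff_pCons coeff_map_poly split: nat.splits)

lemma A1_coeff: "p \<in> A1 \<Longrightarrow> coeff p i \<in> cspace C"
  by (simp add: polys_over_def)

lemma A2_coeff: "p \<in> A2 \<Longrightarrow> coeff p i \<in> A1"
  by (simp add: polys_over_def)

lemma clprod_A1: "a \<in> cspace C \<Longrightarrow> b \<in> cspace C \<Longrightarrow> clprod C a b \<in> A1"
  by (simp add: polys_over_def clprod_closed)

lemma clprod_zero_left [simp]: "b \<in> cspace C \<Longrightarrow> clprod C 0 b = 0"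
  using clprod_add_left[OF zero_in zero_in, of b] by simp

lemma clprod_zero_right [simp]: "a \<in> cspace C \<Longrightarrow> clprod C a 0 = 0"
  using clprod_add_right[OF _ zero_in zero_in, of a] by simp

lemma subst_op_in:
  assumes W: "0 \<in> W" "\<And>u v. u \<in> W \<Longrightarrow> v \<in> W \<Longrightarrow> u + v \<in> W" "\<And>u. u \<in> W \<Longrightarrow> T u \<in> W"
    and p: "\<And>i. \<iota> (coeff p i) \<in> W"
  shows "subst_op T \<iota> p \<in> W"
proof -
  have "(T ^^ i) u \<in> W" if "u \<in> W" for u i by (induction i) (use that W in auto)
  then have "(T ^^ i) (\<iota> (coeff p i)) \<in> W" for i using p by blast
  then have "(\<Sum>i\<in>I. (T ^^ i) (\<iota> (coeff p i))) \<in> W" for I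
    by (induction I rule: infinite_finite_induct) (use W in auto)
  then show ?thesis by (simp add: subst_op_def)
qed

lemma subst_neg_A1: "p \<in> A1 \<Longrightarrow> subst_neg C p \<in> A1"
  unfolding subst_neg_def by (rule subst_op_in) (auto intro: A1_closed A1_coeff)

end

text \<open>
  \<open>F s v\<close> stands for \<open>s\<close> times the class of \<open>v\<close> at total momentum \<open>\<sigma>\<close>, where \<open>\<partial>\<close> acts as \<open>- \<sigma>\<close>. Under such an
  evaluation, extended to polynomials in one variable (\<open>eval1\<close>) and in two variables (\<open>eval2\<close>) with values
  \<open>l\<close> and \<open>m\<close> for them, the operators \<open>- \<partial> - \<lambda>\<close> that occur in the conformal identities
  become scalars. Keeping the scalar \<open>s\<close> as a parameter avoids a module structure on the target.
\<close>
locale momentum = conformal_algebra C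
  for C :: "('k :: field_char_0, 'v :: ab_group_add) conformal" +
  fixes F :: "'s :: comm_ring_1 \<Rightarrow> 'v \<Rightarrow> 'b :: ab_group_add" and \<sigma> :: 's
  assumes F_add: "u \<in> cspace C \<Longrightarrow> v \<in> cspace C \<Longrightarrow> F s (u + v) = F s u + F s v"
    and F_add_left: "u \<in> cspace C \<Longrightarrow> F (s + t) u = F s u + F t u"
    and F_del: "u \<in> cspace C \<Longrightarrow> F s (cdel C u) = - F (s * \<sigma>) u"
begin

lemma F_zero [simp]: "F s 0 = 0"
  using F_add[OF zero_in zero_in, of s] by simp

definition eval1 :: "'s \<Rightarrow> 's \<Rightarrow> 'v poly \<Rightarrow> 'b" where
  "eval1 m s p = psum (\<lambda>i. F (s * m ^ i)) p"

lemma eval1_add: "p \<in> A1 \<Longrightarrow> q \<in> A1 \<Longrightarrow> eval1 m s (p + q) = eval1 m s p + eval1 m s q"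
  unfolding eval1_def by (rule psum_add[where A = "cspace C"]) (simp_all add: F_add)

lemma eval1_zero [simp]: "eval1 m s 0 = 0"
  by (simp add: eval1_def)

lemma eval1_uminus: "p \<in> A1 \<Longrightarrow> eval1 m s (- p) = - eval1 m s p"
  using eval1_add[OF _ A1_closed(3), of p p m s] by (simp add: eq_neg_iff_add_eq_0 add.commute)

lemma eval1_diff: "p \<in> A1 \<Longrightarrow> q \<in> A1 \<Longrightarrow> eval1 m s (p - q) = eval1 m s p - eval1 m s q"
  using eval1_add[OF _ A1_closed(3), of p q m s] by (simp add: eval1_uminus)

lemma eval1_add_left: "p \<in> A1 \<Longrightarrow> eval1 m (s + t) p = eval1 m s p + eval1 m t p"
  unfolding eval1_def psum_plus[symmetric] by (rule psum_cong) (simp add: F_add_left A1_coeff distrib_right)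

lemma eval1_zero_left [simp]: "p \<in> A1 \<Longrightarrow> eval1 m 0 p = 0"
  using eval1_add_left[of p m 0 0] by simp

lemma eval1_uminus_left: "p \<in> A1 \<Longrightarrow> eval1 m (- s) p = - eval1 m s p"
  using eval1_add_left[of p m s "- s"] by (simp add: eq_neg_iff_add_eq_0 add.commute)

lemma eval1_diff_left: "p \<in> A1 \<Longrightarrow> eval1 m (s - t) p = eval1 m s p - eval1 m t p"
  using eval1_add_left[of p m s "- t"] by (simp add: eval1_uminus_left)

lemma eval1_pCons: "eval1 m s (pCons 0 p) = eval1 m (s * m) p"
  by (simp add: eval1_def psum_pCons mult.assoc)

lemma eval1_const: "eval1 m s [:v:] = F s v"
  by (simp add: eval1_def psum_pCons)

lemma eval1_del: "p \<in> A1 \<Longrightarrow> eval1 m s (map_poly (cdel C) p) = - eval1 m (s * \<sigma>) p"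
  unfolding eval1_def psum_minus[symmetric]
  by (subst psum_map_poly) (auto intro!: psum_cong simp: F_del A1_coeff mult_ac)

text \<open>
  Substituting an operator that the evaluation turns into the scalar \<open>t\<close> amounts to evaluating at \<open>t\<close>.
\<close>
lemma ev_subst_op:
  assumes W: "0 \<in> W" "\<And>u v. u \<in> W \<Longrightarrow> v \<in> W \<Longrightarrow> u + v \<in> W" "\<And>u. u \<in> W \<Longrightarrow> T u \<in> W"
    and ev: "\<And>s. ev s 0 = 0" "\<And>s u v. u \<in> W \<Longrightarrow> v \<in> W \<Longrightarrow> ev s (u + v) = ev s u + ev s v"
      "\<And>s u. u \<in> W \<Longrightarrow> ev s (T u) = ev (s * t) u"
    and p: "\<And>i. \<iota> (coeff p i) \<in> W"
  shows "ev (s :: 's) (subst_op T \<iota> p) = psum (\<lambda>i v. ev (s * t ^ i) (\<iota> v)) p"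
proof -
  have pow: "(T ^^ i) u \<in> W \<and> ev s ((T ^^ i) u) = ev (s * t ^ i) u" if "u \<in> W" for u i s
    by (induction i arbitrary: s) (use that W ev in \<open>auto simp: mult.assoc\<close>)
  have "(\<Sum>i\<in>I. (T ^^ i) (\<iota> (coeff p i))) \<in> W \<and>
     ev s (\<Sum>i\<in>I. (T ^^ i) (\<iota> (coeff p i))) = (\<Sum>i\<in>I. ev (s * t ^ i) (\<iota> (coeff p i)))" for I
    by (induction I rule: infinite_finite_induct) (use W ev pow[OF p] in auto)
  then show ?thesis by (simp add: subst_op_def psum_def)
qed

lemma eval1_subst_neg: "p \<in> A1 \<Longrightarrow> eval1 m s (subst_neg C p) = eval1 (\<sigma> - m) s p"
  unfolding subst_neg_def
  by (subst ev_subst_op[where W = A1 and t = "\<sigma> - m"])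
    (auto simp: A1_closed eval1_add eval1_diff eval1_uminus eval1_del eval1_pCons A1_coeff eval1_const right_diff_distrib
      eval1_diff_left eval1_def[of "\<sigma> - m"])

definition eval2 :: "'s \<Rightarrow> 's \<Rightarrow> 's \<Rightarrow> 'v poly poly \<Rightarrow> 'b" where
  "eval2 l m s w = psum (\<lambda>j. eval1 l (s * m ^ j)) w"

lemma eval2_add: "w \<in> A2 \<Longrightarrow> w' \<in> A2 \<Longrightarrow> eval2 l m s (w + w') = eval2 l m s w + eval2 l m s w'"
  unfolding eval2_def by (rule psum_add[where A = A1]) (simp_all add: eval1_add)

lemma eval2_zero [simp]: "eval2 l m s 0 = 0"
  by (simp add: eval2_def)

lemma eval2_uminus: "w \<in> A2 \<Longrightarrow> eval2 l m s (- w) = - eval2 l m s w"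
  using eval2_add[OF _ A2_closed(3), of w w l m s] by (simp add: eq_neg_iff_add_eq_0 add.commute)

lemma eval2_diff: "w \<in> A2 \<Longrightarrow> w' \<in> A2 \<Longrightarrow> eval2 l m s (w - w') = eval2 l m s w - eval2 l m s w'"
  using eval2_add[OF _ A2_closed(3), of w w' l m s] by (simp add: eval2_uminus)

lemma eval2_add_left: "w \<in> A2 \<Longrightarrow> eval2 l m (s + t) w = eval2 l m s w + eval2 l m t w"
  unfolding eval2_def psum_plus[symmetric] by (rule psum_cong) (simp add: eval1_add_left A2_coeff distrib_right)

lemma eval2_diff_left: "w \<in> A2 \<Longrightarrow> eval2 l m (s - t) w = eval2 l m s w - eval2 l m t w"
  using eval2_add_left[of w l m "s - t" t] by simp

lemma eval2_op_mu: "eval2 l m s (op_mu w) = eval2 l m (s * m) w"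
  by (simp add: op_mu_def eval2_def psum_pCons mult.assoc)

lemma eval2_op_lam: "eval2 l m s (op_lam w) = eval2 l m (s * l) w"
  unfolding op_lam_def eval2_def
  by (subst psum_map_poly) (auto intro!: psum_cong simp: eval1_pCons mult_ac)

lemma eval2_op_lam_mu: "w \<in> A2 \<Longrightarrow> eval2 l m s (op_lam_mu w) = eval2 l m (s * (l + m)) w"
  by (simp add: op_lam_mu_def eval2_add A2_closed eval2_op_lam eval2_op_mu distrib_left eval2_add_left)

lemma eval2_del: "w \<in> A2 \<Longrightarrow> eval2 l m s (map_poly (map_poly (cdel C)) w) = - eval2 l m (s * \<sigma>) w"
  unfolding eval2_def psum_minus[symmetric]
  by (subst psum_map_poly) (auto intro!: psum_cong simp: eval1_del A2_coeff mult_ac)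

lemma map_map_del_A2: "w \<in> A2 \<Longrightarrow> map_poly (map_poly (cdel C)) w \<in> A2"
  using A1_closed(6) by (auto simp: polys_over_def[of A1] coeff_map_poly)

lemma eval2_op_neg_mu: "w \<in> A2 \<Longrightarrow> eval2 l m s (op_neg_mu C w) = eval2 l m (s * (\<sigma> - m)) w"
  by (simp add: op_neg_mu_def eval2_diff eval2_uminus A2_closed map_map_del_A2 eval2_del eval2_op_mu right_diff_distrib eval2_diff_left)

lemma eval2_const2: "eval2 l m s (const2 v) = F s v"
  by (simp add: const2_def eval2_def psum_pCons eval1_const)

lemma eval2_subst_const2:
  assumes "\<And>w. w \<in> A2 \<Longrightarrow> T w \<in> A2" "\<And>s w. w \<in> A2 \<Longrightarrow> eval2 l m s (T w) = eval2 l m (s * t) w" "p \<in> A1"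
  shows "subst_op T const2 p \<in> A2" "eval2 l m s (subst_op T const2 p) = eval1 t s p"
proof -
  show "subst_op T const2 p \<in> A2"
    by (rule subst_op_in) (use assms in \<open>auto intro: A2_closed A1_coeff\<close>)
  show "eval2 l m s (subst_op T const2 p) = eval1 t s p"
    by (subst ev_subst_op[where W = A2 and t = t])
      (use assms in \<open>auto simp: A2_closed A1_coeff eval2_add eval2_const2 eval1_def\<close>)
qed

lemma eval2_lprod_right:
  assumes S: "\<And>w. w \<in> A2 \<Longrightarrow> S w \<in> A2" "\<And>s w. w \<in> A2 \<Longrightarrow> eval2 l m s (S w) = eval2 l m (s * a) w"
    and T: "\<And>w. w \<in> A2 \<Longrightarrow> T w \<in> A2" "\<And>s w. w \<in> A2 \<Longrightarrow> eval2 l m s (T w) = eval2 l m (s * b) w"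
    and x: "x \<in> cspace C" and q: "q \<in> A1"
  shows "eval2 l m s (lprod_right C S T x q) = psum (\<lambda>j v. eval1 a (s * b ^ j) (clprod C x v)) q"
  unfolding lprod_right_def
  by (subst ev_subst_op[where W = A2 and t = b])
    (use assms in \<open>auto intro!: psum_cong eval2_subst_const2 simp: A2_closed A1_coeff eval2_add clprod_A1\<close>)

lemma eval2_lprod_left:
  assumes S: "\<And>w. w \<in> A2 \<Longrightarrow> S w \<in> A2" "\<And>s w. w \<in> A2 \<Longrightarrow> eval2 l m s (S w) = eval2 l m (s * a) w"
    and T: "\<And>w. w \<in> A2 \<Longrightarrow> T w \<in> A2" "\<And>s w. w \<in> A2 \<Longrightarrow> eval2 l m s (T w) = eval2 l m (s * b) w"
    and x: "x \<in> cspace C" and q: "q \<in> A1"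
  shows "eval2 l m s (lprod_left C S T q x) = psum (\<lambda>j v. eval1 b (s * a ^ j) (clprod C v x)) q"
  unfolding lprod_left_def
  by (subst ev_subst_op[where W = A2 and t = a])
    (use assms in \<open>auto intro!: psum_cong eval2_subst_const2 simp: A2_closed A1_coeff eval2_add clprod_A1\<close>)

lemma eval2_right_lam_mu:
  "x \<in> cspace C \<Longrightarrow> q \<in> A1 \<Longrightarrow>
    eval2 l m s (lprod_right C op_lam op_mu x q) = psum (\<lambda>j v. eval1 l (s * m ^ j) (clprod C x v)) q"
  by (rule eval2_lprod_right) (auto simp: A2_closed eval2_op_lam eval2_op_mu)

lemma eval2_right_mu_lam:
  "x \<in> cspace C \<Longrightarrow> q \<in> A1 \<Longrightarrow>
    eval2 l m s (lprod_right C op_mu op_lam x q) = psum (\<lambda>j v. eval1 m (s * l ^ j) (clprod C x v)) q"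
  by (rule eval2_lprod_right) (auto simp: A2_closed eval2_op_lam eval2_op_mu)

lemma eval2_left_lam_lam_mu:
  "x \<in> cspace C \<Longrightarrow> q \<in> A1 \<Longrightarrow>
    eval2 l m s (lprod_left C op_lam op_lam_mu q x) = psum (\<lambda>j v. eval1 (l + m) (s * l ^ j) (clprod C v x)) q"
  by (rule eval2_lprod_left) (auto simp: A2_closed eval2_op_lam eval2_op_lam_mu)

lemma eval2_left_lam_neg_mu:
  "x \<in> cspace C \<Longrightarrow> q \<in> A1 \<Longrightarrow>
    eval2 l m s (lprod_left C op_lam (op_neg_mu C) q x) = psum (\<lambda>j v. eval1 (\<sigma> - m) (s * l ^ j) (clprod C v x)) q"
  by (rule eval2_lprod_left) (auto simp: A2_closed eval2_op_lam eval2_op_neg_mu)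

text \<open>
  In \<open>x \<^sub>\<lambda> (\<cdot> \<^sub>-\<^sub>\<partial>\<^sub>-\<^sub>\<mu> \<cdot>)\<close> the operator \<open>\<partial>\<close> sees the inner momentum only, which is \<open>\<sigma> - l\<close>.
\<close>
lemma right_subst_neg:
  assumes x: "x \<in> cspace C" and q: "q \<in> A1"
  shows "psum (\<lambda>j v. eval1 l (s * m ^ j) (clprod C x v)) (subst_neg C q)
    = psum (\<lambda>j v. eval1 l (s * (\<sigma> - l - m) ^ j) (clprod C x v)) q"
proof -
  define ev where "ev s q = psum (\<lambda>j v. eval1 l (s * m ^ j) (clprod C x v)) q" for s q
  have ev_add: "ev s (p + q) = ev s p + ev s q" if "p \<in> A1" "q \<in> A1" for s p q
    unfolding ev_def
    by (rule psum_add[where A = "cspace C"]) (use that x in \<open>auto simp: clprod_add_right eval1_add clprod_A1\<close>)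
  have ev_0: "ev s 0 = 0" for s using x by (simp add: ev_def)
  have ev_uminus: "ev s (- p) = - ev s p" if "p \<in> A1" for s p
    using ev_add[OF that A1_closed(3)[OF that], of s] by (simp add: ev_0 eq_neg_iff_add_eq_0 add.commute)
  have ev_diff: "ev s (p - q) = ev s p - ev s q" if "p \<in> A1" "q \<in> A1" for s p q
    using ev_add[OF that(1) A1_closed(3)[OF that(2)], of s] ev_uminus[OF that(2)] by simp
  have ev_pCons: "ev s (pCons 0 p) = ev (s * m) p" for s p
    using x by (simp add: ev_def psum_pCons mult.assoc)
  have ev_const: "ev s [:v:] = eval1 l s (clprod C x v)" for s v
    using x by (simp add: ev_def psum_pCons)
  have ev_left: "ev (s - t) p = ev s p - ev t p" if "p \<in> A1" for s t p
  proof -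
    have "ev (r + t) p = ev r p + ev t p" for r
      unfolding ev_def psum_plus[symmetric]
      by (rule psum_cong) (simp add: eval1_add_left distrib_right A1_coeff that clprod_A1 x)
    from this[of "s - t"] show ?thesis by simp
  qed
  have ev_del: "ev s (map_poly (cdel C) p) = ev (s * l) p - ev (s * \<sigma>) p" if "p \<in> A1" for s p
  proof -
    have c: "clprod C x (cdel C v) = map_poly (cdel C) (clprod C x v) + pCons 0 (clprod C x v)" if "v \<in> cspace C" for v
      using del_clprod[OF x that] by (simp add: algebra_simps)
    have "ev s (map_poly (cdel C) p) = psum (\<lambda>j v. eval1 l (s * m ^ j) (clprod C x (cdel C v))) p"
      unfolding ev_def using x by (subst psum_map_poly) auto
    also have "\<dots> = psum (\<lambda>j v. eval1 l (s * l * m ^ j) (clprod C x v) + - eval1 l (s * \<sigma> * m ^ j) (clprod C x v)) p"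
      by (rule psum_cong) (simp add: c A1_coeff that eval1_add eval1_del eval1_pCons clprod_A1 x A1_closed mult_ac)
    finally show ?thesis unfolding psum_plus psum_minus ev_def by simp
  qed
  have "ev s (subst_neg C q) = psum (\<lambda>j v. ev (s * (\<sigma> - l - m) ^ j) [:v:]) q"
    unfolding subst_neg_def
    by (rule ev_subst_op[where W = A1])
      (use q in \<open>auto simp: A1_closed A1_coeff ev_add ev_0 ev_diff ev_uminus ev_pCons ev_del ev_left right_diff_distrib\<close>)
  then show ?thesis unfolding ev_const unfolding ev_def .
qed

end

section \<open>The Novikov algebra of coefficients\<close>

text \<open>
  Quotients by a subspace that depends on parameters are represented inside the original type, as the range
  of such a projection.
\<close>
lemma (in vector_space) subspace_projection_exists:
  assumes W: "subspace W"
  shows "\<exists>\<pi>. (\<forall>x y. \<pi> (x + y) = \<pi> x + \<pi> y) \<and> (\<forall>c x. \<pi> (scale c x) = scale c (\<pi> x)) \<and>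
    (\<forall>x. \<pi> (\<pi> x) = \<pi> x) \<and> (\<forall>x. \<pi> x = 0 \<longleftrightarrow> x \<in> W)"
proof -
  interpret VS: vector_space_pair scale scale ..
  obtain B where B: "B \<subseteq> W" "independent B" "W \<subseteq> span B"
    using maximal_independent_subset[of W] by metis
  have sB: "span B = W" using B W by (metis span_minimal subset_antisym)
  define p where "p = VS.construct B (\<lambda>x. x)"
  interpret p: Vector_Spaces.linear scale scale p
    unfolding p_def by (rule VS.linear_construct[OF B(2)])
  note add = p.add and sc = p.scale
  have pW: "p x \<in> W" for x
    using VS.construct_in_span[OF B(2), of "\<lambda>x. x" x] by (simp add: p_def sB)
  have p_id: "p x = x" if "x \<in> W" for x
  proof -
    have "x \<in> span B" using that sB by simp
    then show ?thesis
    proof (induction rule: span_induct_alt)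
      case base
      then show ?case using add[of 0 0] by simp
    next
      case (step c b y)
      then show ?case by (simp add: add sc) (simp add: p_def VS.construct_basis[OF B(2)])
    qed
  qed
  have "p (x - p x) = 0" for x
    using add[of "x - p x" "p x"] p_id[OF pW, of x] by simp
  then show ?thesis
    by (intro exI[of _ "\<lambda>x. x - p x"]) (auto simp: add sc scale_right_diff_distrib p_id, metis pW)
qed

definition smul :: "'s :: comm_ring_1 \<Rightarrow> ('i \<Rightarrow>\<^sub>0 's) \<Rightarrow> ('i \<Rightarrow>\<^sub>0 's)" where
  "smul s x = Poly_Mapping.map ((*) s) x"

lemma lookup_smul: "Poly_Mapping.lookup (smul s x) i = s * Poly_Mapping.lookup x i"
  by (simp add: smul_def Poly_Mapping.map.rep_eq when_def)

lemma smul_single [simp]: "smul s (Poly_Mapping.single i t) = Poly_Mapping.single i (s * t)"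
  by (rule poly_mapping_eqI) (simp add: lookup_smul lookup_single when_def)

lemma smul_add: "smul s (x + y) = smul s x + smul s y"
  and smul_add_left: "smul (s + t) x = smul s x + smul t x"
  and smul_smul: "smul s (smul t x) = smul (s * t) x"
  and smul_1 [simp]: "smul 1 x = x"
  by (rule poly_mapping_eqI, simp add: lookup_smul lookup_add algebra_simps)+

lemma smul_zero [simp]: "smul s 0 = 0"
  using smul_add[of s 0 0] by simp

lemma smul_diff: "smul s (x - y) = smul s x - smul s y"
  using smul_add[of s "x - y" y] by (simp add: algebra_simps)

lemma smul_sum: "smul s (sum f I) = (\<Sum>i\<in>I. smul s (f i))"
  by (induction I rule: infinite_finite_induct) (simp_all add: smul_add)

text \<open>
  The atom \<open>(v, \<sigma>)\<close> is the symbol \<open>v \<otimes> e\<^sup>\<sigma>\<close>.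
\<close>
type_synonym ('k, 'v) atoms = "('v \<times> 'k poly) \<Rightarrow>\<^sub>0 'k poly"

abbreviation atom :: "'v \<Rightarrow> 'k :: comm_ring_1 poly \<Rightarrow> 'k poly \<Rightarrow> ('k, 'v) atoms" where
  "atom v \<sigma> s \<equiv> Poly_Mapping.single (v, \<sigma>) s"

context conformal_algebra
begin

text \<open>
  Atoms of elements outside \<open>cspace C\<close> are killed, which turns partial operations on \<open>cspace C\<close> into total
  ones on the quotient.
\<close>
inductive_set relations :: "('k, 'v) atoms set" where
  rel_outside: "v \<notin> cspace C \<Longrightarrow> atom v \<sigma> s \<in> relations"
| rel_add: "u \<in> cspace C \<Longrightarrow> v \<in> cspace C \<Longrightarrow> atom (u + v) \<sigma> s - (atom u \<sigma> s + atom v \<sigma> s) \<in> relations"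
| rel_scale: "u \<in> cspace C \<Longrightarrow> atom (cscale C c u) \<sigma> s - atom u \<sigma> ([:c:] * s) \<in> relations"
| rel_del: "u \<in> cspace C \<Longrightarrow> atom (cdel C u) \<sigma> s + atom u \<sigma> (\<sigma> * s) \<in> relations"
| rel_diff: "x \<in> relations \<Longrightarrow> y \<in> relations \<Longrightarrow> x - y \<in> relations"

lemma rel_zero: "0 \<in> relations"
  using rel_diff[OF rel_add[OF zero_in zero_in, of 0 0] rel_add[OF zero_in zero_in, of 0 0]] by simp

lemma rel_uminus: "x \<in> relations \<Longrightarrow> - x \<in> relations"
  using rel_diff[OF rel_zero] by simp

lemma rel_plus: "x \<in> relations \<Longrightarrow> y \<in> relations \<Longrightarrow> x + y \<in> relations"
  using rel_diff[OF _ rel_uminus, of x y] by simp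

lemma rel_smul: "x \<in> relations \<Longrightarrow> smul s x \<in> relations"
proof (induction rule: relations.induct)
  case (rel_scale u c \<sigma> t)
  then show ?case using relations.rel_scale[of u c \<sigma> "s * t"] by (simp add: smul_diff mult.left_commute)
next
  case (rel_del u \<sigma> t)
  then show ?case using relations.rel_del[of u \<sigma> "s * t"] by (simp add: smul_add mult.left_commute)
qed (simp_all add: smul_diff smul_add relations.intros)

definition proj :: "('k, 'v) atoms \<Rightarrow> ('k, 'v) atoms" where
  "proj = (SOME \<pi>. (\<forall>x y. \<pi> (x + y) = \<pi> x + \<pi> y) \<and> (\<forall>c x. \<pi> (smul [:c:] x) = smul [:c:] (\<pi> x)) \<and>
    (\<forall>x. \<pi> (\<pi> x) = \<pi> x) \<and> (\<forall>x. \<pi> x = 0 \<longleftrightarrow> x \<in> relations))"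

lemma proj_add: "proj (x + y) = proj x + proj y"
  and proj_proj [simp]: "proj (proj x) = proj x"
  and proj_eq_0: "proj x = 0 \<longleftrightarrow> x \<in> relations"
proof -
  interpret VS: vector_space "\<lambda>c :: 'k. smul [:c:] :: ('k, 'v) atoms \<Rightarrow> ('k, 'v) atoms"
    by unfold_locales (simp_all add: smul_add smul_smul mult.commute flip: smul_add_left one_pCons)
  have "VS.subspace relations"
    by (intro VS.subspaceI rel_zero rel_plus rel_smul)
  note * = someI_ex[OF VS.subspace_projection_exists[OF this], folded proj_def]
  show "proj (x + y) = proj x + proj y" "proj (proj x) = proj x" "proj x = 0 \<longleftrightarrow> x \<in> relations"
    using * by blast+
qed

lemma proj_zero [simp]: "proj 0 = 0"
  using proj_add[of 0 0] by simp

lemma proj_uminus: "proj (- x) = - proj x"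
  using proj_add[of x "- x"] by (simp add: eq_neg_iff_add_eq_0 add.commute)

lemma proj_diff: "proj (x - y) = proj x - proj y"
  using proj_add[of x "- y"] by (simp add: proj_uminus)

lemma proj_sum: "proj (sum f I) = (\<Sum>i\<in>I. proj (f i))"
  by (induction I rule: infinite_finite_induct) (simp_all add: proj_add)

lemma proj_eq_iff: "proj x = proj y \<longleftrightarrow> x - y \<in> relations"
  using proj_eq_0[of "x - y"] by (simp add: proj_diff)

lemma proj_smul_proj: "proj (smul s (proj x)) = proj (smul s x)"
proof -
  have "proj x - x \<in> relations" by (simp flip: proj_eq_iff)
  from rel_smul[OF this, of s] show ?thesis by (simp add: proj_eq_iff smul_diff)
qed

abbreviation at_momentum :: "'k poly \<Rightarrow> 'k poly \<Rightarrow> 'v \<Rightarrow> ('k, 'v) atoms" where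
  "at_momentum \<sigma> s v \<equiv> proj (atom v \<sigma> s)"

lemma momentum_proj: "momentum C (at_momentum \<sigma>) \<sigma>"
proof
  show "proj (atom (u + v) \<sigma> s) = proj (atom u \<sigma> s) + proj (atom v \<sigma> s)" if "u \<in> cspace C" "v \<in> cspace C" for u v s
    using rel_add[OF that] by (simp add: proj_eq_iff flip: proj_add)
  show "proj (atom (cdel C u) \<sigma> s) = - proj (atom u \<sigma> (s * \<sigma>))" if "u \<in> cspace C" for u s
    using rel_del[OF that, of \<sigma> s] by (simp add: proj_eq_iff mult.commute flip: proj_uminus)
qed (simp add: single_add proj_add)

definition atom_mult :: "('v \<times> 'k poly) \<Rightarrow> ('v \<times> 'k poly) \<Rightarrow> 'k poly \<Rightarrow> ('k, 'v) atoms" where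
  "atom_mult a b s = (if fst a \<in> cspace C \<and> fst b \<in> cspace C
     then psum (\<lambda>i v. atom v (snd a + snd b) (s * snd a ^ i)) (clprod C (fst a) (fst b)) else 0)"

definition pre_mult :: "('k, 'v) atoms \<Rightarrow> ('k, 'v) atoms \<Rightarrow> ('k, 'v) atoms" where
  "pre_mult x y = lin (\<lambda>a s. lin (\<lambda>b t. atom_mult a b (s * t)) y) x"

lemma atom_mult_zero [simp]: "atom_mult a b 0 = 0"
  by (simp add: atom_mult_def psum_def)

lemma atom_mult_add: "atom_mult a b (s + t) = atom_mult a b s + atom_mult a b t"
  by (simp add: atom_mult_def distrib_right single_add flip: psum_plus)

lemma atom_mult_smul: "atom_mult a b (r * s) = smul r (atom_mult a b s)"
  by (simp add: atom_mult_def psum_def smul_sum mult.assoc)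

lemma pre_mult_single: "pre_mult (Poly_Mapping.single a s) (Poly_Mapping.single b t) = atom_mult a b (s * t)"
  by (simp add: pre_mult_def lin_single lin_def)

lemma pre_mult_add_left: "pre_mult (x + y) z = pre_mult x z + pre_mult y z"
proof -
  have "lin (\<lambda>b t. atom_mult a b ((s + s') * t)) z = lin (\<lambda>b t. atom_mult a b (s * t)) z + lin (\<lambda>b t. atom_mult a b (s' * t)) z" for a s s'
    by (simp add: lin_def distrib_right atom_mult_add sum.distrib)
  then show ?thesis unfolding pre_mult_def by (intro lin_add) (simp_all add: lin_def)
qed

lemma pre_mult_add_right: "pre_mult x (y + z) = pre_mult x y + pre_mult x z"
proof -
  have "lin (\<lambda>b t. atom_mult a b (s * t)) (y + z) = lin (\<lambda>b t. atom_mult a b (s * t)) y + lin (\<lambda>b t. atom_mult a b (s * t)) z" for a s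
    by (rule lin_add) (simp_all add: distrib_left atom_mult_add)
  then show ?thesis unfolding pre_mult_def by (simp add: lin_def[of _ x] sum.distrib)
qed

lemma pre_mult_zero [simp]: "pre_mult 0 x = 0" "pre_mult x 0 = 0"
  by (simp_all add: pre_mult_def) (simp add: lin_def)

lemma pre_mult_diff_left: "pre_mult (x - y) z = pre_mult x z - pre_mult y z"
  using pre_mult_add_left[of "x - y" y z] by (simp add: algebra_simps)

lemma pre_mult_diff_right: "pre_mult x (y - z) = pre_mult x y - pre_mult x z"
  using pre_mult_add_right[of x "y - z" z] by (simp add: algebra_simps)

lemma pre_mult_smul_left: "pre_mult (smul r x) y = smul r (pre_mult x y)"
proof (induction x rule: poly_mapping_additive_induct)
  case (single a s)
  show ?case
    by (induction y rule: poly_mapping_additive_induct)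
      (simp_all add: pre_mult_single mult.assoc atom_mult_smul pre_mult_add_right smul_add)
qed (simp add: smul_add pre_mult_add_left)

lemma pre_mult_smul_right: "pre_mult x (smul r y) = smul r (pre_mult x y)"
proof (induction x rule: poly_mapping_additive_induct)
  case (single a s)
  show ?case
    by (induction y rule: poly_mapping_additive_induct)
      (simp_all add: pre_mult_single mult.left_commute[of s] atom_mult_smul pre_mult_add_right smul_add)
qed (simp add: smul_add pre_mult_add_left)

lemma proj_atom_mult:
  assumes "u \<in> cspace C" "v \<in> cspace C"
  shows "proj (atom_mult (u, \<alpha>) (v, \<beta>) s) = momentum.eval1 (at_momentum (\<alpha> + \<beta>)) \<alpha> s (clprod C u v)"
proof -
  interpret momentum C "at_momentum (\<alpha> + \<beta>)" "\<alpha> + \<beta>" by (rule momentum_proj)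
  show ?thesis using assms by (simp add: eval1_def atom_mult_def psum_def proj_sum)
qed

lemma atom_mult_outside: "u \<notin> cspace C \<or> v \<notin> cspace C \<Longrightarrow> atom_mult (u, \<alpha>) (v, \<beta>) s = 0"
  by (auto simp: atom_mult_def)

text \<open>
  Sesquilinearity: \<open>\<partial>u + \<sigma> u\<close> is multiplied to \<open>(- \<lambda> + \<sigma>)(u \<^sub>\<lambda> w)\<close> with \<open>\<lambda> = \<sigma>\<close>.
\<close>
lemma pre_mult_rel_left: "x \<in> relations \<Longrightarrow> pre_mult x y \<in> relations"
proof (induction y rule: poly_mapping_additive_induct)
  case (single b t)
  obtain w \<beta> where b: "b = (w, \<beta>)" by (cases b)
  from single show ?case
  proof (induction rule: relations.induct)
    case (rel_diff x y)
    then show ?case using relations.rel_diff by (simp add: pre_mult_diff_left)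
  next
    case (rel_outside v \<sigma> s)
    then show ?case by (simp add: b pre_mult_single atom_mult_outside rel_zero)
  next
    case (rel_add u v \<sigma> s)
    interpret momentum C "at_momentum (\<sigma> + \<beta>)" "\<sigma> + \<beta>" by (rule momentum_proj)
    show ?case
    proof (cases "w \<in> cspace C")
      case True
      then show ?thesis using rel_add
        by (simp add: b pre_mult_single pre_mult_diff_left pre_mult_add_left proj_diff proj_add
            proj_atom_mult add_in clprod_add_left eval1_add clprod_A1 flip: proj_eq_0)
    qed (simp add: b pre_mult_single pre_mult_diff_left pre_mult_add_left atom_mult_outside rel_zero)
  next
    case (rel_scale u c \<sigma> s)
    interpret momentum C "at_momentum (\<sigma> + \<beta>)" "\<sigma> + \<beta>" by (rule momentum_proj)
    show ?case
    proof (cases "w \<in> cspace C")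
      case True
      have *: "eval1 \<sigma> t (map_poly (cscale C c) p) = eval1 \<sigma> ([:c:] * t) p" if "p \<in> A1" for t p
        unfolding eval1_def by (subst psum_map_poly)
          (use that relations.rel_scale[OF A1_coeff[OF that]] in \<open>auto intro!: psum_cong simp: proj_eq_iff mult.assoc\<close>)
      show ?thesis using rel_scale True
        by (simp add: b pre_mult_single pre_mult_diff_left proj_diff
            proj_atom_mult scale_in clprod_scale_left * clprod_A1 flip: proj_eq_0)
    qed (simp add: b pre_mult_single pre_mult_diff_left atom_mult_outside rel_zero)
  next
    case (rel_del u \<sigma> s)
    interpret momentum C "at_momentum (\<sigma> + \<beta>)" "\<sigma> + \<beta>" by (rule momentum_proj)
    show ?case
    proof (cases "w \<in> cspace C")
      case True
      then show ?thesis using rel_del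
        by (simp add: b pre_mult_single pre_mult_add_left proj_add proj_atom_mult del_in clprod_del_left
            eval1_uminus eval1_pCons clprod_A1 A1_closed mult_ac flip: proj_eq_0)
    qed (simp add: b pre_mult_single pre_mult_add_left atom_mult_outside rel_zero)
  qed
qed (simp add: pre_mult_add_right rel_plus)

text \<open>
  On the right, \<open>\<partial>\<close> acts on \<open>w \<^sub>\<lambda> u\<close> at total momentum \<open>\<beta> + \<sigma>\<close>, and \<open>w \<^sub>\<lambda> \<partial>u = (\<partial> + \<lambda>)(w \<^sub>\<lambda> u)\<close> with
  \<open>\<lambda> = \<beta>\<close>.
\<close>
lemma pre_mult_rel_right: "y \<in> relations \<Longrightarrow> pre_mult x y \<in> relations"
proof (induction x rule: poly_mapping_additive_induct)
  case (single b t)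
  obtain w \<beta> where b: "b = (w, \<beta>)" by (cases b)
  from single show ?case
  proof (induction rule: relations.induct)
    case (rel_diff x y)
    then show ?case using relations.rel_diff by (simp add: pre_mult_diff_right)
  next
    case (rel_outside v \<sigma> s)
    then show ?case by (simp add: b pre_mult_single atom_mult_outside rel_zero)
  next
    case (rel_add u v \<sigma> s)
    interpret momentum C "at_momentum (\<beta> + \<sigma>)" "\<beta> + \<sigma>" by (rule momentum_proj)
    show ?case
    proof (cases "w \<in> cspace C")
      case True
      then show ?thesis using rel_add
        by (simp add: b pre_mult_single pre_mult_diff_right pre_mult_add_right proj_diff proj_add
            proj_atom_mult add_in clprod_add_right eval1_add clprod_A1 flip: proj_eq_0)
    qed (simp add: b pre_mult_single pre_mult_diff_right pre_mult_add_right atom_mult_outside rel_zero)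
  next
    case (rel_scale u c \<sigma> s)
    interpret momentum C "at_momentum (\<beta> + \<sigma>)" "\<beta> + \<sigma>" by (rule momentum_proj)
    show ?case
    proof (cases "w \<in> cspace C")
      case True
      have *: "eval1 \<beta> t (map_poly (cscale C c) p) = eval1 \<beta> ([:c:] * t) p" if "p \<in> A1" for t p
        unfolding eval1_def by (subst psum_map_poly)
          (use that relations.rel_scale[OF A1_coeff[OF that]] in \<open>auto intro!: psum_cong simp: proj_eq_iff mult.assoc\<close>)
      show ?thesis using rel_scale True
        by (simp add: b pre_mult_single pre_mult_diff_right proj_diff mult.left_commute[of t]
            proj_atom_mult scale_in clprod_scale_right * clprod_A1 flip: proj_eq_0)
    qed (simp add: b pre_mult_single pre_mult_diff_right atom_mult_outside rel_zero)
  next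
    case (rel_del u \<sigma> s)
    interpret momentum C "at_momentum (\<beta> + \<sigma>)" "\<beta> + \<sigma>" by (rule momentum_proj)
    show ?case
    proof (cases "w \<in> cspace C")
      case True
      have "clprod C w (cdel C u) = map_poly (cdel C) (clprod C w u) + pCons 0 (clprod C w u)"
        using del_clprod[OF True rel_del] by (simp add: algebra_simps)
      moreover have "eval1 \<beta> (t * s) (map_poly (cdel C) p + pCons 0 p) + eval1 \<beta> (t * (\<sigma> * s)) p = 0" if "p \<in> A1" for p
      proof -
        have "eval1 \<beta> (t * s) (map_poly (cdel C) p + pCons 0 p) = eval1 \<beta> (t * s * \<beta> - t * s * (\<beta> + \<sigma>)) p"
          using that by (simp add: eval1_add eval1_del eval1_pCons A1_closed eval1_diff_left)
        also have "t * s * \<beta> - t * s * (\<beta> + \<sigma>) = - (t * (\<sigma> * s))" by (simp add: algebra_simps)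
        finally show ?thesis using that by (simp add: eval1_uminus_left)
      qed
      ultimately show ?thesis using rel_del True
        by (simp add: b pre_mult_single pre_mult_add_right proj_add proj_atom_mult del_in
            clprod_A1 flip: proj_eq_0)
    qed (simp add: b pre_mult_single pre_mult_add_right atom_mult_outside rel_zero)
  qed
qed (simp add: pre_mult_add_left rel_plus)

definition amult :: "('k, 'v) atoms \<Rightarrow> ('k, 'v) atoms \<Rightarrow> ('k, 'v) atoms" where
  "amult x y = proj (pre_mult x y)"

definition ascale :: "'k poly \<Rightarrow> ('k, 'v) atoms \<Rightarrow> ('k, 'v) atoms" where
  "ascale s x = proj (smul s x)"

lemma amult_proj_left [simp]: "amult (proj x) y = amult x y"
proof -
  have "proj x - x \<in> relations" by (simp flip: proj_eq_iff)
  from pre_mult_rel_left[OF this, of y] show ?thesis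
    by (simp add: amult_def proj_eq_iff pre_mult_diff_left)
qed

lemma amult_proj_right [simp]: "amult x (proj y) = amult x y"
proof -
  have "proj y - y \<in> relations" by (simp flip: proj_eq_iff)
  from pre_mult_rel_right[OF this, of x] show ?thesis
    by (simp add: amult_def proj_eq_iff pre_mult_diff_right)
qed

lemma amult_add_left: "amult (x + y) z = amult x z + amult y z"
  and amult_add_right: "amult x (y + z) = amult x y + amult x z"
  by (simp_all add: amult_def pre_mult_add_left pre_mult_add_right proj_add)

lemma amult_ascale_left: "amult (ascale s x) y = ascale s (amult x y)"
  by (simp add: ascale_def) (simp add: amult_def pre_mult_smul_left proj_smul_proj)

lemma amult_ascale_right: "amult x (ascale s y) = ascale s (amult x y)"
  by (simp add: ascale_def) (simp add: amult_def pre_mult_smul_right proj_smul_proj)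

lemma amult_zero [simp]: "amult 0 x = 0" "amult x 0 = 0"
  by (simp_all add: amult_def)

lemma amult_sum_left: "amult (sum f I) y = (\<Sum>i\<in>I. amult (f i) y)"
  by (induction I rule: infinite_finite_induct) (simp_all add: amult_add_left)

lemma amult_sum_right: "amult y (sum f I) = (\<Sum>i\<in>I. amult y (f i))"
  by (induction I rule: infinite_finite_induct) (simp_all add: amult_add_right)

lemma amult_at:
  assumes "u \<in> cspace C" "v \<in> cspace C"
  shows "amult (atom u \<alpha> s) (atom v \<beta> t) = momentum.eval1 (at_momentum (\<alpha> + \<beta>)) \<alpha> (s * t) (clprod C u v)"
  using assms by (simp add: amult_def pre_mult_single proj_atom_mult)

lemma amult_outside:
  assumes "v \<notin> cspace C"
  shows "amult (atom v \<sigma> s) x = 0" "amult x (atom v \<sigma> s) = 0"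
  using pre_mult_rel_left[OF rel_outside[OF assms]] pre_mult_rel_right[OF rel_outside[OF assms]]
  by (simp_all add: amult_def proj_eq_0)

lemma amult_right_nested:
  assumes a: "a \<in> cspace C" and b: "b \<in> cspace C" and c: "c \<in> cspace C" and \<sigma>: "\<sigma> = \<alpha> + \<beta> + \<gamma>"
  shows "amult (atom a \<alpha> s) (amult (atom b \<beta> t) (atom c \<gamma> r))
    = psum (\<lambda>j v. momentum.eval1 (at_momentum \<sigma>) \<alpha> (s * t * r * \<beta> ^ j) (clprod C a v)) (clprod C b c)"
proof -
  have "amult (atom a \<alpha> s) (amult (atom b \<beta> t) (atom c \<gamma> r))
     = psum (\<lambda>j v. amult (atom a \<alpha> s) (atom v (\<beta> + \<gamma>) (t * r * \<beta> ^ j))) (clprod C b c)"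
    unfolding amult_def[of "atom b \<beta> t"] pre_mult_single atom_mult_def using b c
    by (simp add: psum_def amult_sum_right)
  also have "\<dots> = psum (\<lambda>j v. momentum.eval1 (at_momentum \<sigma>) \<alpha> (s * t * r * \<beta> ^ j) (clprod C a v)) (clprod C b c)"
    by (rule psum_cong) (simp add: amult_at a b c clprod_closed \<sigma> mult.assoc add.assoc)
  finally show ?thesis .
qed

lemma amult_left_nested:
  assumes a: "a \<in> cspace C" and b: "b \<in> cspace C" and c: "c \<in> cspace C" and \<sigma>: "\<sigma> = \<alpha> + \<beta> + \<gamma>"
  shows "amult (amult (atom a \<alpha> s) (atom b \<beta> t)) (atom c \<gamma> r)
    = psum (\<lambda>j v. momentum.eval1 (at_momentum \<sigma>) (\<alpha> + \<beta>) (s * t * r * \<alpha> ^ j) (clprod C v c)) (clprod C a b)"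
proof -
  have "amult (amult (atom a \<alpha> s) (atom b \<beta> t)) (atom c \<gamma> r)
     = psum (\<lambda>j v. amult (atom v (\<alpha> + \<beta>) (s * t * \<alpha> ^ j)) (atom c \<gamma> r)) (clprod C a b)"
    unfolding amult_def[of "atom a \<alpha> s"] pre_mult_single atom_mult_def using a b
    by (simp add: psum_def amult_sum_left)
  also have "\<dots> = psum (\<lambda>j v. momentum.eval1 (at_momentum \<sigma>) (\<alpha> + \<beta>) (s * t * r * \<alpha> ^ j) (clprod C v c)) (clprod C a b)"
    by (rule psum_cong) (simp add: amult_at a b c clprod_closed \<sigma> mult_ac)
  finally show ?thesis .
qed

definition letter :: "'v \<Rightarrow> 'k poly \<Rightarrow> ('k, 'v) atoms" where
  "letter v \<sigma> = proj (atom v \<sigma> 1)"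

lemma ascale_letter: "ascale s (letter v \<sigma>) = proj (atom v \<sigma> s)"
  by (simp add: ascale_def letter_def proj_smul_proj)

lemma letter_add: "u \<in> cspace C \<Longrightarrow> v \<in> cspace C \<Longrightarrow> letter (u + v) \<sigma> = letter u \<sigma> + letter v \<sigma>"
  unfolding letter_def by (rule momentum.F_add[OF momentum_proj])

lemma letter_scale: "u \<in> cspace C \<Longrightarrow> letter (cscale C c u) \<sigma> = ascale [:c:] (letter u \<sigma>)"
  using rel_scale[of u c \<sigma> 1] by (simp add: ascale_letter) (simp add: letter_def proj_eq_iff)

lemma letter_del: "u \<in> cspace C \<Longrightarrow> letter (cdel C u) \<sigma> = ascale (- \<sigma>) (letter u \<sigma>)"
  using momentum.F_del[OF momentum_proj, of u \<sigma> 1]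
  by (simp add: ascale_letter single_uminus proj_uminus) (simp add: letter_def)

lemma letter_outside: "v \<notin> cspace C \<Longrightarrow> letter v \<sigma> = 0"
  using rel_outside by (simp add: letter_def proj_eq_0)

lemma letter_mult:
  assumes "a \<in> cspace C" "b \<in> cspace C"
  shows "amult (letter a \<alpha>) (letter b \<beta>) = psum (\<lambda>i v. ascale (\<alpha> ^ i) (letter v (\<alpha> + \<beta>))) (clprod C a b)"
proof -
  interpret momentum C "at_momentum (\<alpha> + \<beta>)" "\<alpha> + \<beta>" by (rule momentum_proj)
  show ?thesis using amult_at[OF assms, of \<alpha> 1 \<beta> 1] by (simp add: letter_def) (simp add: letter_def[symmetric] eval1_def ascale_letter)
qed

text \<open>
  The class of \<open>v\<close> at the generic momentum \<open>t = [:0, 1:]\<close> determines \<open>v\<close>: a polynomial multiple of it is sent to the same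
  polynomial in \<open>- \<partial>\<close> applied to \<open>v\<close>.
\<close>
definition residue :: "('k, 'v) atoms \<Rightarrow> 'v" where
  "residue = lin (\<lambda>a s. if fst a \<in> cspace C \<and> snd a = [:0, 1:]
     then psum (\<lambda>i c. cscale C c (((\<lambda>v. - cdel C v) ^^ i) (fst a))) s else 0)"

lemma residue_relations: "x \<in> relations \<Longrightarrow> residue x = 0"
proof -
  let ?n = "\<lambda>v. - cdel C v"
  let ?app = "\<lambda>s u. psum (\<lambda>i c. cscale C c ((?n ^^ i) u)) s"
  have n_in: "(?n ^^ i) u \<in> cspace C" if "u \<in> cspace C" for i u
    using that by (induction i) (auto intro: neg_in del_in)
  have n_add: "(?n ^^ i) (u + v) = (?n ^^ i) u + (?n ^^ i) v" if "u \<in> cspace C" "v \<in> cspace C" for i u v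
    using that by (induction i) (simp_all add: del_add n_in)
  have n_scale: "(?n ^^ i) (cscale C c u) = cscale C c ((?n ^^ i) u)" if "u \<in> cspace C" for i u c
    using that by (induction i) (simp_all add: del_scale n_in)
  have app_left: "?app (s + t) u = ?app s u + ?app t u" for s t u
    by (rule psum_add[where A = UNIV]) (simp_all add: polys_over_def scale_left_distrib)
  have residue_add: "residue (x + y) = residue x + residue y" for x y
    unfolding residue_def by (rule lin_add) (auto simp: app_left)
  have residue_diff: "residue (x - y) = residue x - residue y" for x y
    using residue_add[of "x - y" y] by (simp add: algebra_simps)
  have r: "residue (atom u \<sigma> s) = (if u \<in> cspace C \<and> \<sigma> = [:0, 1:] then ?app s u else 0)" for u \<sigma> s
    unfolding residue_def by (subst lin_single) auto
  have app_neg: "?app s (?n u) = - ?app s (cdel C u)" if "u \<in> cspace C" for s u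
  proof -
    have "(?n ^^ i) (?n u) = - (?n ^^ i) (cdel C u)" for i
      using n_scale[OF del_in[OF that], of i "- 1"] by (simp add: scale_minus_left)
    then show ?thesis by (simp add: scale_minus_right psum_minus[symmetric])
  qed
  show "x \<in> relations \<Longrightarrow> residue x = 0"
  proof (induction rule: relations.induct)
    case (rel_add u v \<sigma> s)
    then show ?case by (simp add: residue_diff residue_add r add_in n_add scale_right_distrib psum_plus)
  next
    case (rel_scale u c \<sigma> s)
    have "?app (smult c s) u = ?app s (cscale C c u)"
      using rel_scale by (simp add: smult_conv_map_poly psum_map_poly n_scale mult.commute)
    then show ?case using rel_scale by (simp add: residue_diff r scale_in)
  next
    case (rel_del u \<sigma> s)
    have "?app (pCons 0 s) u = - ?app s (cdel C u)"
      using app_neg[OF rel_del] by (simp add: psum_pCons funpow_Suc_right del: funpow.simps)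
    then show ?case using rel_del by (simp add: residue_add r del_in)
  qed (simp_all add: r residue_diff)
qed

lemma letter_generic_zero:
  assumes v: "v \<in> cspace C" and 0: "ascale 1 (letter v [:0, 1:]) = 0"
  shows "v = 0"
proof -
  have "atom v [:0, 1:] 1 \<in> relations"
    using 0 by (simp add: ascale_letter proj_eq_0)
  then have "residue (atom v [:0, 1:] 1) = 0" by (rule residue_relations)
  moreover have "residue (atom v [:0, 1:] 1) = v"
    unfolding residue_def using v by (subst lin_single) (simp_all add: psum_def)
  ultimately show ?thesis by simp
qed

end

context novikov_conformal_algebra
begin

lemma amult_left_comm_at:
  "amult (atom u \<alpha> s) (amult (atom v \<beta> t) (atom w \<gamma> r)) = amult (atom v \<beta> t) (amult (atom u \<alpha> s) (atom w \<gamma> r))"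
proof (cases "u \<in> cspace C \<and> v \<in> cspace C \<and> w \<in> cspace C")
  case True
  then have u: "u \<in> cspace C" and v: "v \<in> cspace C" and w: "w \<in> cspace C" by auto
  define \<sigma> where "\<sigma> = \<alpha> + \<beta> + \<gamma>"
  have \<sigma>: "\<sigma> = \<beta> + \<alpha> + \<gamma>" by (simp add: \<sigma>_def)
  interpret momentum C "at_momentum \<sigma>" \<sigma> by (rule momentum_proj)
  have "eval2 \<alpha> \<beta> (s * t * r) (lprod_right C op_lam op_mu u (clprod C v w))
      = eval2 \<alpha> \<beta> (s * t * r) (lprod_right C op_mu op_lam v (clprod C u w))"
    using left_commutative[OF u v w] by simp
  then show ?thesis
    unfolding eval2_right_lam_mu[OF u clprod_A1[OF v w]] eval2_right_mu_lam[OF v clprod_A1[OF u w]]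
      amult_right_nested[OF u v w \<sigma>_def] amult_right_nested[OF v u w \<sigma>] by (simp only: mult.commute[of t s])
next
  case False
  then show ?thesis by (auto simp: amult_outside)
qed

lemma amult_right_sym_at:
  "amult (amult (atom u \<alpha> s) (atom v \<beta> t)) (atom w \<gamma> r) - amult (atom u \<alpha> s) (amult (atom v \<beta> t) (atom w \<gamma> r))
   = amult (amult (atom u \<alpha> s) (atom w \<gamma> r)) (atom v \<beta> t) - amult (atom u \<alpha> s) (amult (atom w \<gamma> r) (atom v \<beta> t))"
proof (cases "u \<in> cspace C \<and> v \<in> cspace C \<and> w \<in> cspace C")
  case True
  then have u: "u \<in> cspace C" and v: "v \<in> cspace C" and w: "w \<in> cspace C" by auto
  define \<sigma> where "\<sigma> = \<alpha> + \<beta> + \<gamma>"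
  have \<sigma>: "\<sigma> = \<alpha> + \<gamma> + \<beta>" by (simp add: \<sigma>_def)
  have \<sigma>': "\<sigma> - \<beta> = \<alpha> + \<gamma>" "\<sigma> - \<alpha> - \<beta> = \<gamma>" by (simp_all add: \<sigma>_def)
  have str: "s * r * t = s * t * r" by (simp add: mult_ac)
  interpret momentum C "at_momentum \<sigma>" \<sigma> by (rule momentum_proj)
  have A2: "lprod_left C op_lam op_lam_mu (clprod C u v) w \<in> A2"
    "lprod_right C op_lam op_mu u (clprod C v w) \<in> A2"
    "lprod_left C op_lam (op_neg_mu C) (clprod C u w) v \<in> A2"
    "lprod_right C op_lam op_mu u (subst_neg C (clprod C w v)) \<in> A2"
    unfolding lprod_left_def lprod_right_def
    by (auto intro!: subst_op_in A2_closed A1_coeff clprod_A1 subst_neg_A1 u v w)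
  have "eval2 \<alpha> \<beta> (s * t * r) (lprod_left C op_lam op_lam_mu (clprod C u v) w)
        - eval2 \<alpha> \<beta> (s * t * r) (lprod_right C op_lam op_mu u (clprod C v w))
      = eval2 \<alpha> \<beta> (s * t * r) (lprod_left C op_lam (op_neg_mu C) (clprod C u w) v)
        - eval2 \<alpha> \<beta> (s * t * r) (lprod_right C op_lam op_mu u (subst_neg C (clprod C w v)))"
    using right_symmetric[OF u v w] by (simp only: eval2_diff[OF A2(1,2), symmetric] eval2_diff[OF A2(3,4), symmetric])
  then show ?thesis
    unfolding eval2_right_lam_mu[OF u clprod_A1[OF v w]] eval2_left_lam_lam_mu[OF w clprod_A1[OF u v]]
      eval2_left_lam_neg_mu[OF v clprod_A1[OF u w]] eval2_right_lam_mu[OF u subst_neg_A1[OF clprod_A1[OF w v]]]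
      right_subst_neg[OF u clprod_A1[OF w v]] \<sigma>'
      amult_right_nested[OF u v w \<sigma>_def] amult_right_nested[OF u w v \<sigma>]
      amult_left_nested[OF u v w \<sigma>_def] amult_left_nested[OF u w v \<sigma>] str .
next
  case False
  then show ?thesis by (auto simp: amult_outside)
qed

text \<open>
  On atoms the two identities are the conformal ones evaluated at \<open>\<lambda> = \<alpha>\<close>, \<open>\<mu> = \<beta>\<close>; the variable \<open>- \<partial> - \<mu>\<close>
  becomes \<open>\<alpha> + \<gamma>\<close> for the outer product and \<open>\<gamma>\<close> for the inner one.
\<close>
lemma novikov_ring_atoms: "novikov_ring amult ascale"
proof
  fix x y z s t
  show "amult (x + y) z = amult x z + amult y z" by (rule amult_add_left)
  show "amult x (y + z) = amult x y + amult x z" by (rule amult_add_right)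
  show "ascale (s + t) x = ascale s x + ascale t x" by (simp add: ascale_def smul_add_left proj_add)
  show "ascale s (x + y) = ascale s x + ascale s y" by (simp add: ascale_def smul_add proj_add)
  show "ascale (s * t) x = ascale s (ascale t x)" by (simp add: ascale_def proj_smul_proj smul_smul)
  show "amult (ascale s x) y = ascale s (amult x y)" by (rule amult_ascale_left)
  show "amult x (ascale s y) = ascale s (amult x y)" by (rule amult_ascale_right)
  show "amult x (amult y z) = amult y (amult x z)"
  proof (induction x rule: poly_mapping_additive_induct)
    case x: (single a s)
    show ?case
    proof (induction y rule: poly_mapping_additive_induct)
      case y: (single b t)
      show ?case
      proof (induction z rule: poly_mapping_additive_induct)
        case z: (single c r)
        show ?case
          using amult_left_comm_at[of "fst a" "snd a" s "fst b" "snd b" t "fst c" "snd c" r] by simp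
      qed (simp add: amult_add_right)
    qed (simp add: amult_add_right amult_add_left)
  qed (simp add: amult_add_right amult_add_left)
  show "amult (amult x y) z - amult x (amult y z) = amult (amult x z) y - amult x (amult z y)"
  proof (induction x rule: poly_mapping_additive_induct)
    case x: (single a s)
    show ?case
    proof (induction y rule: poly_mapping_additive_induct)
      case y: (single b t)
      show ?case
      proof (induction z rule: poly_mapping_additive_induct)
        case z: (single c r)
        show ?case
          using amult_right_sym_at[of "fst a" "snd a" s "fst b" "snd b" t "fst c" "snd c" r] by simp
      qed (simp add: amult_add_right amult_add_left algebra_simps)
    qed (simp add: amult_add_right amult_add_left algebra_simps)
  qed (simp add: amult_add_right amult_add_left algebra_simps)
qed

end

section \<open>The commutative conformal algebra of local fields\<close>

lemma sum_fun_apply: "(\<Sum>i\<in>I. f i) x = (\<Sum>i\<in>I. f i x :: 'b :: comm_monoid_add)"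
  by (induction I rule: infinite_finite_induct) simp_all

text \<open>
  A field is a function from momenta to the quotient by \<open>J\<close>. The fields in \<open>G\<close> are local to each other: their
  product with total momentum \<open>\<sigma>\<close> is polynomial in the momentum of one factor, with a degree bound that
  is independent of \<open>\<sigma>\<close>.
\<close>
locale field_algebra = diff_ideal D J \<iota>
  for D :: "'u :: comm_ring_1 \<Rightarrow> 'u" and J and \<iota> :: "'k :: field_char_0 poly \<Rightarrow> 'u" +
  fixes G :: "('k poly \<Rightarrow> 'u) set"
  assumes G_D: "c \<in> G \<Longrightarrow> (\<lambda>\<sigma>. D (c \<sigma>)) \<in> G"
    and G_local: "b \<in> G \<Longrightarrow> c \<in> G \<Longrightarrow> \<exists>N. \<forall>\<sigma>. poly_mod N (\<lambda>\<mu>. b \<mu> * c (\<sigma> - \<mu>))"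
begin

text \<open>
  A linear choice of representatives modulo \<open>J\<close>.
\<close>
definition rep :: "'u \<Rightarrow> 'u" where
  "rep = (SOME \<pi>. (\<forall>x y. \<pi> (x + y) = \<pi> x + \<pi> y) \<and> (\<forall>c x. \<pi> (\<iota> [:c:] * x) = \<iota> [:c:] * \<pi> x) \<and>
    (\<forall>x. \<pi> (\<pi> x) = \<pi> x) \<and> (\<forall>x. \<pi> x = 0 \<longleftrightarrow> x \<in> J))"

lemma vector_space_\<iota>: "vector_space (\<lambda>c u. \<iota> [:c:] * u)"
proof
  show "\<iota> [:a:] * (\<iota> [:b:] * x) = \<iota> [:a * b:] * x" for a b x
    using \<iota>_mult[of "[:a:]" "[:b:]"] by (simp add: mult.assoc mult.commute[of b a])
  show "\<iota> [:a + b:] * x = \<iota> [:a:] * x + \<iota> [:b:] * x" for a b x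
    using \<iota>_add[of "[:a:]" "[:b:]"] by (simp add: distrib_right)
qed (simp_all add: distrib_left \<iota>_1 flip: one_pCons)

lemma rep_add: "rep (x + y) = rep x + rep y"
  and rep_scale: "rep (\<iota> [:c:] * x) = \<iota> [:c:] * rep x"
  and rep_rep [simp]: "rep (rep x) = rep x"
  and rep_eq_0: "rep x = 0 \<longleftrightarrow> x \<in> J"
proof -
  interpret VS: vector_space "\<lambda>c u. \<iota> [:c:] * u" by (rule vector_space_\<iota>)
  have "VS.subspace J" by (intro VS.subspaceI J_zero J_add J_mult)
  note * = someI_ex[OF VS.subspace_projection_exists[OF this], folded rep_def]
  show "rep (x + y) = rep x + rep y" "rep (\<iota> [:c:] * x) = \<iota> [:c:] * rep x"
    "rep (rep x) = rep x" "rep x = 0 \<longleftrightarrow> x \<in> J"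
    using * by blast+
qed

lemma rep_zero [simp]: "rep 0 = 0"
  using rep_add[of 0 0] by simp

lemma rep_uminus: "rep (- x) = - rep x"
  using rep_add[of x "- x"] by (simp add: eq_neg_iff_add_eq_0 add.commute)

lemma rep_diff: "rep (x - y) = rep x - rep y"
  using rep_add[of x "- y"] by (simp add: rep_uminus)

lemma rep_sum: "rep (sum f I) = (\<Sum>i\<in>I. rep (f i))"
  by (induction I rule: infinite_finite_induct) (simp_all add: rep_add)

lemma rep_eq_iff: "rep x = rep y \<longleftrightarrow> x \<approx> y"
  using rep_eq_0[of "x - y"] by (simp add: rep_diff cg_def)

lemma rep_cg [simp]: "rep x \<approx> x"
  by (simp flip: rep_eq_iff)

definition fscale :: "'k \<Rightarrow> ('k poly \<Rightarrow> 'u) \<Rightarrow> 'k poly \<Rightarrow> 'u" where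
  "fscale k c = (\<lambda>\<sigma>. \<iota> [:k:] * c \<sigma>)"

definition fdel :: "('k poly \<Rightarrow> 'u) \<Rightarrow> 'k poly \<Rightarrow> 'u" where
  "fdel c = (\<lambda>\<sigma>. rep (\<iota> (- \<sigma>) * c \<sigma>))"

definition fder :: "('k poly \<Rightarrow> 'u) \<Rightarrow> 'k poly \<Rightarrow> 'u" where
  "fder c = (\<lambda>\<sigma>. rep (D (c \<sigma>)))"

definition fmult :: "'k poly \<Rightarrow> ('k poly \<Rightarrow> 'u) \<Rightarrow> ('k poly \<Rightarrow> 'u) \<Rightarrow> 'k poly \<Rightarrow> 'u" where
  "fmult \<mu> b c = (\<lambda>\<sigma>. rep (b \<mu> * c (\<sigma> - \<mu>)))"

text \<open>
  The closure is taken under the values of the lambda product at natural numbers. By interpolation this is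
  the same as closure under its coefficients.
\<close>
inductive_set fields :: "('k poly \<Rightarrow> 'u) set" where
  fld_zero: "0 \<in> fields"
| fld_gen: "c \<in> G \<Longrightarrow> (\<lambda>\<sigma>. rep (c \<sigma>)) \<in> fields"
| fld_add: "b \<in> fields \<Longrightarrow> c \<in> fields \<Longrightarrow> b + c \<in> fields"
| fld_scale: "c \<in> fields \<Longrightarrow> fscale k c \<in> fields"
| fld_del: "c \<in> fields \<Longrightarrow> fdel c \<in> fields"
| fld_mult: "b \<in> fields \<Longrightarrow> c \<in> fields \<Longrightarrow> fmult (of_nat r) b c \<in> fields"

lemma fields_rep: "c \<in> fields \<Longrightarrow> rep (c \<sigma>) = c \<sigma>"
  by (induction rule: fields.induct) (simp_all add: rep_add rep_scale fscale_def fdel_def fmult_def)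

definition flocal :: "('k poly \<Rightarrow> 'u) \<Rightarrow> ('k poly \<Rightarrow> 'u) \<Rightarrow> bool" where
  "flocal b c \<longleftrightarrow> (\<exists>N. \<forall>\<sigma>. poly_mod N (\<lambda>\<mu>. b \<mu> * c (\<sigma> - \<mu>)))"

lemma flocal_sym: "flocal b c \<Longrightarrow> flocal c b"
proof -
  assume "flocal b c"
  then obtain N where N: "\<And>\<sigma>. poly_mod N (\<lambda>\<mu>. b \<mu> * c (\<sigma> - \<mu>))" by (auto simp: flocal_def)
  have "poly_mod N (\<lambda>\<mu>. c \<mu> * b (\<sigma> - \<mu>))" for \<sigma>
    using poly_mod_affine[OF N[of \<sigma>], of \<sigma> "- 1"] by (simp add: mult.commute)
  then show ?thesis by (auto simp: flocal_def)
qed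

text \<open>
  Locality passes to products without any loss of degree, because \<open>(b\<^sub>1(r) b\<^sub>2(\<mu> - r)) c(\<sigma> - \<mu>)\<close> depends on
  \<open>\<mu>\<close> only through \<open>b\<^sub>2\<close> and \<open>c\<close>.
\<close>
lemma flocal_fields:
  assumes b: "b \<in> fields" and gen: "\<And>g. g \<in> G \<Longrightarrow> flocal g c"
  shows "flocal b c"
  using b
proof induction
  case fld_zero
  then show ?case by (auto simp: flocal_def poly_mod_zero)
next
  case (fld_gen g)
  then obtain N where N: "\<And>\<sigma>. poly_mod N (\<lambda>\<mu>. g \<mu> * c (\<sigma> - \<mu>))" using gen by (auto simp: flocal_def)
  have "poly_mod N (\<lambda>\<mu>. rep (g \<mu>) * c (\<sigma> - \<mu>))" for \<sigma>
    by (rule poly_mod_cong[OF N[of \<sigma>]]) (intro cg_mult rep_cg cg_refl)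
  then show ?case by (auto simp: flocal_def)
next
  case (fld_add a b)
  then obtain N M where NM: "\<And>\<sigma>. poly_mod N (\<lambda>\<mu>. a \<mu> * c (\<sigma> - \<mu>))" "\<And>\<sigma>. poly_mod M (\<lambda>\<mu>. b \<mu> * c (\<sigma> - \<mu>))"
    by (auto simp: flocal_def)
  have "poly_mod (N + M) (\<lambda>\<mu>. a \<mu> * c (\<sigma> - \<mu>) + b \<mu> * c (\<sigma> - \<mu>))" for \<sigma>
    by (rule poly_mod_add[OF poly_mod_mono[OF NM(1)] poly_mod_mono[OF NM(2)]]) simp_all
  then show ?case by (auto simp: flocal_def distrib_right)
next
  case (fld_scale b k)
  then obtain N where "\<And>\<sigma>. poly_mod N (\<lambda>\<mu>. b \<mu> * c (\<sigma> - \<mu>))" by (auto simp: flocal_def)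
  then have "poly_mod N (\<lambda>\<mu>. \<iota> [:k:] * (b \<mu> * c (\<sigma> - \<mu>)))" for \<sigma>
    by (rule poly_mod_mult)
  then show ?case by (auto simp: flocal_def fscale_def mult.assoc)
next
  case (fld_del b)
  then obtain N where N: "\<And>\<sigma>. poly_mod N (\<lambda>\<mu>. b \<mu> * c (\<sigma> - \<mu>))" by (auto simp: flocal_def)
  have "poly_mod (Suc N) (\<lambda>\<mu>. fdel b \<mu> * c (\<sigma> - \<mu>))" for \<sigma>
  proof (rule poly_mod_cong[OF poly_mod_mult[OF poly_mod_var[OF N[of \<sigma>]], of "- 1"]])
    fix \<mu>
    have "fdel b \<mu> * c (\<sigma> - \<mu>) \<approx> \<iota> (- \<mu>) * b \<mu> * c (\<sigma> - \<mu>)"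
      unfolding fdel_def by (intro cg_mult rep_cg cg_refl)
    then show "fdel b \<mu> * c (\<sigma> - \<mu>) \<approx> - 1 * (\<iota> \<mu> * (b \<mu> * c (\<sigma> - \<mu>)))"
      by (simp add: \<iota>_uminus mult.assoc)
  qed
  then show ?case by (auto simp: flocal_def)
next
  case (fld_mult a b r)
  then obtain N where N: "\<And>\<sigma>. poly_mod N (\<lambda>\<mu>. b \<mu> * c (\<sigma> - \<mu>))" by (auto simp: flocal_def)
  have "poly_mod N (\<lambda>\<mu>. fmult (of_nat r) a b \<mu> * c (\<sigma> - \<mu>))" for \<sigma>
  proof (rule poly_mod_cong[OF poly_mod_mult[OF poly_mod_affine[OF N[of "\<sigma> - of_nat r"], of "- of_nat r" 1], of "a (of_nat r)"]])
    fix \<mu>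
    have "fmult (of_nat r) a b \<mu> * c (\<sigma> - \<mu>) \<approx> (a (of_nat r) * b (\<mu> - of_nat r)) * c (\<sigma> - \<mu>)"
      unfolding fmult_def by (intro cg_mult rep_cg cg_refl)
    then show "fmult (of_nat r) a b \<mu> * c (\<sigma> - \<mu>)
       \<approx> a (of_nat r) * (b (- of_nat r + 1 * \<mu>) * c (\<sigma> - of_nat r - (- of_nat r + 1 * \<mu>)))"
      by (simp add: mult.assoc)
  qed
  then show ?case by (auto simp: flocal_def)
qed

lemma fields_local: "b \<in> fields \<Longrightarrow> c \<in> fields \<Longrightarrow> flocal b c"
proof -
  assume b: "b \<in> fields" and c: "c \<in> fields"
  have "flocal b g" if "g \<in> G" for g
    using b by (rule flocal_fields) (use G_local that in \<open>auto simp: flocal_def\<close>)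
  then have "flocal c b" using flocal_fields[OF c] flocal_sym by blast
  then show ?thesis by (rule flocal_sym)
qed

lemma fields_sum: "(\<And>i. i \<in> I \<Longrightarrow> f i \<in> fields) \<Longrightarrow> sum f I \<in> fields"
  by (induction I rule: infinite_finite_induct) (simp_all add: fld_zero fld_add)

definition order :: "('k poly \<Rightarrow> 'u) \<Rightarrow> ('k poly \<Rightarrow> 'u) \<Rightarrow> nat" where
  "order b c = (SOME N. \<forall>\<sigma>. poly_mod N (\<lambda>\<mu>. b \<mu> * c (\<sigma> - \<mu>)))"

lemma order: "b \<in> fields \<Longrightarrow> c \<in> fields \<Longrightarrow> poly_mod (order b c) (\<lambda>\<mu>. b \<mu> * c (\<sigma> - \<mu>))"
  unfolding order_def using someI_ex[OF fields_local[unfolded flocal_def]] by blast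

definition fcoeff :: "nat \<Rightarrow> ('k poly \<Rightarrow> 'u) \<Rightarrow> ('k poly \<Rightarrow> 'u) \<Rightarrow> nat \<Rightarrow> 'k poly \<Rightarrow> 'u" where
  "fcoeff N b c i = (\<lambda>\<sigma>. rep (lagrange N (\<lambda>\<mu>. b \<mu> * c (\<sigma> - \<mu>)) i))"

lemma fcoeff_in:
  assumes "b \<in> fields" "c \<in> fields"
  shows "fcoeff N b c i \<in> fields"
proof -
  have "fcoeff N b c i = (\<Sum>r<N. fscale (vandermonde_inverse N i r) (fmult (of_nat r) b c))"
    by (rule ext) (simp add: fcoeff_def lagrange_def rep_sum rep_scale sum_fun_apply fscale_def fmult_def)
  then show ?thesis using assms by (auto intro!: fields_sum fields.intros)
qed

text \<open>
  The polynomial in \<open>\<mu>\<close> with values \<open>b(\<mu>) c(\<sigma> - \<mu>)\<close>, obtained by interpolation for each \<open>\<sigma>\<close>.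
\<close>
definition fprod :: "('k poly \<Rightarrow> 'u) \<Rightarrow> ('k poly \<Rightarrow> 'u) \<Rightarrow> ('k poly \<Rightarrow> 'u) poly" where
  "fprod b c = (\<Sum>i<order b c. monom (fcoeff (order b c) b c i) i)"

lemma coeff_fprod: "coeff (fprod b c) n = (if n < order b c then fcoeff (order b c) b c n else 0)"
  by (simp add: fprod_def coeff_sum)

definition ev :: "'k poly \<Rightarrow> 'k poly \<Rightarrow> ('k poly \<Rightarrow> 'u) poly \<Rightarrow> 'u" where
  "ev \<mu> \<sigma> p = psum (\<lambda>i v. \<iota> (\<mu> ^ i) * v \<sigma>) p"

lemma ev_add: "ev \<mu> \<sigma> (p + q) = ev \<mu> \<sigma> p + ev \<mu> \<sigma> q"
  unfolding ev_def by (rule psum_add[where A = UNIV]) (simp_all add: polys_over_def distrib_left)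

lemma ev_zero [simp]: "ev \<mu> \<sigma> 0 = 0"
  by (simp add: ev_def)

lemma ev_uminus: "ev \<mu> \<sigma> (- p) = - ev \<mu> \<sigma> p"
  using ev_add[of \<mu> \<sigma> p "- p"] by (simp add: eq_neg_iff_add_eq_0 add.commute)

lemma ev_diff: "ev \<mu> \<sigma> (p - q) = ev \<mu> \<sigma> p - ev \<mu> \<sigma> q"
  using ev_add[of \<mu> \<sigma> p "- q"] by (simp add: ev_uminus)

lemma ev_pCons: "ev \<mu> \<sigma> (pCons 0 p) = \<iota> \<mu> * ev \<mu> \<sigma> p"
  by (simp add: ev_def psum_pCons) (simp add: psum_def sum_distrib_left \<iota>_mult mult.assoc)

lemma ev_fprod:
  assumes "b \<in> fields" "c \<in> fields"
  shows "ev \<mu> \<sigma> (fprod b c) \<approx> b \<mu> * c (\<sigma> - \<mu>)"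
proof -
  let ?N = "order b c"
  have "ev \<mu> \<sigma> (fprod b c) = (\<Sum>i<?N. \<iota> (\<mu> ^ i) * fcoeff ?N b c i \<sigma>)"
  proof (cases "?N = 0")
    case True
    then show ?thesis by (simp add: fprod_def)
  next
    case False
    have "degree (fprod b c) < ?N"
      by (rule degree_lessI) (use False in \<open>auto simp: coeff_fprod\<close>)
    then show ?thesis
      unfolding ev_def by (subst psum_lessThan) (auto simp: coeff_fprod intro!: sum.cong)
  qed
  also have "\<dots> \<approx> (\<Sum>i<?N. \<iota> (\<mu> ^ i) * lagrange ?N (\<lambda>\<mu>. b \<mu> * c (\<sigma> - \<mu>)) i)"
    unfolding fcoeff_def by (rule cg_sum, rule cg_mult_left, rule rep_cg)
  also have "\<dots> \<approx> b \<mu> * c (\<sigma> - \<mu>)"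
    by (rule cg_sym[OF poly_mod_lagrange[OF order[OF assms, of \<sigma>], of \<mu>]])
  finally show ?thesis .
qed

abbreviation Q :: "('k poly \<Rightarrow> 'u) set" where "Q \<equiv> {c. \<forall>\<sigma>. rep (c \<sigma>) = c \<sigma>}"

text \<open>
  Identities between polynomials of fields may be checked after evaluation at all momenta. In this form the
  axioms of conformal algebras become identities in a commutative ring.
\<close>
lemma ev_unique:
  assumes p: "p \<in> polys_over Q" and q: "q \<in> polys_over Q"
    and eq: "\<And>\<mu> \<sigma>. ev \<mu> \<sigma> p \<approx> ev \<mu> \<sigma> q"
  shows "p = q"
proof (rule poly_eqI)
  fix n
  define N where "N = Suc (max n (max (degree p) (degree q)))"
  have N: "n < N" "degree p < N" "degree q < N" by (auto simp: N_def)
  show "coeff p n = coeff q n"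
  proof
    fix \<sigma>
    have e: "ev \<mu> \<sigma> r = (\<Sum>i<N. \<iota> (\<mu> ^ i) * coeff r i \<sigma>)" if "degree r < N" for r \<mu>
      unfolding ev_def by (rule psum_lessThan) (use that in auto)
    have "coeff p n \<sigma> \<approx> lagrange N (\<lambda>\<mu>. ev \<mu> \<sigma> p) n"
      by (rule cg_sym[OF lagrange_coeff]) (simp_all add: e N)
    also have "\<dots> \<approx> coeff q n \<sigma>"
      by (rule lagrange_coeff) (use eq e[OF N(3)] N in \<open>auto simp flip: e\<close>)
    finally have "rep (coeff p n \<sigma>) = rep (coeff q n \<sigma>)" by (simp add: rep_eq_iff)
    then show "coeff p n \<sigma> = coeff q n \<sigma>" using p q by (simp add: polys_over_def)
  qed
qed

lemma fields_Q: "fields \<subseteq> Q"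
  using fields_rep by auto

lemma fscale_zero [simp]: "fscale k 0 = 0"
  and fdel_zero [simp]: "fdel 0 = 0"
  and fder_zero [simp]: "fder 0 = 0"
  by (simp_all add: fun_eq_iff fscale_def fdel_def fder_def)

lemma rep_fscale: "rep (c \<sigma>) = c \<sigma> \<Longrightarrow> rep (fscale k c \<sigma>) = fscale k c \<sigma>"
  and rep_fdel: "rep (fdel c \<sigma>) = fdel c \<sigma>" and rep_fder: "rep (fder c \<sigma>) = fder c \<sigma>"
  by (simp_all add: fscale_def fdel_def fder_def rep_scale)

lemma fields_coeff_in: "b \<in> fields \<Longrightarrow> c \<in> fields \<Longrightarrow> coeff (fprod b c) n \<in> fields"
  by (simp add: coeff_fprod fcoeff_in fld_zero)

lemma fprod_Q: "b \<in> fields \<Longrightarrow> c \<in> fields \<Longrightarrow> fprod b c \<in> polys_over Q"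
  using fields_rep[OF fields_coeff_in] by (simp add: polys_over_def)

lemma polys_Q_closed:
  "p \<in> polys_over Q \<Longrightarrow> q \<in> polys_over Q \<Longrightarrow> p + q \<in> polys_over Q"
  "p \<in> polys_over Q \<Longrightarrow> q \<in> polys_over Q \<Longrightarrow> p - q \<in> polys_over Q"
  "p \<in> polys_over Q \<Longrightarrow> - p \<in> polys_over Q"
  "p \<in> polys_over Q \<Longrightarrow> pCons 0 p \<in> polys_over Q"
  "p \<in> polys_over Q \<Longrightarrow> map_poly (fscale k) p \<in> polys_over Q"
  "map_poly fdel p \<in> polys_over Q" "map_poly fder p \<in> polys_over Q"
  by (auto simp: polys_over_def coeff_pCons coeff_map_poly rep_add rep_diff rep_uminus
      rep_fscale rep_fdel rep_fder split: nat.splits)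

lemma ev_map_scale: "ev \<mu> \<sigma> (map_poly (fscale k) p) = \<iota> [:k:] * ev \<mu> \<sigma> p"
  unfolding ev_def by (subst psum_map_poly) (simp_all add: psum_def sum_distrib_left fscale_def zero_fun_def mult.left_commute)

lemma ev_map_del: "ev \<mu> \<sigma> (map_poly fdel p) \<approx> \<iota> (- \<sigma>) * ev \<mu> \<sigma> p"
proof -
  have "ev \<mu> \<sigma> (map_poly fdel p) = (\<Sum>i\<le>degree p. \<iota> (\<mu> ^ i) * rep (\<iota> (- \<sigma>) * coeff p i \<sigma>))"
    unfolding ev_def by (subst psum_map_poly) (simp_all add: psum_def fdel_def zero_fun_def)
  also have "\<dots> \<approx> (\<Sum>i\<le>degree p. \<iota> (\<mu> ^ i) * (\<iota> (- \<sigma>) * coeff p i \<sigma>))"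
    by (intro cg_sum cg_mult_left rep_cg)
  finally show ?thesis by (simp add: ev_def psum_def sum_distrib_left mult.left_commute)
qed

lemma ev_map_der: "ev \<mu> \<sigma> (map_poly fder p) \<approx> D (ev \<mu> \<sigma> p)"
proof -
  have "ev \<mu> \<sigma> (map_poly fder p) = (\<Sum>i\<le>degree p. \<iota> (\<mu> ^ i) * rep (D (coeff p i \<sigma>)))"
    unfolding ev_def by (subst psum_map_poly) (simp_all add: psum_def fder_def zero_fun_def)
  also have "\<dots> \<approx> (\<Sum>i\<le>degree p. \<iota> (\<mu> ^ i) * D (coeff p i \<sigma>))"
    by (intro cg_sum cg_mult_left rep_cg)
  finally show ?thesis by (simp add: ev_def psum_def D_sum D_\<iota>_mult)
qed

definition field_conformal :: "('k, 'k poly \<Rightarrow> 'u) conformal" where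
  "field_conformal = \<lparr>cspace = fields, cscale = fscale, cdel = fdel, clprod = fprod\<rparr>"

lemma field_conformal_sel [simp]: "cspace field_conformal = fields" "cscale field_conformal = fscale" "cdel field_conformal = fdel" "clprod field_conformal = fprod"
  by (simp_all add: field_conformal_def)

lemma fdel_add: "fdel (b + c) = fdel b + fdel c"
  by (simp add: fun_eq_iff fdel_def distrib_left rep_add)

lemma fdel_scale: "fdel (fscale k c) = fscale k (fdel c)"
  by (simp add: fun_eq_iff fdel_def fscale_def mult.left_commute[of "\<iota> (- _)"] rep_scale)

lemma fder_add: "fder (b + c) = fder b + fder c"
  by (simp add: fun_eq_iff fder_def D_add rep_add)

lemma fder_scale: "fder (fscale k c) = fscale k (fder c)"
  by (simp add: fun_eq_iff fder_def fscale_def D_\<iota>_mult rep_scale)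

lemma fder_del: "fder (fdel c) = fdel (fder c)"
proof
  fix \<sigma>
  have "D (rep (\<iota> (- \<sigma>) * c \<sigma>)) \<approx> D (\<iota> (- \<sigma>) * c \<sigma>)" by (intro cg_D rep_cg)
  also have "D (\<iota> (- \<sigma>) * c \<sigma>) = \<iota> (- \<sigma>) * D (c \<sigma>)" by (rule D_\<iota>_mult)
  also have "\<dots> \<approx> \<iota> (- \<sigma>) * rep (D (c \<sigma>))" by (intro cg_mult_left cg_sym[OF rep_cg])
  finally show "fder (fdel c) \<sigma> = fdel (fder c) \<sigma>" by (simp add: fder_def fdel_def rep_eq_iff)
qed

lemma fder_in: "c \<in> fields \<Longrightarrow> fder c \<in> fields"
proof (induction rule: fields.induct)
  case (fld_gen c)
  have "fder (\<lambda>\<sigma>. rep (c \<sigma>)) = (\<lambda>\<sigma>. rep (D (c \<sigma>)))"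
    by (simp add: fun_eq_iff fder_def rep_eq_iff cg_D)
  then show ?case using fields.fld_gen[OF G_D[OF fld_gen]] by simp
next
  case (fld_mult b c r)
  have eq: "fder (fmult (of_nat r) b c) = fmult (of_nat r) (fder b) c + fmult (of_nat r) b (fder c)"
  proof
    fix \<sigma>
    let ?b = "b (of_nat r)" and ?c = "c (\<sigma> - of_nat r)"
    have "D (rep (?b * ?c)) \<approx> D (?b * ?c)" by (intro cg_D rep_cg)
    also have "D (?b * ?c) = D ?b * ?c + ?b * D ?c" by (rule D_mult)
    also have "\<dots> \<approx> rep (D ?b) * ?c + ?b * rep (D ?c)"
      by (intro cg_add cg_mult cg_refl cg_sym[OF rep_cg])
    finally show "fder (fmult (of_nat r) b c) \<sigma> = (fmult (of_nat r) (fder b) c + fmult (of_nat r) b (fder c)) \<sigma>"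
      by (simp add: fder_def fmult_def rep_eq_iff flip: rep_add)
  qed
  show ?case unfolding eq by (intro fields.fld_add fields.fld_mult fld_mult)
next
  case fld_zero
  show ?case unfolding fder_zero by (rule fields.fld_zero)
next
  case (fld_add b c)
  show ?case unfolding fder_add by (intro fields.fld_add fld_add)
next
  case (fld_scale c k)
  show ?case unfolding fder_scale by (intro fields.fld_scale fld_scale)
next
  case (fld_del c)
  show ?case unfolding fder_del by (intro fields.fld_del fld_del)
qed

lemma vector_space_fscale: "vector_space fscale"
proof -
  interpret VS: vector_space "\<lambda>c u. \<iota> [:c:] * u" by (rule vector_space_\<iota>)
  show ?thesis
    by unfold_locales
      (simp_all add: fun_eq_iff fscale_def VS.scale_left_distrib VS.scale_right_distrib)
qed

lemma subspace_fields: "module.subspace fscale fields"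
proof -
  interpret VS: vector_space fscale by (rule vector_space_fscale)
  show ?thesis by (intro VS.subspaceI) (auto intro: fields.intros)
qed

lemma fprod_unique:
  assumes "b \<in> fields" "c \<in> fields" "p \<in> polys_over Q"
    and "\<And>\<mu> \<sigma>. ev \<mu> \<sigma> p \<approx> b \<mu> * c (\<sigma> - \<mu>)"
  shows "fprod b c = p"
  by (rule ev_unique[OF fprod_Q assms(3)])
    (use assms in \<open>auto intro: cg_trans[OF ev_fprod] cg_sym\<close>)

lemma conformal_fields: "conformal_algebra field_conformal"
proof (intro conformal_algebra.intro conformal_algebra_axioms.intro)
  show "vector_space (cscale field_conformal)" using vector_space_fscale by simp
  show "module.subspace (cscale field_conformal) (cspace field_conformal)" using subspace_fields by simp
  show "linear_between field_conformal field_conformal (cdel field_conformal)"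
    by (simp add: linear_between_def fld_del fdel_add fdel_scale)
next
  fix a b n assume "a \<in> cspace field_conformal" "b \<in> cspace field_conformal"
  then show "coeff (clprod field_conformal a b) n \<in> cspace field_conformal" by (simp add: fields_coeff_in)
next
  fix a a' b assume "a \<in> cspace field_conformal" "a' \<in> cspace field_conformal" "b \<in> cspace field_conformal"
  then have f: "a \<in> fields" "a' \<in> fields" "b \<in> fields" "a + a' \<in> fields" by (auto intro: fld_add)
  have "fprod (a + a') b = fprod a b + fprod a' b"
  proof (rule fprod_unique)
    show "ev \<mu> \<sigma> (fprod a b + fprod a' b) \<approx> (a + a') \<mu> * b (\<sigma> - \<mu>)" for \<mu> \<sigma>
      unfolding ev_add plus_fun_apply distrib_right by (intro cg_add ev_fprod f)
  qed (use f in \<open>auto intro: polys_Q_closed fprod_Q simp del: plus_fun_apply\<close>)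
  then show "clprod field_conformal (a + a') b = clprod field_conformal a b + clprod field_conformal a' b" unfolding field_conformal_sel .
next
  fix a b b' assume "a \<in> cspace field_conformal" "b \<in> cspace field_conformal" "b' \<in> cspace field_conformal"
  then have f: "a \<in> fields" "b \<in> fields" "b' \<in> fields" "b + b' \<in> fields" by (auto intro: fld_add)
  have "fprod a (b + b') = fprod a b + fprod a b'"
  proof (rule fprod_unique)
    show "ev \<mu> \<sigma> (fprod a b + fprod a b') \<approx> a \<mu> * (b + b') (\<sigma> - \<mu>)" for \<mu> \<sigma>
      unfolding ev_add plus_fun_apply distrib_left by (intro cg_add ev_fprod f)
  qed (use f in \<open>auto intro: polys_Q_closed fprod_Q simp del: plus_fun_apply\<close>)
  then show "clprod field_conformal a (b + b') = clprod field_conformal a b + clprod field_conformal a b'" unfolding field_conformal_sel .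
next
  fix a b c assume "a \<in> cspace field_conformal" "b \<in> cspace field_conformal"
  then have f: "a \<in> fields" "b \<in> fields" "fscale c a \<in> fields" "fscale c b \<in> fields" "fdel a \<in> fields" "fdel b \<in> fields"
    by (auto intro: fields.intros)
  have ab: "ev \<mu> \<sigma> (fprod a b) \<approx> a \<mu> * b (\<sigma> - \<mu>)" for \<mu> \<sigma>
    by (intro ev_fprod f)
  have "fprod (fscale c a) b = map_poly (fscale c) (fprod a b)"
  proof (rule fprod_unique)
    show "ev \<mu> \<sigma> (map_poly (fscale c) (fprod a b)) \<approx> fscale c a \<mu> * b (\<sigma> - \<mu>)" for \<mu> \<sigma>
      using cg_mult_left[OF ab] by (simp add: ev_map_scale fscale_def mult.assoc)
  qed (use f in \<open>auto intro: polys_Q_closed fprod_Q\<close>)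
  then show "clprod field_conformal (cscale field_conformal c a) b = map_poly (cscale field_conformal c) (clprod field_conformal a b)" by simp
  have "fprod a (fscale c b) = map_poly (fscale c) (fprod a b)"
  proof (rule fprod_unique)
    show "ev \<mu> \<sigma> (map_poly (fscale c) (fprod a b)) \<approx> a \<mu> * fscale c b (\<sigma> - \<mu>)" for \<mu> \<sigma>
      using cg_mult_left[OF ab, of "\<iota> [:c:]"] by (simp add: ev_map_scale fscale_def mult.left_commute[of "a \<mu>"])
  qed (use f in \<open>auto intro: polys_Q_closed fprod_Q\<close>)
  then show "clprod field_conformal a (cscale field_conformal c b) = map_poly (cscale field_conformal c) (clprod field_conformal a b)" by simp
  have "fprod (fdel a) b = - pCons 0 (fprod a b)"
  proof (rule fprod_unique)
    fix \<mu> \<sigma>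
    have "ev \<mu> \<sigma> (- pCons 0 (fprod a b)) = \<iota> (- \<mu>) * ev \<mu> \<sigma> (fprod a b)"
      by (simp add: ev_uminus ev_pCons \<iota>_uminus)
    also have "\<dots> \<approx> \<iota> (- \<mu>) * (a \<mu> * b (\<sigma> - \<mu>))" by (rule cg_mult_left[OF ab])
    also have "\<dots> = (\<iota> (- \<mu>) * a \<mu>) * b (\<sigma> - \<mu>)" by (rule mult.assoc[symmetric])
    also have "\<dots> \<approx> fdel a \<mu> * b (\<sigma> - \<mu>)"
      unfolding fdel_def by (intro cg_mult cg_refl cg_sym[OF rep_cg])
    finally show "ev \<mu> \<sigma> (- pCons 0 (fprod a b)) \<approx> fdel a \<mu> * b (\<sigma> - \<mu>)" .
  qed (use f in \<open>auto intro: polys_Q_closed fprod_Q\<close>)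
  then show "clprod field_conformal (cdel field_conformal a) b = - pCons 0 (clprod field_conformal a b)" by simp
  have "fprod a (fdel b) = map_poly fdel (fprod a b) + pCons 0 (fprod a b)"
  proof (rule fprod_unique)
    fix \<mu> \<sigma>
    have "ev \<mu> \<sigma> (map_poly fdel (fprod a b) + pCons 0 (fprod a b))
        \<approx> \<iota> (- \<sigma>) * ev \<mu> \<sigma> (fprod a b) + \<iota> \<mu> * ev \<mu> \<sigma> (fprod a b)"
      unfolding ev_add ev_pCons by (intro cg_add ev_map_del cg_refl)
    also have "\<dots> = \<iota> (- (\<sigma> - \<mu>)) * ev \<mu> \<sigma> (fprod a b)"
      by (simp add: \<iota>_diff \<iota>_uminus algebra_simps)
    also have "\<dots> \<approx> \<iota> (- (\<sigma> - \<mu>)) * (a \<mu> * b (\<sigma> - \<mu>))" by (rule cg_mult_left[OF ab])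
    also have "\<dots> = a \<mu> * (\<iota> (- (\<sigma> - \<mu>)) * b (\<sigma> - \<mu>))" by (rule mult.left_commute)
    also have "\<dots> \<approx> a \<mu> * fdel b (\<sigma> - \<mu>)"
      unfolding fdel_def by (intro cg_mult_left cg_sym[OF rep_cg])
    finally show "ev \<mu> \<sigma> (map_poly fdel (fprod a b) + pCons 0 (fprod a b)) \<approx> a \<mu> * fdel b (\<sigma> - \<mu>)" .
  qed (use f in \<open>auto intro: polys_Q_closed fprod_Q\<close>)
  then show "map_poly (cdel field_conformal) (clprod field_conformal a b) = clprod field_conformal a (cdel field_conformal b) - pCons 0 (clprod field_conformal a b)" by simp
qed

abbreviation field_at :: "'k poly \<Rightarrow> 'k poly \<Rightarrow> ('k poly \<Rightarrow> 'u) \<Rightarrow> 'u" where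
  "field_at \<sigma> s v \<equiv> rep (\<iota> s * v \<sigma>)"

lemma momentum_fields: "momentum field_conformal (field_at \<sigma>) \<sigma>"
proof (intro momentum.intro momentum_axioms.intro conformal_fields)
  fix u s
  have "\<iota> s * rep (\<iota> (- \<sigma>) * u \<sigma>) \<approx> \<iota> s * (\<iota> (- \<sigma>) * u \<sigma>)" by (intro cg_mult_left rep_cg)
  also have "\<dots> = - (\<iota> (s * \<sigma>) * u \<sigma>)" by (simp add: \<iota>_uminus \<iota>_mult mult.assoc)
  finally show "rep (\<iota> s * cdel field_conformal u \<sigma>) = - rep (\<iota> (s * \<sigma>) * u \<sigma>)"
    by (simp add: fdel_def rep_eq_iff flip: rep_uminus)
qed (simp_all add: rep_add distrib_left distrib_right \<iota>_add)

lemma eval1_fields: "momentum.eval1 (field_at \<sigma>) \<mu> s p = rep (\<iota> s * ev \<mu> \<sigma> p)"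
proof -
  interpret momentum field_conformal "field_at \<sigma>" \<sigma> by (rule momentum_fields)
  show ?thesis by (simp add: eval1_def ev_def psum_def sum_distrib_left rep_sum \<iota>_mult mult.assoc)
qed

lemma ev2_unique:
  assumes w: "w \<in> polys_over (polys_over fields)" and w': "w' \<in> polys_over (polys_over fields)"
    and eq: "\<And>l m \<sigma>. momentum.eval2 (field_at \<sigma>) l m 1 w = momentum.eval2 (field_at \<sigma>) l m 1 w'"
  shows "w = w'"
proof -
  define H where "H l w = map_poly (\<lambda>q \<sigma>. rep (ev l \<sigma> q)) w" for l w
  have HQ: "H l w \<in> polys_over Q" for l w by (simp add: polys_over_def H_def coeff_map_poly zero_fun_def)
  have evH: "ev m \<sigma> (H l w) \<approx> momentum.eval2 (field_at \<sigma>) l m 1 w" for m \<sigma> l w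
  proof -
    interpret momentum field_conformal "field_at \<sigma>" \<sigma> by (rule momentum_fields)
    have "ev m \<sigma> (H l w) = (\<Sum>j\<le>degree w. \<iota> (m ^ j) * rep (ev l \<sigma> (coeff w j)))"
      unfolding ev_def[of m] H_def by (subst psum_map_poly) (simp_all add: zero_fun_def psum_def)
    also have "\<dots> \<approx> (\<Sum>j\<le>degree w. rep (\<iota> (m ^ j) * ev l \<sigma> (coeff w j)))"
      by (intro cg_sum cg_trans[OF cg_mult_left[OF rep_cg]] cg_sym[OF rep_cg])
    finally show ?thesis by (simp add: eval2_def psum_def eval1_fields)
  qed
  have Hw: "H l w = H l w'" for l
  proof (rule ev_unique[OF HQ HQ])
    fix m \<sigma>
    show "ev m \<sigma> (H l w) \<approx> ev m \<sigma> (H l w')"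
      using evH[of m \<sigma> l w] cg_sym[OF evH[of m \<sigma> l w']] unfolding eq[of \<sigma> l m] by (rule cg_trans)
  qed
  have "coeff w j = coeff w' j" for j
  proof (rule ev_unique)
    show "coeff w j \<in> polys_over Q" "coeff w' j \<in> polys_over Q"
      using w w' fields_rep by (auto simp: polys_over_def)
    show "ev l \<sigma> (coeff w j) \<approx> ev l \<sigma> (coeff w' j)" for l \<sigma>
      using arg_cong[OF Hw[of l], of "\<lambda>p. coeff p j \<sigma>"]
      by (simp add: H_def coeff_map_poly zero_fun_def rep_eq_iff)
  qed
  then show ?thesis by (rule poly_eqI)
qed

lemma commutative_fields: "commutative_conformal_algebra field_conformal"
proof (intro commutative_conformal_algebra.intro commutative_conformal_algebra_axioms.intro conformal_fields)
  interpret CA: conformal_algebra field_conformal by (rule conformal_fields)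
  fix a b assume "a \<in> cspace field_conformal" "b \<in> cspace field_conformal"
  then have f: "a \<in> fields" "b \<in> fields" by auto
  have A1: "fprod b a \<in> CA.A1" using CA.clprod_A1[of b a] f by simp
  have "fprod a b = subst_neg field_conformal (fprod b a)"
  proof (rule ev_unique)
    show "subst_neg field_conformal (fprod b a) \<in> polys_over Q"
      using CA.subst_neg_A1[OF A1] fields_Q by (auto simp: polys_over_def)
    fix \<mu> \<sigma>
    interpret momentum field_conformal "field_at \<sigma>" \<sigma> by (rule momentum_fields)
    have "rep (ev \<mu> \<sigma> (subst_neg field_conformal (fprod b a))) = rep (ev (\<sigma> - \<mu>) \<sigma> (fprod b a))"
      using eval1_subst_neg[OF A1, of \<mu> 1] by (simp add: eval1_fields \<iota>_1)
    also have "\<dots> = rep (b (\<sigma> - \<mu>) * a \<mu>)" using ev_fprod[OF f(2,1), of "\<sigma> - \<mu>" \<sigma>] by (simp add: rep_eq_iff)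
    also have "\<dots> = rep (ev \<mu> \<sigma> (fprod a b))"
      using cg_sym[OF ev_fprod[OF f, of \<mu> \<sigma>]] by (simp add: rep_eq_iff mult.commute)
    finally show "ev \<mu> \<sigma> (fprod a b) \<approx> ev \<mu> \<sigma> (subst_neg field_conformal (fprod b a))" by (simp add: rep_eq_iff cg_sym)
  qed (use f in \<open>auto intro: fprod_Q\<close>)
  then show "clprod field_conformal a b = subst_neg field_conformal (clprod field_conformal b a)" by simp
next
  interpret CA: conformal_algebra field_conformal by (rule conformal_fields)
  fix a b c assume "a \<in> cspace field_conformal" "b \<in> cspace field_conformal" "c \<in> cspace field_conformal"
  then have f: "a \<in> fields" "b \<in> fields" "c \<in> fields" by auto
  have A1: "fprod b c \<in> CA.A1" "fprod a b \<in> CA.A1"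
    using CA.clprod_A1[of b c] CA.clprod_A1[of a b] f by simp_all
  show "lprod_right field_conformal op_lam op_mu a (clprod field_conformal b c) = lprod_left field_conformal op_lam op_lam_mu (clprod field_conformal a b) c"
  proof (rule ev2_unique)
    show "lprod_right field_conformal op_lam op_mu a (clprod field_conformal b c) \<in> polys_over (polys_over fields)"
      "lprod_left field_conformal op_lam op_lam_mu (clprod field_conformal a b) c \<in> polys_over (polys_over fields)"
      unfolding lprod_left_def lprod_right_def
      using f A1 CA.A2_closed CA.A1_coeff CA.clprod_A1
      by (auto intro!: CA.subst_op_in)
    fix l m \<sigma>
    interpret momentum field_conformal "field_at \<sigma>" \<sigma> by (rule momentum_fields)
    have "eval2 l m 1 (lprod_right field_conformal op_lam op_mu a (fprod b c))
        = psum (\<lambda>j v. rep (\<iota> (m ^ j) * ev l \<sigma> (fprod a v))) (fprod b c)"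
      using eval2_right_lam_mu[of a "fprod b c" l m 1] f A1 by (simp add: eval1_fields)
    also have "\<dots> = psum (\<lambda>j v. rep (\<iota> (m ^ j) * (a l * v (\<sigma> - l)))) (fprod b c)"
      by (rule psum_cong) (use f in \<open>auto simp: rep_eq_iff intro!: cg_mult_left ev_fprod fields_coeff_in\<close>)
    also have "\<dots> = rep (a l * ev m (\<sigma> - l) (fprod b c))"
      by (simp add: ev_def psum_def rep_sum sum_distrib_left mult.left_commute)
    also have "\<dots> = rep (a l * (b m * c (\<sigma> - l - m)))"
      using f by (auto simp: rep_eq_iff intro!: cg_mult_left ev_fprod)
    finally have 1: "eval2 l m 1 (lprod_right field_conformal op_lam op_mu a (fprod b c)) = rep (a l * (b m * c (\<sigma> - l - m)))" .
    have "eval2 l m 1 (lprod_left field_conformal op_lam op_lam_mu (fprod a b) c)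
        = psum (\<lambda>j v. rep (\<iota> (l ^ j) * ev (l + m) \<sigma> (fprod v c))) (fprod a b)"
      using eval2_left_lam_lam_mu[of c "fprod a b" l m 1] f A1 by (simp add: eval1_fields)
    also have "\<dots> = psum (\<lambda>j v. rep (\<iota> (l ^ j) * (v (l + m) * c (\<sigma> - (l + m))))) (fprod a b)"
      by (rule psum_cong) (use f in \<open>auto simp: rep_eq_iff intro!: cg_mult_left ev_fprod fields_coeff_in\<close>)
    also have "\<dots> = rep (ev l (l + m) (fprod a b) * c (\<sigma> - (l + m)))"
      by (simp add: ev_def psum_def rep_sum sum_distrib_right mult.assoc)
    also have "\<dots> = rep ((a l * b ((l + m) - l)) * c (\<sigma> - (l + m)))"
      using f by (auto simp only: rep_eq_iff intro!: cg_mult ev_fprod cg_refl)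
    finally have "eval2 l m 1 (lprod_left field_conformal op_lam op_lam_mu (fprod a b) c) = rep (a l * (b m * c (\<sigma> - l - m)))"
      by (simp add: mult.assoc diff_diff_eq)
    with 1 show "eval2 l m 1 (lprod_right field_conformal op_lam op_mu a (clprod field_conformal b c))
        = eval2 l m 1 (lprod_left field_conformal op_lam op_lam_mu (clprod field_conformal a b) c)"
      by simp
  qed
qed

lemma derivation_fields: "conformal_derivation field_conformal fder"
  unfolding conformal_derivation_def linear_between_def
proof (intro conjI ballI allI)
  fix a b assume "a \<in> cspace field_conformal" "b \<in> cspace field_conformal"
  then have f: "a \<in> fields" "b \<in> fields" "fder a \<in> fields" "fder b \<in> fields" by (auto intro: fder_in)
  have "map_poly fder (fprod a b) = fprod (fder a) b + fprod a (fder b)"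
  proof (rule ev_unique)
    fix \<mu> \<sigma>
    have "ev \<mu> \<sigma> (map_poly fder (fprod a b)) \<approx> D (ev \<mu> \<sigma> (fprod a b))" by (rule ev_map_der)
    also have "\<dots> \<approx> D (a \<mu> * b (\<sigma> - \<mu>))" by (intro cg_D ev_fprod f)
    also have "D (a \<mu> * b (\<sigma> - \<mu>)) = D (a \<mu>) * b (\<sigma> - \<mu>) + a \<mu> * D (b (\<sigma> - \<mu>))" by (rule D_mult)
    also have "\<dots> \<approx> fder a \<mu> * b (\<sigma> - \<mu>) + a \<mu> * fder b (\<sigma> - \<mu>)"
      unfolding fder_def by (intro cg_add cg_mult cg_refl cg_sym[OF rep_cg])
    also have "\<dots> \<approx> ev \<mu> \<sigma> (fprod (fder a) b) + ev \<mu> \<sigma> (fprod a (fder b))"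
      by (intro cg_add cg_sym[OF ev_fprod] f)
    finally show "ev \<mu> \<sigma> (map_poly fder (fprod a b)) \<approx> ev \<mu> \<sigma> (fprod (fder a) b + fprod a (fder b))"
      by (simp add: ev_add)
  qed (use f in \<open>auto intro: polys_Q_closed fprod_Q\<close>)
  then show "map_poly fder (clprod field_conformal a b) = clprod field_conformal (fder a) b + clprod field_conformal a (fder b)" by simp
qed (simp_all add: fder_in fder_add fder_scale fder_del)

end

section \<open>Embedding a finitely generated Novikov conformal algebra\<close>

locale generated_novikov = novikov_conformal_algebra V
  for V :: "('k :: field_char_0, 'v :: ab_group_add) conformal" +
  fixes X :: "'v set"
  assumes X_finite: "finite X" and X_in: "X \<subseteq> cspace V"
    and X_generates: "conformal_subalgebra V hull X = cspace V"

sublocale generated_novikov \<subseteq> NR: novikov_ring amult ascale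
  by (rule novikov_ring_atoms)

sublocale generated_novikov \<subseteq> DI: diff_ideal dder NR.kern dconst
  by unfold_locales (simp_all add: NR.kern_zero NR.kern_diff NR.kern_mult NR.kern_dder dconst_add dconst_mult)

context generated_novikov
begin

abbreviation cong :: "(('k, 'v) atoms, 'k poly) dpoly \<Rightarrow> (('k, 'v) atoms, 'k poly) dpoly \<Rightarrow> bool" (infix "\<cong>" 50)
  where "u \<cong> v \<equiv> DI.cg u v"

definition jet_letter :: "'v \<Rightarrow> 'k poly \<Rightarrow> nat \<Rightarrow> (('k, 'v) atoms, 'k poly) dpoly" where
  "jet_letter v \<sigma> k = dletter (letter v \<sigma>) k"

lemma generators_induct [consumes 1, case_names generator add scale del nprod zero]:
  assumes v: "v \<in> cspace V"
    and gen: "\<And>x. x \<in> X \<Longrightarrow> P x"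
    and add: "\<And>u v. u \<in> cspace V \<Longrightarrow> v \<in> cspace V \<Longrightarrow> P u \<Longrightarrow> P v \<Longrightarrow> P (u + v)"
    and scale: "\<And>c u. u \<in> cspace V \<Longrightarrow> P u \<Longrightarrow> P (cscale V c u)"
    and del: "\<And>u. u \<in> cspace V \<Longrightarrow> P u \<Longrightarrow> P (cdel V u)"
    and prod: "\<And>u v n. u \<in> cspace V \<Longrightarrow> v \<in> cspace V \<Longrightarrow> P u \<Longrightarrow> P v \<Longrightarrow> P (coeff (clprod V u v) n)"
    and zero: "P 0"
  shows "P v"
proof -
  have "conformal_subalgebra V {v \<in> cspace V. P v}"
    unfolding conformal_subalgebra_def
  proof (intro conjI ballI allI)
    show "subspace {v \<in> cspace V. P v}"
      by (intro subspaceI) (auto intro: zero zero_in add add_in scale scale_in)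
    show "nprod V a n b \<in> {v \<in> cspace V. P v}" if "a \<in> {v \<in> cspace V. P v}" "b \<in> {v \<in> cspace V. P v}" for a b n
      using that by (auto simp: nprod_def intro!: scale scale_in prod clprod_closed)
  qed (auto intro: del del_in)
  then have "conformal_subalgebra V hull X \<subseteq> {v \<in> cspace V. P v}"
    by (intro hull_minimal) (use X_in gen in auto)
  then show ?thesis using v X_generates by auto
qed

lemma dletter_zero: "dletter 0 k \<cong> 0"
  using NR.kern_letter_add[of 0 0 k] DI.J_uminus[of "- dletter 0 k"] by (simp add: DI.cg_def)

lemma dletter_add: "dletter (a + b) k \<cong> dletter a k + dletter b k"
  using NR.kern_letter_add by (simp add: DI.cg_def)

lemma dletter_sc: "dletter (ascale s a) k \<cong> dconst s * dletter a k"
  using NR.kern_letter_sc by (simp add: DI.cg_def)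

lemma dletter_sum: "dletter (\<Sum>i\<in>I. f i) k \<cong> (\<Sum>i\<in>I. dletter (f i) k)"
proof (induction I rule: infinite_finite_induct)
  case (insert i I)
  have "dletter (f i + (\<Sum>i\<in>I. f i)) k \<cong> dletter (f i) k + (\<Sum>i\<in>I. dletter (f i) k)"
    by (rule DI.cg_trans[OF dletter_add]) (intro DI.cg_add DI.cg_refl insert)
  then show ?case using insert by simp
qed (simp_all add: dletter_zero)

lemma letter_zero [simp]: "letter 0 \<sigma> = 0"
  using letter_add[OF zero_in zero_in, of \<sigma>] by simp

lemma jet_letter_add:
  "u \<in> cspace V \<Longrightarrow> v \<in> cspace V \<Longrightarrow> jet_letter (u + v) \<sigma> k \<cong> jet_letter u \<sigma> k + jet_letter v \<sigma> k"
  by (simp add: jet_letter_def letter_add dletter_add)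

lemma jet_letter_scale: "u \<in> cspace V \<Longrightarrow> jet_letter (cscale V c u) \<sigma> k \<cong> dconst [:c:] * jet_letter u \<sigma> k"
  by (simp add: jet_letter_def letter_scale dletter_sc)

lemma jet_letter_del: "u \<in> cspace V \<Longrightarrow> jet_letter (cdel V u) \<sigma> k \<cong> dconst (- \<sigma>) * jet_letter u \<sigma> k"
  by (simp add: jet_letter_def letter_del dletter_sc)

lemma dder_jet_letter: "dder (jet_letter v \<sigma> k) = jet_letter v \<sigma> (Suc k)"
  by (simp add: jet_letter_def dder_dletter)

lemma jet_letter_mult:
  assumes a: "a \<in> cspace V" and b: "b \<in> cspace V" and N: "degree (clprod V a b) < N"
  shows "jet_letter a \<alpha> 1 * jet_letter b \<beta> 0
    \<cong> (\<Sum>i<N. dconst (\<alpha> ^ i) * jet_letter (coeff (clprod V a b) i) (\<alpha> + \<beta>) 0)"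
proof -
  have "jet_letter a \<alpha> 1 * jet_letter b \<beta> 0 \<cong> dletter (amult (letter a \<alpha>) (letter b \<beta>)) 0"
    unfolding jet_letter_def DI.cg_def by (rule NR.kern_product)
  also have "amult (letter a \<alpha>) (letter b \<beta>) = (\<Sum>i<N. ascale (\<alpha> ^ i) (letter (coeff (clprod V a b) i) (\<alpha> + \<beta>)))"
    unfolding letter_mult[OF a b] by (rule psum_lessThan[OF N]) simp
  also have "dletter \<dots> 0 \<cong> (\<Sum>i<N. dletter (ascale (\<alpha> ^ i) (letter (coeff (clprod V a b) i) (\<alpha> + \<beta>))) 0)"
    by (rule dletter_sum)
  also have "\<dots> \<cong> (\<Sum>i<N. dconst (\<alpha> ^ i) * jet_letter (coeff (clprod V a b) i) (\<alpha> + \<beta>) 0)"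
    unfolding jet_letter_def by (rule DI.cg_sum, rule dletter_sc)
  finally show ?thesis .
qed

abbreviation xmono :: "('v \<times> 'k poly \<times> nat) multiset \<Rightarrow> (('k, 'v) atoms, 'k poly) dpoly" where
  "xmono P \<equiv> (\<Prod>(x, \<alpha>, k)\<in>#P. jet_letter x \<alpha> k)"

text \<open>
  The span of the monomials in derivatives of generators over the ring of momenta, up to congruence.
\<close>
inductive_set generated :: "(('k, 'v) atoms, 'k poly) dpoly set" where
  gen_zero: "0 \<in> generated"
| gen_mono: "\<forall>l\<in>#P. fst l \<in> X \<Longrightarrow> dconst s * xmono P \<in> generated"
| gen_add: "u \<in> generated \<Longrightarrow> v \<in> generated \<Longrightarrow> u + v \<in> generated"
| gen_cong: "u \<in> generated \<Longrightarrow> v \<cong> u \<Longrightarrow> v \<in> generated"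

lemma generated_sum: "(\<And>i. i \<in> I \<Longrightarrow> f i \<in> generated) \<Longrightarrow> sum f I \<in> generated"
  by (induction I rule: infinite_finite_induct) (simp_all add: generated.intros)

lemma generated_dconst: "u \<in> generated \<Longrightarrow> dconst s * u \<in> generated"
proof (induction rule: generated.induct)
  case (gen_mono P t)
  then show ?case using generated.gen_mono[of P "s * t"] by (simp add: dconst_mult mult.assoc)
next
  case (gen_cong u v)
  then show ?case using generated.gen_cong DI.cg_mult_left by blast
qed (simp_all add: distrib_left generated.intros)

lemma generated_mult: "u \<in> generated \<Longrightarrow> v \<in> generated \<Longrightarrow> u * v \<in> generated"
proof (induction rule: generated.induct)
  case (gen_mono P s)
  have "xmono P * v \<in> generated" using gen_mono(2)
  proof (induction rule: generated.induct)
    case (gen_mono Q t)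
    have "dconst t * xmono (P + Q) \<in> generated"
      using gen_mono \<open>\<forall>l\<in>#P. fst l \<in> X\<close> by (intro generated.gen_mono) auto
    then show ?case by (simp add: mult_ac)
  next
    case (gen_cong u v)
    then show ?case using generated.gen_cong DI.cg_mult_left by blast
  qed (simp_all add: distrib_left generated.intros)
  then show ?case by (simp add: generated_dconst mult.assoc)
next
  case (gen_cong u u')
  then show ?case using generated.gen_cong[of "u * v" "u' * v"] DI.cg_mult DI.cg_refl by blast
qed (simp_all add: distrib_right generated.intros)

lemma generated_jet_letter_generator: "x \<in> X \<Longrightarrow> jet_letter x \<sigma> k \<in> generated"
  using gen_mono[of "{#(x, \<sigma>, k)#}" 1] by simp

lemma generated_dder: "u \<in> generated \<Longrightarrow> dder u \<in> generated"
proof (induction rule: generated.induct)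
  case (gen_mono P s)
  have "dder (xmono P) \<in> generated" using gen_mono
  proof (induction P)
    case (add l P)
    obtain x \<alpha> k where l: "l = (x, \<alpha>, k)" by (metis prod.collapse)
    have "jet_letter x \<alpha> (Suc k) * xmono P + jet_letter x \<alpha> k * dder (xmono P) \<in> generated"
      using add generated.gen_mono[of P 1]
      by (intro gen_add generated_mult) (auto simp: l intro: generated_jet_letter_generator)
    then show ?case by (simp add: l dder.D_mult dder_jet_letter)
  qed (simp add: gen_zero)
  then show ?case by (simp add: dder_dconst_mult generated_dconst)
next
  case (gen_cong u v)
  then show ?case using generated.gen_cong DI.cg_D by blast
qed (simp_all add: dder_add generated.intros)

text \<open>
  A coefficient of \<open>u \<^sub>\<lambda> v\<close> with momentum \<open>\<sigma>\<close> is an interpolation combination of the products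
  \<open>D(u \<otimes> e\<^sup>r) \<cdot> (v \<otimes> e\<^sup>\<sigma>\<^sup>-\<^sup>r)\<close> with \<open>r = 0, 1, \<dots>\<close>.
\<close>
lemma generated_jet_letter_0: "v \<in> cspace V \<Longrightarrow> jet_letter v \<sigma> 0 \<in> generated"
proof (induction arbitrary: \<sigma> rule: generators_induct)
  case (generator x)
  then show ?case by (rule generated_jet_letter_generator)
next
  case (add u v)
  then show ?case using gen_cong[OF gen_add jet_letter_add] by blast
next
  case (scale c u)
  then show ?case using gen_cong[OF generated_dconst jet_letter_scale] by blast
next
  case (del u)
  then show ?case using gen_cong[OF generated_dconst jet_letter_del] by blast
next
  case (nprod u v n)
  define N where "N = Suc (max n (degree (clprod V u v)))"
  let ?f = "\<lambda>\<mu>. jet_letter u \<mu> 1 * jet_letter v (\<sigma> - \<mu>) 0"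
  have "?f \<mu> \<in> generated" for \<mu>
    using generated_dder[OF nprod.IH(1)[of \<mu>]] by (intro generated_mult nprod.IH) (simp add: dder_jet_letter)
  then have "DI.lagrange N ?f n \<in> generated"
    unfolding DI.lagrange_def by (intro generated_sum generated_dconst)
  moreover have "DI.lagrange N ?f n \<cong> jet_letter (coeff (clprod V u v) n) \<sigma> 0"
  proof (rule DI.lagrange_coeff)
    show "?f (of_nat r) \<cong> (\<Sum>i<N. dconst (of_nat r ^ i) * jet_letter (coeff (clprod V u v) i) \<sigma> 0)" for r
      using jet_letter_mult[OF nprod.hyps, of N "of_nat r" "\<sigma> - of_nat r"] by (simp add: N_def)
  qed (simp add: N_def)
  ultimately show ?case using gen_cong DI.cg_sym by blast
next
  case zero
  show ?case by (simp add: jet_letter_def gen_cong[OF gen_zero dletter_zero])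
qed

text \<open>
  Here \<open>a\<close> may be any element of the type of atoms; \<open>ascale 1 a\<close> is its projection, which has the same class.
\<close>
lemma generated_letter: "dletter a k \<in> generated"
proof -
  have "dletter (ascale 1 a) 0 \<in> generated"
  proof (induction a rule: poly_mapping_additive_induct)
    case (single i s)
    obtain v \<sigma> where i: "i = (v, \<sigma>)" by (cases i)
    have "ascale 1 (atom v \<sigma> s) = ascale s (letter v \<sigma>)" by (simp add: ascale_letter) (simp add: ascale_def)
    moreover have "dletter (letter v \<sigma>) 0 \<in> generated"
    proof (cases "v \<in> cspace V")
      case True
      then show ?thesis using generated_jet_letter_0 by (simp add: jet_letter_def)
    next
      case False
      then show ?thesis by (simp add: letter_outside gen_cong[OF gen_zero dletter_zero])
    qed
    ultimately show ?case using gen_cong[OF generated_dconst dletter_sc] by (simp add: i)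
  next
    case (add u v)
    then show ?case using gen_cong[OF gen_add dletter_add] by (simp add: NR.sc_add_right)
  qed
  then have "dletter a 0 \<in> generated"
    using gen_cong[OF _ DI.cg_sym[OF dletter_sc[of 1 a 0]]] by simp
  then have "(dder ^^ k) (dletter a 0) \<in> generated"
    by (induction k) (simp_all add: generated_dder)
  then show ?thesis by (simp add: dder_pow_dletter)
qed

lemma all_generated: "u \<in> generated"
proof (induction u rule: poly_mapping_additive_induct)
  case (single M s)
  have "dmono M \<in> generated"
  proof (induction M)
    case empty
    then show ?case using gen_mono[of "{#}" 1] by simp
  next
    case (add l M)
    then show ?case using generated_mult[OF generated_letter add] by (cases l) (simp add: dmono_add_mset)
  qed
  then show ?case by (simp add: single_eq_dmono generated_dconst)
qed (rule gen_add)

text \<open>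
  Since the monomials in the generators span everything modulo \<open>kern\<close>, they suffice as test elements.
\<close>
lemma test_generators:
  assumes "\<And>P m. \<forall>l\<in>#P. fst l \<in> X \<Longrightarrow> NR.eval (xmono P * (dder ^^ m) u) = 0"
  shows "u \<in> NR.kern"
proof -
  have "NR.eval (q * (dder ^^ m) u) = 0" for q m
    using all_generated[of q]
  proof (induction rule: generated.induct)
    case (gen_mono P s)
    then show ?case using assms by (simp add: mult.assoc NR.eval_dconst)
  next
    case (gen_cong q q')
    have "q' * (dder ^^ m) u - q * (dder ^^ m) u \<in> NR.kern"
      using DI.cg_mult[OF gen_cong(2) DI.cg_refl] by (simp add: DI.cg_def)
    then show ?case using NR.kern_eval gen_cong(3) by (fastforce simp: NR.eval_diff)
  qed (simp_all add: distrib_right NR.eval_add)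
  then show ?thesis by (simp add: NR.kern_def)
qed

definition order_bound :: nat where
  "order_bound = Suc (\<Sum>x\<in>X. \<Sum>y\<in>X. degree (clprod V x y))"

lemma degree_order_bound: "x \<in> X \<Longrightarrow> y \<in> X \<Longrightarrow> degree (clprod V x y) < order_bound"
proof -
  assume x: "x \<in> X" and y: "y \<in> X"
  have "degree (clprod V x y) \<le> (\<Sum>y\<in>X. degree (clprod V x y))"
    by (rule member_le_sum) (use y X_finite in auto)
  also have "\<dots> \<le> (\<Sum>x\<in>X. \<Sum>y\<in>X. degree (clprod V x y))"
    by (rule member_le_sum[of x X "\<lambda>x. \<Sum>y\<in>X. degree (clprod V x y)"]) (use x X_finite in auto)
  finally show ?thesis by (simp add: order_bound_def)
qed

lemma xmono_eq_dmono: "xmono P = dmono (image_mset (\<lambda>(x, \<alpha>, k). (letter x \<alpha>, k)) P)"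
  by (induction P) (auto simp: dmono_add_mset jet_letter_def)

text \<open>
  The locality of \<open>D x\<close> and \<open>y\<close> is the finiteness of the degree of \<open>x \<^sub>\<lambda> y\<close>, bounded over the finite set \<open>X\<close>.
\<close>
lemma local_letters: "local_letters dder NR.kern dconst X jet_letter order_bound NR.eval"
proof (intro local_letters.intro local_letters_axioms.intro DI.diff_ideal_axioms)
  fix x y assume x: "x \<in> X" and y: "y \<in> X"
  then show "\<exists>E. \<forall>\<alpha> \<beta>. DI.cg (jet_letter x \<alpha> 1 * jet_letter y \<beta> 0) (\<Sum>i<order_bound. dconst (\<alpha> ^ i) * E i (\<alpha> + \<beta>))"
    using X_in jet_letter_mult[OF _ _ degree_order_bound[OF x y]]
    by (intro exI[of _ "\<lambda>i \<sigma>. jet_letter (coeff (clprod V x y) i) \<sigma> 0"]) auto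
next
  fix P :: "('v \<times> 'k poly \<times> nat) multiset" and s
  assume P: "(\<Sum>(x, \<alpha>, k)\<in>#P. int k - 1) \<noteq> - 1"
  have "(\<Sum>l\<in>#image_mset (\<lambda>(x, \<alpha>, k). (letter x \<alpha>, k)) P. int (snd l) - 1) = (\<Sum>(x, \<alpha>, k)\<in>#P. int k - 1)"
    by (induction P) auto
  with P show "NR.eval (dconst s * xmono P) = 0"
    unfolding xmono_eq_dmono single_eq_dmono[symmetric] by (intro NR.eval_weight) simp
qed (simp_all add: dder_jet_letter NR.eval_add NR.kern_eval test_generators)

definition generator_jets :: "('k poly \<Rightarrow> (('k, 'v) atoms, 'k poly) dpoly) set" where
  "generator_jets = {\<lambda>\<sigma>. jet_letter x \<sigma> k | x k. x \<in> X}"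

lemma field_algebra_generators:
  "field_algebra dder NR.kern dconst generator_jets"
proof (intro field_algebra.intro field_algebra_axioms.intro DI.diff_ideal_axioms)
  interpret LL: local_letters dder NR.kern dconst X jet_letter order_bound NR.eval by (rule local_letters)
  fix b c assume "b \<in> generator_jets" "c \<in> generator_jets"
  then obtain x p y q where bc: "b = (\<lambda>\<sigma>. jet_letter x \<sigma> p)" "c = (\<lambda>\<sigma>. jet_letter y \<sigma> q)" "x \<in> X" "y \<in> X"
    unfolding generator_jets_def by blast
  obtain B where "\<forall>x\<in>X. \<forall>y\<in>X. \<exists>E. \<forall>\<mu> \<sigma>. jet_letter x \<mu> p * jet_letter y (\<sigma> - \<mu>) q \<cong> (\<Sum>i<B. dconst (\<mu> ^ i) * E i \<sigma>)"
    using LL.letters_local by blast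
  then obtain E where "\<And>\<mu> \<sigma>. jet_letter x \<mu> p * jet_letter y (\<sigma> - \<mu>) q \<cong> (\<Sum>i<B. dconst (\<mu> ^ i) * E i \<sigma>)"
    using bc by blast
  then show "\<exists>N. \<forall>\<sigma>. DI.poly_mod N (\<lambda>\<mu>. b \<mu> * c (\<sigma> - \<mu>))"
    unfolding DI.poly_mod_def bc by (intro exI[of _ B] allI, rule_tac x = "\<lambda>i. E i \<sigma>" in exI, simp)
next
  fix c assume "c \<in> generator_jets"
  then obtain x k where "c = (\<lambda>\<sigma>. jet_letter x \<sigma> k)" "x \<in> X"
    unfolding generator_jets_def by blast
  then have "(\<lambda>\<sigma>. dder (c \<sigma>)) = (\<lambda>\<sigma>. jet_letter x \<sigma> (Suc k))" "x \<in> X"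
    by (simp_all add: dder_jet_letter)
  then show "(\<lambda>\<sigma>. dder (c \<sigma>)) \<in> generator_jets"
    unfolding generator_jets_def by blast
qed

text \<open>
  The embedding sends \<open>v\<close> to the field \<open>\<sigma> \<mapsto> v \<otimes> e\<^sup>\<sigma>\<close>. It turns the product of \<open>V\<close> into \<open>D(\<cdot>) \<^sub>\<lambda> (\<cdot>)\<close> by
  \<open>kern_product\<close>, and it is injective because of the value at the generic momentum.
\<close>
theorem special_V: "special V"
proof -
  interpret FA: field_algebra dder NR.kern dconst generator_jets
    by (rule field_algebra_generators)
  interpret CF: conformal_algebra FA.field_conformal by (rule FA.conformal_fields)
  define f where "f v = (\<lambda>\<sigma>. FA.rep (jet_letter v \<sigma> 0))" for v
  have f_add: "f (u + v) = f u + f v" if "u \<in> cspace V" "v \<in> cspace V" for u v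
    unfolding f_def plus_fun_def FA.rep_add[symmetric] FA.rep_eq_iff fun_eq_iff using jet_letter_add[OF that] by blast
  have f_scale: "f (cscale V c u) = FA.fscale c (f u)" if "u \<in> cspace V" for c u
    unfolding f_def FA.fscale_def FA.rep_scale[symmetric] FA.rep_eq_iff fun_eq_iff using jet_letter_scale[OF that] by blast
  have f_del: "f (cdel V u) = FA.fdel (f u)" if "u \<in> cspace V" for u
    unfolding f_def FA.fdel_def FA.rep_eq_iff fun_eq_iff
    using DI.cg_trans[OF jet_letter_del[OF that] DI.cg_mult_left[OF DI.cg_sym[OF FA.rep_cg]]] by blast
  have f_zero: "f 0 = 0"
    using f_add[OF zero_in zero_in] by simp
  have f_rep: "f v \<sigma> \<cong> jet_letter v \<sigma> 0" for v \<sigma> by (simp add: f_def)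
  have df: "FA.fder (f v) \<sigma> \<cong> jet_letter v \<sigma> 1" for v \<sigma>
  proof -
    have "FA.fder (f v) \<sigma> \<cong> dder (f v \<sigma>)" by (simp add: FA.fder_def)
    also have "\<dots> \<cong> dder (jet_letter v \<sigma> 0)" by (intro DI.cg_D f_rep)
    finally show ?thesis by (simp add: dder_jet_letter)
  qed
  have f_prod: "(\<Sum>i<N. dconst (\<mu> ^ i) * f (coeff (clprod V a b) i) \<sigma>) \<cong> FA.fder (f a) \<mu> * f b (\<sigma> - \<mu>)"
    if a: "a \<in> cspace V" and b: "b \<in> cspace V" and N: "degree (clprod V a b) < N" for a b N \<mu> \<sigma>
  proof -
    have "(\<Sum>i<N. dconst (\<mu> ^ i) * f (coeff (clprod V a b) i) \<sigma>) \<cong> (\<Sum>i<N. dconst (\<mu> ^ i) * jet_letter (coeff (clprod V a b) i) \<sigma> 0)"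
      by (intro DI.cg_sum DI.cg_mult_left f_rep)
    also have "\<dots> \<cong> jet_letter a \<mu> 1 * jet_letter b (\<sigma> - \<mu>) 0"
      using DI.cg_sym[OF jet_letter_mult[OF a b N, of \<mu> "\<sigma> - \<mu>"]] by simp
    also have "\<dots> \<cong> FA.fder (f a) \<mu> * f b (\<sigma> - \<mu>)"
      by (intro DI.cg_mult DI.cg_sym[OF df] DI.cg_sym[OF f_rep])
    finally show ?thesis .
  qed
  have f_in: "f v \<in> FA.fields" if "v \<in> cspace V" for v
    using that
  proof (induction rule: generators_induct)
    case (generator x)
    then show ?case unfolding f_def by (intro FA.fld_gen) (auto simp: generator_jets_def)
  next
    case (add u v)
    show ?case unfolding f_add[OF add(1,2)] by (intro FA.fld_add add)
  next
    case (scale c u)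
    show ?case unfolding f_scale[OF scale(1)] by (intro FA.fld_scale scale)
  next
    case (del u)
    show ?case unfolding f_del[OF del(1)] by (intro FA.fld_del del)
  next
    case (nprod u v n)
    obtain N where N: "n < N" "degree (clprod V u v) < N"
      by (rule that[of "Suc (n + degree (clprod V u v))"]) simp_all
    have eq: "f (coeff (clprod V u v) n) = FA.fcoeff N (FA.fder (f u)) (f v) n"
    proof
      fix \<sigma>
      have "DI.lagrange N (\<lambda>\<mu>. FA.fder (f u) \<mu> * f v (\<sigma> - \<mu>)) n \<cong> f (coeff (clprod V u v) n) \<sigma>"
        by (rule DI.lagrange_coeff[OF DI.cg_sym[OF f_prod[OF nprod(1,2) N(2)]] N(1)])
      then have "FA.rep (f (coeff (clprod V u v) n) \<sigma>) = FA.fcoeff N (FA.fder (f u)) (f v) n \<sigma>"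
        by (simp add: FA.fcoeff_def FA.rep_eq_iff DI.cg_sym)
      then show "f (coeff (clprod V u v) n) \<sigma> = FA.fcoeff N (FA.fder (f u)) (f v) n \<sigma>"
        by (simp add: f_def)
    qed
    show ?case unfolding eq by (intro FA.fcoeff_in FA.fder_in nprod)
  next
    case zero
    show ?case unfolding f_zero by (rule FA.fld_zero)
  qed
  have f_fprod: "FA.fprod (FA.fder (f a)) (f b) = map_poly f (clprod V a b)"
    if a: "a \<in> cspace V" and b: "b \<in> cspace V" for a b
  proof (rule FA.ev_unique)
    show "FA.fprod (FA.fder (f a)) (f b) \<in> polys_over FA.Q"
      by (intro FA.fprod_Q FA.fder_in f_in a b)
    show "map_poly f (clprod V a b) \<in> polys_over FA.Q"
      by (simp add: polys_over_def coeff_map_poly f_zero) (simp add: f_def)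
    fix \<mu> \<sigma>
    have "FA.ev \<mu> \<sigma> (map_poly f (clprod V a b)) = psum (\<lambda>i v. dconst (\<mu> ^ i) * f v \<sigma>) (clprod V a b)"
      unfolding FA.ev_def by (rule psum_map_poly) (simp_all add: f_zero)
    also have "\<dots> = (\<Sum>i<Suc (degree (clprod V a b)). dconst (\<mu> ^ i) * f (coeff (clprod V a b) i) \<sigma>)"
      by (rule psum_lessThan) (simp_all add: f_zero)
    also have "\<dots> \<cong> FA.fder (f a) \<mu> * f b (\<sigma> - \<mu>)"
      by (rule f_prod[OF a b]) simp
    finally have "FA.ev \<mu> \<sigma> (map_poly f (clprod V a b)) \<cong> FA.fder (f a) \<mu> * f b (\<sigma> - \<mu>)" .
    then show "FA.ev \<mu> \<sigma> (FA.fprod (FA.fder (f a)) (f b)) \<cong> FA.ev \<mu> \<sigma> (map_poly f (clprod V a b))"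
      using FA.ev_fprod[OF FA.fder_in[OF f_in[OF a]] f_in[OF b]] DI.cg_trans DI.cg_sym by blast
  qed
  have f_nprod: "nprod (derived_algebra FA.field_conformal FA.fder) (f a) n (f b) = f (nprod V a n b)"
    if "a \<in> cspace V" "b \<in> cspace V" for a b n
    using that by (simp add: nprod_def derived_algebra_def f_fprod coeff_map_poly f_zero f_scale clprod_closed)
  have f_inj: "inj_on f (cspace V)"
  proof (rule inj_onI)
    fix u v assume u: "u \<in> cspace V" and v: "v \<in> cspace V" and eq: "f u = f v"
    have "f (u - v) = 0"
      using f_add[OF diff_in[OF u v] v] eq by simp
    then have "FA.rep (jet_letter (u - v) [:0, 1:] 0) = 0" by (simp add: f_def fun_eq_iff)
    then have "ascale 1 (letter (u - v) [:0, 1:]) = 0"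
      by (intro NR.kern_letter_zero) (simp add: FA.rep_eq_0 jet_letter_def)
    then have "u - v = 0" by (rule letter_generic_zero[OF diff_in[OF u v]])
    then show "u = v" by simp
  qed
  have sub: "conformal_subalgebra (derived_algebra FA.field_conformal FA.fder) (f ` cspace V)"
    unfolding conformal_subalgebra_def
  proof (intro conjI ballI allI)
    show "f ` cspace V \<subseteq> cspace (derived_algebra FA.field_conformal FA.fder)"
      using f_in by (auto simp: derived_algebra_def)
    have "CF.subspace (f ` cspace V)"
    proof (rule CF.subspaceI)
      show "0 \<in> f ` cspace V" using f_zero zero_in by (metis imageI)
      show "x + y \<in> f ` cspace V" if xy: "x \<in> f ` cspace V" "y \<in> f ` cspace V" for x y
      proof -
        obtain u v where uv: "x = f u" "u \<in> cspace V" "y = f v" "v \<in> cspace V" using xy by blast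
        show ?thesis unfolding uv(1,3) f_add[OF uv(2,4), symmetric] by (intro imageI add_in uv)
      qed
      show "cscale FA.field_conformal c x \<in> f ` cspace V" if x: "x \<in> f ` cspace V" for c x
      proof -
        obtain u where u: "x = f u" "u \<in> cspace V" using x by blast
        show ?thesis unfolding u(1) FA.field_conformal_sel f_scale[OF u(2), symmetric] by (intro imageI scale_in u)
      qed
    qed
    then show "module.subspace (cscale (derived_algebra FA.field_conformal FA.fder)) (f ` cspace V)"
      by (simp add: derived_algebra_def)
    show "cdel (derived_algebra FA.field_conformal FA.fder) x \<in> f ` cspace V" if x: "x \<in> f ` cspace V" for x
    proof -
      obtain u where u: "x = f u" "u \<in> cspace V" using x by blast
      have "cdel (derived_algebra FA.field_conformal FA.fder) x = f (cdel V u)"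
        by (simp add: derived_algebra_def u f_del)
      then show ?thesis using del_in[OF u(2)] by simp
    qed
    show "nprod (derived_algebra FA.field_conformal FA.fder) x n y \<in> f ` cspace V" if xy: "x \<in> f ` cspace V" "y \<in> f ` cspace V" for x y n
    proof -
      obtain u v where uv: "x = f u" "u \<in> cspace V" "y = f v" "v \<in> cspace V" using xy by blast
      show ?thesis unfolding uv(1,3) f_nprod[OF uv(2,4)]
        by (intro imageI) (simp add: nprod_def scale_in clprod_closed uv)
    qed
  qed
  have "conformal_iso V ((derived_algebra FA.field_conformal FA.fder)\<lparr>cspace := f ` cspace V\<rparr>) f"
    unfolding conformal_iso_def conformal_hom_def linear_between_def
  proof (intro conjI ballI allI)
    show "bij_betw f (cspace V) (cspace ((derived_algebra FA.field_conformal FA.fder)\<lparr>cspace := f ` cspace V\<rparr>))"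
      using f_inj by (simp add: bij_betw_def)
    show "f (nprod V a n b) = nprod ((derived_algebra FA.field_conformal FA.fder)\<lparr>cspace := f ` cspace V\<rparr>) (f a) n (f b)"
      if "a \<in> cspace V" "b \<in> cspace V" for a b n
      using f_nprod[OF that, of n] by (simp add: nprod_def)
  qed (simp_all add: f_add f_scale f_del derived_algebra_def)
  then have "special_via V FA.field_conformal FA.fder (f ` cspace V) f"
    using FA.commutative_fields FA.derivation_fields sub by (simp add: special_via_def)
  then show ?thesis by (rule special_universal)
qed

end

theorem corollary4p3:
  fixes V :: "('k :: field_char_0, 'v :: ab_group_add) conformal"
  assumes "novikov_conformal_algebra V"
    and "finitely_generated V"
  shows "special V"
proof -
  obtain X where "finite X" "X \<subseteq> cspace V" "conformal_subalgebra V hull X = cspace V"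
    using assms(2) by (auto simp: finitely_generated_def)
  then interpret generated_novikov V X
    using assms(1) by (intro generated_novikov.intro generated_novikov_axioms.intro)
  show ?thesis by (rule special_V)
qed

end
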